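(* Let $\Sigma=(\widetilde{\mathbf{x}},\Lambda,\widetilde{B})$ be an acyclic quantum seed with principal coefficients, with indices ordered so that $b_{ij}\ge 0$ for all $n\ge i>j\ge 1$. Then the projective standard monomials in $x_1,x_1^{(n)},\dots,x_n,x_n^{(n)}$, i.e. the elements $$x_1^{a_1}\cdots x_n^{a_n}(x_1^{(n)})^{a_1^{(n)}}\cdots(x_n^{(n)})^{a_n^{(n)}}$$ with all exponents non-negative integers and $a_ka_k^{(n)}=0$ for all $k\in[1,n]$, form a $\mathbb{ZP}$-basis of the quantum cluster algebra $\mathcal{A}(\Sigma)$.
   Context: Notation: $[s,t]=\{s,s+1,\dots,t\}$; $[x]_+=\max(x,0)$, applied entrywise to vectors; $\mathbf{e}_i$ is the $i$-th unit vector. Quantum seeds. Let $\widetilde{B}=(b_{ij})$ be a $2n\times n$ integer matrix with columns $\mathbf{b}_1,\dots,\mathbf{b}_n$, whose upper $n\times n$ part $B$ is skew-symmetrizable: $DB$ is skew-symmetric for $D=\mathrm{diag}(d_1,\dots,d_n)$ with positive integer $d_j$. "Principal coefficients" means that the lower $n\times n$ part of $\widetilde{B}$ is the identity, i.e. $b_{n+i,j}=\delta_{ij}$. Let $\Lambda=(\lambda_{ij})$ be a skew-symmetric $2n\times 2n$ integer matrix, identified with the bilinear form on $\mathbb{Z}^{2n}$ with $\Lambda(\mathbf{e}_i,\mathbf{e}_j)=\lambda_{ij}$, compatible with $\widetilde{B}$: $\Lambda(\mathbf{b}_j,\mathbf{e}_i)=\delta_{ij}d_j$ for $i\in[1,2n]$,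 $j\in[1,n]$. The quantum torus $\mathcal{T}$ is the $\mathbb{Z}[q^{\pm 1/2}]$-algebra with basis $\{X^{\mathbf{a}}:\mathbf{a}\in\mathbb{Z}^{2n}\}$ and product $X^{\mathbf{a}}X^{\mathbf{c}}=q^{\Lambda(\mathbf{a},\mathbf{c})/2}X^{\mathbf{a}+\mathbf{c}}$; $\mathcal{F}$ is its skew-field of fractions and $x_i=X^{\mathbf{e}_i}$, so $x_ix_j=q^{\lambda_{ij}}x_jx_i$ and $X^{\mathbf{a}}=q^{\frac12\sum_{l<k}a_ka_l\lambda_{kl}}x_1^{a_1}\cdots x_{2n}^{a_{2n}}$. The triple $\Sigma=(\widetilde{\mathbf{x}},\Lambda,\widetilde{B})$ with $\widetilde{\mathbf{x}}=\{x_1,\dots,x_{2n}\}$ is a quantum seed; $x_1,\dots,x_n$ are its quantum cluster variables and $x_{n+1},\dots,x_{2n}$ its frozen variables. $\mathbb{ZP}=\mathbb{Z}[q^{\pm1/2}][x_{n+1}^{\pm1},\dots,x_{2n}^{\pm1}]$, a (quasi-commutative) subring of $\mathcal{F}$; coefficients from $\mathbb{ZP}$ are written on the left. Mutation. For $k\in[1,n]$, the mutation $\mu_k$ replaces $x_k$ by $x_k'=X^{-\mathbf{e}_k+[\mathbf{b}_k]_+}+X^{-\mathbf{e}_k+[-\mathbf{b}_k]_+}$, replaces $\widetilde{B}$ by $\widetilde{B}'$ with $b'_{ij}=-b_{ij}$ if $i=k$ or $j=k$, and $b'_{ij}=b_{ij}+\frac{|b_{ik}|b_{kj}+b_{ik}|b_{kj}|}{2}$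 otherwise, and replaces $\Lambda$ by the skew-symmetric $\Lambda'$ with $\lambda'_{ij}=\lambda_{ij}$ for $i,j\ne k$ and $\lambda'_{kj}=-\lambda_{kj}+\sum_{t}[b_{tk}]_+\lambda_{tj}$ for $j\neq k$. The same rule applies to any seed obtained by mutation, with $X^{\mathbf{a}}$ formed from the variables and form of that seed by the normalized ordered monomial formula above. The quantum cluster algebra $\mathcal{A}(\Sigma)$ is the $\mathbb{ZP}$-subalgebra of $\mathcal{F}$ generated by all quantum cluster variables of all quantum seeds obtained from $\Sigma$ by finite sequences of mutations. A seed is acyclic if the directed graph on $[1,n]$ with an edge $i\to j$ whenever $b_{ij}>0$ has no oriented cycle; in this case, after reordering, one assumes $b_{ij}\ge0$ for all $i>j$ in $[1,n]$. Projective cluster variables. For $i\in[1,n]$ put $\Sigma^{(i)}=(\widetilde{\mathbf{x}}^{(i)},\Lambda^{(i)},\widetilde{B}^{(i)})=\mu_i\cdots\mu_2\mu_1(\Sigma)$ ($\mu_1$ is applied first), with $\widetilde{\mathbf{x}}^{(i)}=\{x_1^{(i)},\dots,x_{2n}^{(i)}\}$. The elements $x_1^{(n)},\dots,x_n^{(n)}$ of the cluster of $\Sigma^{(n)}$ are the quantum projective cluster variables. *)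

theory Defs
  imports Main
begin

section \<open>Subrings and left modules inside a skew field\<close>

inductive_set subring_generated :: "'f::ring_1 set \<Rightarrow> 'f set" for G :: "'f set" where
  gen: "g \<in> G \<Longrightarrow> g \<in> subring_generated G"
| one: "1 \<in> subring_generated G"
| diff: "u \<in> subring_generated G \<Longrightarrow> v \<in> subring_generated G \<Longrightarrow> u - v \<in> subring_generated G"
| mult: "u \<in> subring_generated G \<Longrightarrow> v \<in> subring_generated G \<Longrightarrow> u * v \<in> subring_generated G"

text \<open>
  The coefficient ring \<open>R\<close> may be noncommutative, so the library's modules (which are over
  commutative rings) do not apply. Linear independence is that of the indexed family \<open>f\<close>; in
  particular it makes \<open>f\<close> injective on \<open>I\<close>.
\<close>

definition left_span :: "'f::ring_1 set \<Rightarrow> ('i \<Rightarrow> 'f) \<Rightarrow> 'i set \<Rightarrow> 'f set" where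
  "left_span R f I = {\<Sum>i\<in>J. c i * f i | J c. finite J \<and> J \<subseteq> I \<and> (\<forall>i\<in>J. c i \<in> R)}"

definition left_independent :: "'f::ring_1 set \<Rightarrow> ('i \<Rightarrow> 'f) \<Rightarrow> 'i set \<Rightarrow> bool" where
  "left_independent R f I \<longleftrightarrow>
     (\<forall>J c. finite J \<longrightarrow> J \<subseteq> I \<longrightarrow> (\<forall>i\<in>J. c i \<in> R) \<longrightarrow> (\<Sum>i\<in>J. c i * f i) = 0 \<longrightarrow>
        (\<forall>i\<in>J. c i = 0))"

definition left_basis :: "'f::ring_1 set \<Rightarrow> ('i \<Rightarrow> 'f) \<Rightarrow> 'i set \<Rightarrow> 'f set \<Rightarrow> bool" where
  "left_basis R f I M \<longleftrightarrow> left_independent R f I \<and> left_span R f I = M"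

section \<open>The quantum torus and its skew field of fractions\<close>

text \<open>
  Indices run over \<open>1, 2, \<dots>\<close>; a vector of \<open>\<int>\<^sup>m\<close> is a function vanishing outside \<open>{1..m}\<close>.
  Matrices are functions of which only the entries with indices in range are used.
\<close>

definition int_lattice :: "nat \<Rightarrow> (nat \<Rightarrow> int) set" where
  "int_lattice m = {a. \<forall>i. i \<notin> {1..m} \<longrightarrow> a i = 0}"

definition unit_vector :: "nat \<Rightarrow> nat \<Rightarrow> int" where
  "unit_vector i = (\<lambda>j. if j = i then 1 else 0)"

definition bilinear_form :: "nat \<Rightarrow> (nat \<Rightarrow> nat \<Rightarrow> int) \<Rightarrow> (nat \<Rightarrow> int) \<Rightarrow> (nat \<Rightarrow> int) \<Rightarrow> int" where
  "bilinear_form m \<Lambda> a c = (\<Sum>i=1..m. \<Sum>j=1..m. a i * c j * \<Lambda> i j)"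

text \<open>
  Throughout, \<open>qh\<close> is the square root of \<open>q\<close>.

  The skew field of fractions is determined up to unique isomorphism by containing the quantum
  torus \<open>T\<close> and consisting of the fractions \<open>u v\<inverse>\<close> with \<open>u, v \<in> T\<close>. So it is taken to be any skew
  field \<open>'f\<close> with these properties, and \<open>T\<close> is a subring of it. The torus is the free module over
  the ring of integer Laurent polynomials in \<open>qh\<close>: assumption \<open>transcendental\<close> (with
  characteristic zero) says that the subring generated by \<open>qh\<close> and its inverse is this Laurent
  polynomial ring, and \<open>independent\<close> that the \<open>X a\<close> form a basis of \<open>T\<close> over it.
\<close>

definition laurent_ring :: "'f::division_ring \<Rightarrow> 'f set" where
  "laurent_ring qh = subring_generated {qh, inverse qh}"

locale quantum_torus_fractions =
  fixes m :: nat
    and \<Lambda> :: "nat \<Rightarrow> nat \<Rightarrow> int"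
    and qh :: "'f::{division_ring, ring_char_0}"
    and X :: "(nat \<Rightarrow> int) \<Rightarrow> 'f"
  assumes qh_nonzero: "qh \<noteq> 0"
    and transcendental: "left_independent \<int> (\<lambda>k::int. qh powi k) UNIV"
    and independent: "left_independent (laurent_ring qh) X (int_lattice m)"
    and qh_central: "a \<in> int_lattice m \<Longrightarrow> qh * X a = X a * qh"
    and product: "a \<in> int_lattice m \<Longrightarrow> c \<in> int_lattice m \<Longrightarrow>
      X a * X c = qh powi bilinear_form m \<Lambda> a c * X (\<lambda>i. a i + c i)"
    and fractions: "\<exists>u \<in> left_span (laurent_ring qh) X (int_lattice m).
      \<exists>v \<in> left_span (laurent_ring qh) X (int_lattice m). v \<noteq> 0 \<and> z = u * inverse v"

section \<open>Quantum seeds and mutation\<close>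

record 'f quantum_seed =
  cluster :: "nat \<Rightarrow> 'f"
  qform :: "nat \<Rightarrow> nat \<Rightarrow> int"
  exch :: "nat \<Rightarrow> nat \<Rightarrow> int"

definition skew_symmetric :: "nat \<Rightarrow> (nat \<Rightarrow> nat \<Rightarrow> int) \<Rightarrow> bool" where
  "skew_symmetric m A \<longleftrightarrow> (\<forall>i\<in>{1..m}. \<forall>j\<in>{1..m}. A i j = - A j i)"

definition compatible ::
    "nat \<Rightarrow> (nat \<Rightarrow> int) \<Rightarrow> (nat \<Rightarrow> nat \<Rightarrow> int) \<Rightarrow> (nat \<Rightarrow> nat \<Rightarrow> int) \<Rightarrow> bool" where
  "compatible n d \<Lambda> B \<longleftrightarrow>
     (\<forall>i\<in>{1..2*n}. \<forall>j\<in>{1..n}.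
        bilinear_form (2*n) \<Lambda> (\<lambda>t. B t j) (unit_vector i) = (if i = j then d j else 0))"

definition principal_coefficients :: "nat \<Rightarrow> (nat \<Rightarrow> nat \<Rightarrow> int) \<Rightarrow> bool" where
  "principal_coefficients n B \<longleftrightarrow>
     (\<forall>i\<in>{1..n}. \<forall>j\<in>{1..n}. B (n + i) j = (if i = j then 1 else 0))"

definition acyclic_exch :: "nat \<Rightarrow> (nat \<Rightarrow> nat \<Rightarrow> int) \<Rightarrow> bool" where
  "acyclic_exch n B \<longleftrightarrow> acyclic {(i, j). i \<in> {1..n} \<and> j \<in> {1..n} \<and> B i j > 0}"

definition initial_seed ::
    "((nat \<Rightarrow> int) \<Rightarrow> 'f) \<Rightarrow> (nat \<Rightarrow> nat \<Rightarrow> int) \<Rightarrow> (nat \<Rightarrow> nat \<Rightarrow> int) \<Rightarrow> 'f quantum_seed" where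
  "initial_seed X \<Lambda> B = \<lparr>cluster = \<lambda>i. X (unit_vector i), qform = \<Lambda>, exch = B\<rparr>"

text \<open>
  The normalized monomial of exponent \<open>a\<close> in the variables of a seed: the factors are multiplied
  in increasing order of the index.
\<close>

definition seed_monomial ::
    "nat \<Rightarrow> 'f::division_ring \<Rightarrow> 'f quantum_seed \<Rightarrow> (nat \<Rightarrow> int) \<Rightarrow> 'f" where
  "seed_monomial n qh S a =
     qh powi (\<Sum>k=1..2*n. \<Sum>l=1..<k. a k * a l * qform S k l) *
     prod_list (map (\<lambda>i. cluster S i powi a i) [1..<Suc (2*n)])"

definition mutated_var :: "nat \<Rightarrow> 'f::division_ring \<Rightarrow> nat \<Rightarrow> 'f quantum_seed \<Rightarrow> 'f" where
  "mutated_var n qh k S =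
     seed_monomial n qh S (\<lambda>i. - unit_vector k i + max (exch S i k) 0) +
     seed_monomial n qh S (\<lambda>i. - unit_vector k i + max (- exch S i k) 0)"

text \<open>The division by 2 is exact: the numerator is always even.\<close>

definition mutated_exch :: "nat \<Rightarrow> (nat \<Rightarrow> nat \<Rightarrow> int) \<Rightarrow> nat \<Rightarrow> nat \<Rightarrow> int" where
  "mutated_exch k B i j =
     (if i = k \<or> j = k then - B i j
      else B i j + (\<bar>B i k\<bar> * B k j + B i k * \<bar>B k j\<bar>) div 2)"

definition mutated_form_row ::
    "nat \<Rightarrow> nat \<Rightarrow> (nat \<Rightarrow> nat \<Rightarrow> int) \<Rightarrow> (nat \<Rightarrow> nat \<Rightarrow> int) \<Rightarrow> nat \<Rightarrow> int" where
  "mutated_form_row n k B \<Lambda> j = - \<Lambda> k j + (\<Sum>t=1..2*n. max (B t k) 0 * \<Lambda> t j)"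

definition mutated_form ::
    "nat \<Rightarrow> nat \<Rightarrow> (nat \<Rightarrow> nat \<Rightarrow> int) \<Rightarrow> (nat \<Rightarrow> nat \<Rightarrow> int) \<Rightarrow> nat \<Rightarrow> nat \<Rightarrow> int" where
  "mutated_form n k B \<Lambda> i j =
     (if i = k \<and> j = k then 0
      else if i = k then mutated_form_row n k B \<Lambda> j
      else if j = k then - mutated_form_row n k B \<Lambda> i
      else \<Lambda> i j)"

definition mutate ::
    "nat \<Rightarrow> 'f::division_ring \<Rightarrow> nat \<Rightarrow> 'f quantum_seed \<Rightarrow> 'f quantum_seed" where
  "mutate n qh k S =
     \<lparr>cluster = (cluster S)(k := mutated_var n qh k S),
      qform = mutated_form n k (exch S) (qform S),
      exch = mutated_exch k (exch S)\<rparr>"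

section \<open>The quantum cluster algebra\<close>

definition ZP :: "nat \<Rightarrow> 'f::division_ring \<Rightarrow> 'f quantum_seed \<Rightarrow> 'f set" where
  "ZP n qh S =
     subring_generated
       ({qh, inverse qh} \<union> cluster S ` {n+1..2*n} \<union> (\<lambda>i. inverse (cluster S i)) ` {n+1..2*n})"

definition quantum_cluster_variables :: "nat \<Rightarrow> 'f::division_ring \<Rightarrow> 'f quantum_seed \<Rightarrow> 'f set" where
  "quantum_cluster_variables n qh S =
     {cluster (fold (mutate n qh) ks S) i | ks i. set ks \<subseteq> {1..n} \<and> i \<in> {1..n}}"

definition quantum_cluster_algebra :: "nat \<Rightarrow> 'f::division_ring \<Rightarrow> 'f quantum_seed \<Rightarrow> 'f set" where
  "quantum_cluster_algebra n qh S =
     subring_generated (ZP n qh S \<union> quantum_cluster_variables n qh S)"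

section \<open>Projective standard monomials\<close>

text \<open>\<open>fold\<close> processes the list from the left, so the mutation at 1 is applied first.\<close>

definition projective_seed ::
    "nat \<Rightarrow> 'f::division_ring \<Rightarrow> 'f quantum_seed \<Rightarrow> nat \<Rightarrow> 'f quantum_seed" where
  "projective_seed n qh S i = fold (mutate n qh) [1..<Suc i] S"

definition projective_variable :: "nat \<Rightarrow> 'f::division_ring \<Rightarrow> 'f quantum_seed \<Rightarrow> nat \<Rightarrow> 'f" where
  "projective_variable n qh S k = cluster (projective_seed n qh S n) k"

definition standard_exponents :: "nat \<Rightarrow> ((nat \<Rightarrow> nat) \<times> (nat \<Rightarrow> nat)) set" where
  "standard_exponents n =
     {(a, a'). (\<forall>k. k \<notin> {1..n} \<longrightarrow> a k = 0 \<and> a' k = 0) \<and> (\<forall>k\<in>{1..n}. a k * a' k = 0)}"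

fun projective_standard_monomial ::
    "nat \<Rightarrow> 'f::division_ring \<Rightarrow> 'f quantum_seed \<Rightarrow> (nat \<Rightarrow> nat) \<times> (nat \<Rightarrow> nat) \<Rightarrow> 'f" where
  "projective_standard_monomial n qh S (a, a') =
     prod_list (map (\<lambda>i. cluster S i ^ a i) [1..<Suc n]) *
     prod_list (map (\<lambda>i. projective_variable n qh S i ^ a' i) [1..<Suc n])"

end

theory Submission
  imports Defs "HOL-Library.Function_Algebras"
begin

text \<open>
  A seed is studied through its toric frame \<open>M\<close>, the map \<open>a \<mapsto> X\<^sup>a\<close>. Mutation at \<open>k\<close> turns \<open>M\<close> into
  \<open>a \<mapsto> M (\<phi> a) * r (a k)\<close>, where \<open>\<phi>\<close> is a tropical involution and \<open>r t\<close> is a rational function of the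
  single monomial \<open>M b\<^sub>k\<close>, namely a polynomial with constant term 1 if \<open>t \<ge> 0\<close>. Comparing
  \<open>x\<^sub>k\<close>-degrees shows that an element of both tori has its component of degree \<open>- t\<close> divisible by \<open>r t\<close>.

  In rank two this implies that an element common to the tori of a seed and of its mutations at \<open>j\<close>
  and at \<open>k\<close> also lies in the torus obtained by mutating at \<open>j\<close> and then at \<open>k\<close>. Hence the upper bound, the
  intersection of the tori of a seed and of its neighbours, does not depend on the seed, and it
  contains all cluster variables.

  In the acyclic case with principal coefficients, the projective variable \<open>z\<^sub>k\<close> is \<open>x\<^sub>k\<inverse>\<close> plus terms
  containing the frozen variable \<open>x\<^sub>n\<^sub>+\<^sub>k\<close>. So the standard monomials have distinct leading monomials
  with respect to the degree in the frozen variables and are independent. To see that they span the upper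
  bound, the indices \<open>k\<close> are treated one at a time: the component of lowest \<open>x\<^sub>k\<close>-degree \<open>- t\<close> is
  divisible by \<open>r t\<close>, the quotient is the value at \<open>x\<^sub>k = 0\<close> of a combination \<open>w\<close> of standard monomials
  times \<open>x\<^sub>k\<close> to the power \<open>- t\<close>, and subtracting \<open>w z\<^sub>k\<^sup>t\<close> raises the lowest degree.
\<close>

section \<open>Additive spans\<close>

text \<open>No straightening relation for products such as \<open>x_k * z_k\<close> is computed. The
  induction compares \<open>U i\<close>, the elements of the torus that also lie in the tori mutated
  at \<open>1, ..., i\<close>, with \<open>V i\<close>, the span of standard monomials in the first
  \<open>i\<close> pairs of variables. A product that is not standard lies in \<open>U i\<close>
  because its factors do, and the inclusion in \<open>V i\<close> from the previous stage expands
  it.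

  Compatibility does two jobs. It makes Laurent polynomials in \<open>M b_k\<close> commute with
  everything of \<open>x_k\<close>-degree 0, so that right division by \<open>r t\<close> behaves as
  over a commutative ring. It also provides a linear functional positive on \<open>b_k\<close>, for
  which \<open>r t\<close> with \<open>t \<ge> 0\<close> has leading term 1.

  The delicate point at \<open>x_k = 0\<close> is that standard monomials must stay independent
  modulo \<open>r t\<close>, whose exponents are multiples of \<open>b_k\<close>. For the neighbours
  \<open>l < k\<close>, whose variables occur in \<open>M b_k\<close>, the variable
  \<open>z_l\<close> reduces to the inverse of \<open>x_l\<close> and moves into the
  coefficients.\<close>

inductive_set additive_span :: "'f::ring_1 set \<Rightarrow> 'f set" for G :: "'f set" where
  gen: "g \<in> G \<Longrightarrow> g \<in> additive_span G"
| zero: "0 \<in> additive_span G"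
| diff: "u \<in> additive_span G \<Longrightarrow> v \<in> additive_span G \<Longrightarrow> u - v \<in> additive_span G"

lemma additive_span_minus: "u \<in> additive_span G \<Longrightarrow> - u \<in> additive_span G"
  using additive_span.diff[OF additive_span.zero, of u] by simp

lemma additive_span_add:
  "u \<in> additive_span G \<Longrightarrow> v \<in> additive_span G \<Longrightarrow> u + v \<in> additive_span G"
  using additive_span.diff[OF _ additive_span_minus, of u G v] by simp

lemma additive_span_sum:
  "(\<And>i. i \<in> I \<Longrightarrow> f i \<in> additive_span G) \<Longrightarrow> sum f I \<in> additive_span G"
  by (induction I rule: infinite_finite_induct)
     (auto intro: additive_span.zero additive_span_add)

lemma additive_span_subset:
  assumes "G \<subseteq> additive_span H" shows "additive_span G \<subseteq> additive_span H"
proof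
  fix u assume "u \<in> additive_span G"
  then show "u \<in> additive_span H"
    by induction (use assms in \<open>auto intro: additive_span.intros\<close>)
qed

lemma additive_span_mono: "G \<subseteq> H \<Longrightarrow> additive_span G \<subseteq> additive_span H"
  by (intro additive_span_subset) (auto intro: additive_span.gen)

lemma additive_span_mult:
  assumes "u \<in> additive_span G" "v \<in> additive_span H"
    and "\<And>g h. g \<in> G \<Longrightarrow> h \<in> H \<Longrightarrow> g * h \<in> additive_span K"
  shows "u * v \<in> additive_span K"
  using assms(1)
proof induction
  case (gen g)
  from assms(2) show ?case
    by induction (use assms(3) gen in \<open>auto simp: algebra_simps intro: additive_span.intros\<close>)
qed (auto simp: algebra_simps intro: additive_span.intros)

section \<open>Quantum tori inside a skew field\<close>

locale central_unit =
  fixes qh :: "'f::division_ring"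
  assumes qh_nonzero: "qh \<noteq> 0" and qh_central: "qh * z = z * qh"
begin

abbreviation Q :: "int \<Rightarrow> 'f" where "Q s \<equiv> qh powi s"

lemma Q_comm: "Q s * z = z * Q s"
proof -
  have inv: "inverse qh * y = y * inverse qh" for y
  proof -
    have "inverse qh * y = inverse qh * (y * qh) * inverse qh"
      using qh_nonzero by (simp add: mult.assoc)
    also have "\<dots> = inverse qh * (qh * y) * inverse qh" by (simp only: qh_central)
    also have "\<dots> = y * inverse qh" using qh_nonzero by (simp add: mult.assoc[symmetric])
    finally show ?thesis .
  qed
  have pow: "a ^ k * y = y * a ^ k" if c: "\<And>y. a * y = y * a" for a y :: 'f and k
  proof (induction k)
    case (Suc k)
    have "a ^ Suc k * y = a * (a ^ k * y)" by (simp add: mult.assoc)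
    also have "\<dots> = (a * y) * a ^ k" by (simp only: Suc mult.assoc)
    also have "\<dots> = y * a ^ Suc k" by (simp only: c[of y] mult.assoc power_Suc)
    finally show ?case .
  qed simp
  show ?thesis
    by (cases "s \<ge> 0") (simp_all only: power_int_def if_True if_False pow[of qh, OF qh_central, of _ z]
      pow[of "inverse qh", OF inv, of _ z])
qed

declare qh_nonzero[simp]

lemma Q_add: "Q (s + t) = Q s * Q t" using qh_nonzero by (simp add: power_int_add)
lemma Q_mult[simp]: "Q s * Q t = Q (s + t)" by (simp add: Q_add)
lemma Q_mult_left[simp]: "Q s * (Q t * z) = Q (s + t) * z" by (simp only: Q_add mult.assoc)
lemma Q_left_comm: "z * (Q s * w) = Q s * (z * w)"
  by (simp only: mult.assoc[symmetric] Q_comm[of s z])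

end

text \<open>The powers of \<open>qh\<close> belong to the generators, so closure under subtraction
  alone yields the span over the integer Laurent polynomials in \<open>qh\<close>.\<close>

definition monomial_span ::
    "'f::division_ring \<Rightarrow> ((nat \<Rightarrow> int) \<Rightarrow> 'f) \<Rightarrow> (nat \<Rightarrow> int) set \<Rightarrow> 'f set" where
  "monomial_span qh M A = additive_span {qh powi s * M a | s a. a \<in> A}"

text \<open>Exponents are functions on all of \<open>nat\<close> that need not vanish outside
  \<open>{1..m}\<close>, so columns of matrices serve as exponents without truncation. This relation
  is the resulting equality of exponents; saturated sets and degree maps are those that respect
  it.\<close>

definition agree :: "nat \<Rightarrow> (nat \<Rightarrow> int) \<Rightarrow> (nat \<Rightarrow> int) \<Rightarrow> bool" where
  "agree m a c \<longleftrightarrow> (\<forall>i\<in>{1..m}. a i = c i)"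

definition saturated :: "nat \<Rightarrow> (nat \<Rightarrow> int) set \<Rightarrow> bool" where
  "saturated m A \<longleftrightarrow> (\<forall>a c. agree m a c \<longrightarrow> a \<in> A \<longrightarrow> c \<in> A)"

definition degree_map :: "nat \<Rightarrow> ((nat \<Rightarrow> int) \<Rightarrow> int) \<Rightarrow> bool" where
  "degree_map m l \<longleftrightarrow> (\<forall>a c. l (a + c) = l a + l c) \<and> (\<forall>a c. agree m a c \<longrightarrow> l a = l c)"

lemma agree_sym: "agree m a c \<Longrightarrow> agree m c a"
  by (simp add: agree_def)

lemma agreeD: "agree m a c \<Longrightarrow> i \<in> {1..m} \<Longrightarrow> a i = c i"
  by (simp add: agree_def)

lemma saturated_Compl: "saturated m A \<Longrightarrow> saturated m (- A)"
  unfolding saturated_def using agree_sym by blast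

lemma degree_map_saturated: "degree_map m l \<Longrightarrow> saturated m {c. P (l c)}"
  unfolding degree_map_def saturated_def by auto

lemma degree_map_add: "degree_map m l \<Longrightarrow> l (a + c) = l a + l c"
  by (simp add: degree_map_def)

lemma degree_map_zero: "degree_map m l \<Longrightarrow> l 0 = 0"
  using degree_map_add[of m l 0 0] by simp

lemma degree_map_minus: "degree_map m l \<Longrightarrow> l (- a) = - l a"
  using degree_map_add[of m l a "- a"] degree_map_zero[of m l] by simp

lemma degree_map_coord: "k \<in> {1..m} \<Longrightarrow> degree_map m (\<lambda>c. c k)"
  by (auto simp: degree_map_def agree_def)

lemma saturated_coord: "k \<in> {1..m} \<Longrightarrow> saturated m {c. P (c k)}"
  by (auto simp: saturated_def agree_def)

text \<open>The axiom \<open>direct\<close> stands for the linear independence of the monomials. It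
  speaks of supports only and never of coefficients; this is enough to define homogeneous
  components, and it can be carried through a mutation.\<close>

locale frame = central_unit qh for qh :: "'f::division_ring" +
  fixes m :: nat and M :: "(nat \<Rightarrow> int) \<Rightarrow> 'f" and L :: "(nat \<Rightarrow> int) \<Rightarrow> (nat \<Rightarrow> int) \<Rightarrow> int"
  assumes L_add_left: "L (a + c) e = L a e + L c e"
    and L_skew: "L a c = - L c a"
    and L_cong: "agree m a c \<Longrightarrow> L a e = L c e"
    and M_mult: "M a * M c = Q (L a c) * M (a + c)"
    and M_0: "M 0 = 1"
    and M_cong: "agree m a c \<Longrightarrow> M a = M c"
    and direct: "saturated m A \<Longrightarrow> y \<in> monomial_span qh M A \<Longrightarrow> y \<in> monomial_span qh M (- A) \<Longrightarrow> y = 0"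
begin

abbreviation Sp :: "(nat \<Rightarrow> int) set \<Rightarrow> 'f set" where "Sp A \<equiv> monomial_span qh M A"

lemma L_add_right: "L e (a + c) = L e a + L e c"
  by (simp only: L_skew[of e "a + c"] L_skew[of e a] L_skew[of e c] L_add_left)

lemma L_self[simp]: "L a a = 0" using L_skew[of a a] by simp

lemma L_0_left[simp]: "L 0 a = 0" using L_add_left[of 0 0 a] by simp
lemma L_0_right[simp]: "L a 0 = 0" using L_skew[of a 0] by simp
lemma L_minus_left: "L (- a) c = - L a c" using L_add_left[of a "- a" c] by simp
lemma L_minus_right: "L a (- c) = - L a c" by (simp only: L_skew[of a "-c"] L_skew[of a c] L_minus_left[of c a])
lemma L_cong_right: "agree m a c \<Longrightarrow> L e a = L e c" by (simp only: L_skew[of e a] L_skew[of e c] L_cong[of a c])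

lemma L_scale_left: "L (\<lambda>i. t * a i) c = t * L a c"
proof -
  have nat: "L (\<lambda>i. int t * a i) c = int t * L a c" for t
  proof (induction t)
    case 0 show ?case using L_0_left[of c] by (simp add: zero_fun_def)
  next
    case (Suc t)
    have "(\<lambda>i. int (Suc t) * a i) = (\<lambda>i. int t * a i) + a" by (auto simp: algebra_simps)
    then show ?case using Suc by (simp only: L_add_left) (simp add: algebra_simps)
  qed
  show ?thesis
  proof (cases "t \<ge> 0")
    case True then show ?thesis using nat[of "nat t"] by simp
  next
    case False
    have "(\<lambda>i. t * a i) = - (\<lambda>i. int (nat (- t)) * a i)" using False by (auto simp: algebra_simps)
    then show ?thesis using nat[of "nat (- t)"] False by (simp only: L_minus_left) simp
  qed
qed

lemma L_scale_right: "L c (\<lambda>i. t * a i) = t * L c a"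
  by (simp only: L_skew[of c "\<lambda>i. t * a i"] L_skew[of c a] L_scale_left)

lemma M_mult_left: "M a * (M c * z) = Q (L a c) * (M (a + c) * z)"
  by (simp add: mult.assoc[symmetric] M_mult)

lemma M_nz[simp]: "M a \<noteq> 0"
proof
  assume "M a = 0"
  then show False using M_mult[of a "- a"] by (simp add: M_0)
qed

lemma M_comm: "M a * M c = Q (2 * L a c) * (M c * M a)"
  by (simp add: M_mult L_skew[of c a] add.commute)

lemma M_inverse: "inverse (M a) = M (- a)"
  using M_mult[of a "- a"] by (intro inverse_unique) (simp add: M_0 L_minus_right)

lemma M_inv_l[simp]: "M (- a) * M a = 1" "M a * M (- a) = 1"
  by (simp_all add: M_mult M_0 L_minus_left L_minus_right)

lemma M_inv_ll[simp]: "M (- a) * (M a * z) = z" "M a * (M (- a) * z) = z"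
  by (simp_all add: mult.assoc[symmetric])

lemma Sp_gen: "a \<in> A \<Longrightarrow> Q s * M a \<in> Sp A"
  unfolding monomial_span_def by (auto intro: additive_span.gen)

lemma Sp_M: "a \<in> A \<Longrightarrow> M a \<in> Sp A"
  using Sp_gen[of a A 0] by simp

lemma Sp_0[simp]: "0 \<in> Sp A" unfolding monomial_span_def by (rule additive_span.zero)
lemma Sp_1: "0 \<in> A \<Longrightarrow> 1 \<in> Sp A" using Sp_M[of 0 A] by (simp add: M_0)
lemma Sp_diff: "u \<in> Sp A \<Longrightarrow> v \<in> Sp A \<Longrightarrow> u - v \<in> Sp A"
  unfolding monomial_span_def by (rule additive_span.diff)
lemma Sp_add: "u \<in> Sp A \<Longrightarrow> v \<in> Sp A \<Longrightarrow> u + v \<in> Sp A"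
  unfolding monomial_span_def by (rule additive_span_add)
lemma Sp_sum: "(\<And>i. i \<in> I \<Longrightarrow> f i \<in> Sp A) \<Longrightarrow> sum f I \<in> Sp A"
  unfolding monomial_span_def by (rule additive_span_sum)
lemma Sp_mono: "u \<in> Sp A \<Longrightarrow> A \<subseteq> B \<Longrightarrow> u \<in> Sp B"
  unfolding monomial_span_def using additive_span_mono[of "{Q s * M a |s a. a \<in> A}" "{Q s * M a |s a. a \<in> B}"]
  by blast

lemma Sp_induct[consumes 1, case_names gen zero diff]:
  assumes "y \<in> Sp A" "\<And>s a. a \<in> A \<Longrightarrow> P (Q s * M a)" "P 0"
    "\<And>u v. u \<in> Sp A \<Longrightarrow> v \<in> Sp A \<Longrightarrow> P u \<Longrightarrow> P v \<Longrightarrow> P (u - v)"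
  shows "P y"
  using assms(1) unfolding monomial_span_def
proof induction
  case (diff u v)
  then show ?case using assms(4)[of u v] unfolding monomial_span_def by blast
qed (use assms in auto)

lemma Sp_mult:
  assumes "u \<in> Sp A" "v \<in> Sp B" "\<And>a b. a \<in> A \<Longrightarrow> b \<in> B \<Longrightarrow> a + b \<in> C"
  shows "u * v \<in> Sp C"
  using assms(1,2) unfolding monomial_span_def
proof (rule additive_span_mult)
  fix g h assume "g \<in> {Q s * M a |s a. a \<in> A}" "h \<in> {Q s * M a |s a. a \<in> B}"
  then obtain s a t b where "g = Q s * M a" "h = Q t * M b" "a \<in> A" "b \<in> B" by auto
  then have "g * h = Q (s + t + L a b) * M (a + b)" "a + b \<in> C"
    using assms(3) by (auto simp: mult.assoc Q_left_comm[of "M _"] M_mult add.assoc)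
  then show "g * h \<in> additive_span {Q s * M a |s a. a \<in> C}"
    by (auto intro: additive_span.gen)
qed

lemma Sp_Q: "u \<in> Sp A \<Longrightarrow> Q s * u \<in> Sp A"
  using Sp_mult[of "Q s" "{0}" u A A] Sp_gen[of 0 "{0}" s] by (simp add: M_0)

lemma Sp_Q_iff[simp]: "Q s * u \<in> Sp A \<longleftrightarrow> u \<in> Sp A"
  using Sp_Q[of "Q s * u" A "- s"] Sp_Q[of u A s] by auto

lemma Sp_UNIV: "u \<in> Sp A \<Longrightarrow> u \<in> Sp UNIV" by (erule Sp_mono) simp

lemma Sp_split:
  assumes "y \<in> Sp A"
  shows "\<exists>u. u \<in> Sp (A \<inter> P) \<and> y - u \<in> Sp (A - P)"
  using assms
proof (induction rule: Sp_induct)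
  case (gen s a)
  show ?case
  proof (cases "a \<in> P")
    case True then show ?thesis using gen by (intro exI[of _ "Q s * M a"]) (auto intro: Sp_M)
  next
    case False then show ?thesis using gen by (intro exI[of _ 0]) (auto intro: Sp_M)
  qed
next
  case zero then show ?case by (intro exI[of _ 0]) auto
next
  case (diff u v)
  then obtain u' v' where "u' \<in> Sp (A \<inter> P)" "u - u' \<in> Sp (A - P)"
    "v' \<in> Sp (A \<inter> P)" "v - v' \<in> Sp (A - P)" by auto
  then have "u' - v' \<in> Sp (A \<inter> P)" "(u - u') - (v - v') \<in> Sp (A - P)" using Sp_diff by blast+
  then show ?case by (intro exI[of _ "u' - v'"]) (simp add: algebra_simps)
qed

section \<open>Homogeneous components and lowest degrees\<close>

text \<open>For saturated \<open>P\<close> and \<open>y\<close> in the torus the choice is unique by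
  \<open>direct\<close>; no other values matter.\<close>

definition pr :: "(nat \<Rightarrow> int) set \<Rightarrow> 'f \<Rightarrow> 'f" where
  "pr P y = (SOME u. u \<in> Sp P \<and> y - u \<in> Sp (- P))"

lemma pr_eqI:
  assumes "saturated m P" "u \<in> Sp P" "y - u \<in> Sp (- P)"
  shows "pr P y = u"
proof -
  have "pr P y \<in> Sp P \<and> y - pr P y \<in> Sp (- P)"
    unfolding pr_def by (rule someI[of _ u]) (use assms in auto)
  then have "pr P y - u \<in> Sp P" "(y - u) - (y - pr P y) \<in> Sp (- P)"
    using assms Sp_diff by blast+
  then have "pr P y - u = 0" using direct[OF assms(1), of "pr P y - u"] by simp
  then show ?thesis by simp
qed

lemma pr_mem:
  assumes "saturated m P" "y \<in> Sp A"
  shows "pr P y \<in> Sp (A \<inter> P)" "y - pr P y \<in> Sp (A - P)"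
proof -
  obtain u where u: "u \<in> Sp (A \<inter> P)" "y - u \<in> Sp (A - P)" using Sp_split[OF assms(2)] by blast
  then have "pr P y = u" by (intro pr_eqI[OF assms(1)]) (auto elim: Sp_mono)
  then show "pr P y \<in> Sp (A \<inter> P)" "y - pr P y \<in> Sp (A - P)" using u by auto
qed

lemma pr_mem': 
  assumes "saturated m P" "y \<in> Sp UNIV"
  shows "pr P y \<in> Sp P" "y - pr P y \<in> Sp (- P)"
  using pr_mem[OF assms] by (simp_all add: Compl_eq_Diff_UNIV[symmetric])

lemma pr_id: "saturated m P \<Longrightarrow> y \<in> Sp A \<Longrightarrow> A \<subseteq> P \<Longrightarrow> pr P y = y"
  by (rule pr_eqI) (simp_all add: Sp_mono)

lemma pr_eq_0: "saturated m P \<Longrightarrow> y \<in> Sp A \<Longrightarrow> A \<inter> P = {} \<Longrightarrow> pr P y = 0"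
  by (rule pr_eqI) (simp_all add: Sp_mono disjoint_eq_subset_Compl)

lemma pr_0[simp]: "saturated m P \<Longrightarrow> pr P 0 = 0"
  by (rule pr_eqI) simp_all

lemma pr_diff:
  assumes "saturated m P" "y \<in> Sp UNIV" "z \<in> Sp UNIV"
  shows "pr P (y - z) = pr P y - pr P z"
proof (rule pr_eqI[OF assms(1)])
  note y = pr_mem'[OF assms(1,2)] and z = pr_mem'[OF assms(1,3)]
  show "pr P y - pr P z \<in> Sp P" by (rule Sp_diff[OF y(1) z(1)])
  have "(y - pr P y) - (z - pr P z) \<in> Sp (- P)" by (rule Sp_diff[OF y(2) z(2)])
  then show "y - z - (pr P y - pr P z) \<in> Sp (- P)" by (simp add: algebra_simps)
qed

lemma pr_add:
  assumes "saturated m P" "y \<in> Sp UNIV" "z \<in> Sp UNIV"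
  shows "pr P (y + z) = pr P y + pr P z"
  using pr_diff[OF assms(1,2), of "0 - z"] pr_diff[OF assms(1) _ assms(3), of 0] assms Sp_diff[of 0 UNIV z]
  by simp

lemma pr_sum:
  assumes "saturated m P" "\<And>i. i \<in> I \<Longrightarrow> f i \<in> Sp UNIV"
  shows "pr P (sum f I) = (\<Sum>i\<in>I. pr P (f i))"
  using assms(2)
  by (induction I rule: infinite_finite_induct) (auto simp: assms(1) pr_add Sp_sum)

lemma pr_Q:
  assumes "saturated m P" "y \<in> Sp UNIV" shows "pr P (Q s * y) = Q s * pr P y"
proof (rule pr_eqI[OF assms(1)])
  note p = pr_mem'[OF assms]
  show "Q s * pr P y \<in> Sp P" using p(1) by simp
  have "Q s * (y - pr P y) \<in> Sp (- P)" using p(2) by (rule Sp_Q)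
  then show "Q s * y - Q s * pr P y \<in> Sp (- P)" by (simp only: right_diff_distrib)
qed

lemma pr_mult:
  assumes "saturated m P" "saturated m P'" "y \<in> Sp A" "z \<in> Sp C"
    and "\<And>a c. a \<in> A \<Longrightarrow> a \<in> P \<Longrightarrow> c \<in> C \<Longrightarrow> a + c \<in> P'"
    and "\<And>a c. a \<in> A \<Longrightarrow> a \<notin> P \<Longrightarrow> c \<in> C \<Longrightarrow> a + c \<notin> P'"
  shows "pr P' (y * z) = pr P y * z"
proof (rule pr_eqI[OF assms(2)])
  note y = pr_mem[OF assms(1,3)]
  show "pr P y * z \<in> Sp P'" using y(1) assms(4) by (rule Sp_mult) (use assms(5) in auto)
  have "(y - pr P y) * z \<in> Sp (- P')" using y(2) assms(4) by (rule Sp_mult) (use assms(6) in auto)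
  then show "y * z - pr P y * z \<in> Sp (- P')" by (simp add: algebra_simps)
qed

text \<open>Every other pair of components has total degree above \<open>r + t\<close>. In a skew
  field the product of two nonzero lowest components is nonzero, and the cancellation arguments
  below rest on this.\<close>

lemma pr_mult_low:
  assumes l: "degree_map m l" and y: "y \<in> Sp {c. l c \<ge> r}" and z: "z \<in> Sp {c. l c \<ge> t}"
  shows "pr {c. l c = r + t} (y * z) = pr {c. l c = r} y * pr {c. l c = t} z"
proof (rule pr_eqI)
  have s: "saturated m {c. l c = r}" for r using degree_map_saturated[OF l, of "\<lambda>x. x = r"] by simp
  then show "saturated m {c. l c = r + t}" by simp
  note Y = pr_mem[OF s[of r] y] and Z = pr_mem[OF s[of t] z]
  let ?y = "pr {c. l c = r} y" and ?z = "pr {c. l c = t} z"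
  show "?y * ?z \<in> Sp {c. l c = r + t}"
    using Y(1) Z(1) by (rule Sp_mult) (auto simp: degree_map_add[OF l])
  have 1: "(y - ?y) * z \<in> Sp (- {c. l c = r + t})"
    using Y(2) z by (rule Sp_mult) (auto simp: degree_map_add[OF l])
  have 2: "?y * (z - ?z) \<in> Sp (- {c. l c = r + t})"
    using Y(1) Z(2) by (rule Sp_mult) (auto simp: degree_map_add[OF l])
  have "y * z - ?y * ?z = (y - ?y) * z + ?y * (z - ?z)" by (simp add: algebra_simps)
  then show "y * z - ?y * ?z \<in> Sp (- {c. l c = r + t})" using Sp_add[OF 1 2] by simp
qed

lemma Sp_Int:
  assumes "y \<in> Sp A" "y \<in> Sp B" "saturated m B" shows "y \<in> Sp (A \<inter> B)"
  using pr_mem(1)[OF assms(3,1)] pr_id[OF assms(3,2)] by simp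

lemma sat_eq: "degree_map m l \<Longrightarrow> saturated m {c. l c = r}"
  using degree_map_saturated[of m l "\<lambda>x. x = r"] by simp
lemma sat_ge: "degree_map m l \<Longrightarrow> saturated m {c. r \<le> l c}"
  using degree_map_saturated[of m l "\<lambda>x. r \<le> x"] by simp
lemma Sp_raise:
  assumes "degree_map m l" "y \<in> Sp {c. l c \<ge> r}" "pr {c. l c = r} y = 0"
  shows "y \<in> Sp {c. l c \<ge> r + 1}"
  using pr_mem(2)[OF sat_eq[OF assms(1)] assms(2), of r] assms(3)
  by (auto elim: Sp_mono)

lemma Sp_bounds:
  assumes "degree_map m l" "y \<in> Sp A"
  shows "\<exists>r t. y \<in> Sp {c. r \<le> l c \<and> l c < r + int t}"
  using assms(2)
proof (induction rule: Sp_induct)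
  case (gen s a)
  show ?case by (rule exI[of _ "l a"], rule exI[of _ 1]) (auto intro: Sp_M)
next
  case zero then show ?case by auto
next
  case (diff u v)
  then obtain r1 t1 r2 t2 where *: "u \<in> Sp {c. r1 \<le> l c \<and> l c < r1 + int t1}"
    "v \<in> Sp {c. r2 \<le> l c \<and> l c < r2 + int t2}" by blast
  have "u - v \<in> Sp {c. min r1 r2 \<le> l c \<and> l c < min r1 r2 + int (t1 + t2 + nat \<bar>r1 - r2\<bar>)}"
    by (rule Sp_diff; rule *[THEN Sp_mono]) auto
  then show ?case by blast
qed

lemma Sp_bounds_family:
  assumes l: "degree_map m l" and "finite J" "\<And>j. j \<in> J \<Longrightarrow> F j \<in> Sp A"
  shows "\<exists>r t. \<forall>j\<in>J. F j \<in> Sp {c. r \<le> l c \<and> l c < r + int t}"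
  using assms(2,3)
proof (induction J)
  case (insert j J)
  then obtain r1 t1 where 1: "\<And>j. j \<in> J \<Longrightarrow> F j \<in> Sp {c. r1 \<le> l c \<and> l c < r1 + int t1}" by auto
  obtain r2 t2 where 2: "F j \<in> Sp {c. r2 \<le> l c \<and> l c < r2 + int t2}"
    using Sp_bounds[OF l, of "F j"] insert.prems by blast
  have "F i \<in> Sp {c. min r1 r2 \<le> l c \<and> l c < min r1 r2 + int (t1 + t2 + nat \<bar>r1 - r2\<bar>)}"
    if "i \<in> insert j J" for i
  proof (cases "i = j")
    case True show ?thesis unfolding True by (rule Sp_mono[OF 2]) auto
  next
    case False then show ?thesis using that by (intro Sp_mono[OF 1]) auto
  qed
  then show ?case by blast
qed auto

text \<open>The equation is asked for all larger finite index sets, so that two expansions can be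
  compared over a common one.\<close>

lemma Sp_decompose:
  assumes l: "degree_map m l" and y: "y \<in> Sp A"
  shows "\<exists>J. finite J \<and> (\<forall>J'. finite J' \<longrightarrow> J \<subseteq> J' \<longrightarrow> y = (\<Sum>r\<in>J'. pr {c. l c = r} y))"
  using y
proof (induction rule: Sp_induct)
  case (gen s a)
  have "pr {c. l c = r} (Q s * M a) = (if r = l a then Q s * M a else 0)" for r
    using pr_id[OF sat_eq[OF l], of "Q s * M a" "{a}" r] pr_eq_0[OF sat_eq[OF l], of "Q s * M a" "{a}" r]
    by (auto simp: Sp_M)
  then show ?case by (intro exI[of _ "{l a}"]) auto
next
  case zero then show ?case by (auto simp: sat_eq[OF l])
next
  case (diff u v)
  from diff.IH obtain J where J: "finite J" "\<And>J'. finite J' \<Longrightarrow> J \<subseteq> J' \<Longrightarrow> u = (\<Sum>r\<in>J'. pr {c. l c = r} u)"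
    by blast
  from diff.IH obtain K where K: "finite K" "\<And>J'. finite J' \<Longrightarrow> K \<subseteq> J' \<Longrightarrow> v = (\<Sum>r\<in>J'. pr {c. l c = r} v)"
    by blast
  have "u - v = (\<Sum>r\<in>J'. pr {c. l c = r} (u - v))" if "finite J'" "J \<union> K \<subseteq> J'" for J'
  proof -
    have "(\<Sum>r\<in>J'. pr {c. l c = r} (u - v)) = (\<Sum>r\<in>J'. pr {c. l c = r} u - pr {c. l c = r} v)"
      using diff.hyps by (intro sum.cong refl pr_diff sat_eq l) (auto intro: Sp_UNIV)
    then show ?thesis using J(2)[of J'] K(2)[of J'] that by (simp add: sum_subtractf)
  qed
  then show ?case using J(1) K(1) by (intro exI[of _ "J \<union> K"]) auto
qed

text \<open>A nonzero component of \<open>F\<close> of lowest degree below \<open>t\<close>, times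
  the degree 0 component of \<open>r\<close>, would be a nonzero component of \<open>F * r\<close>
  below \<open>t\<close>. The induction starts from some lower bound \<open>r0\<close> for
  \<open>F\<close> and raises it one degree at a time.\<close>

lemma Sp_cancel_low:
  assumes l: "degree_map m l" and F: "F \<in> Sp A" and r: "r \<in> Sp {c. l c \<ge> 0}"
    and nz: "pr {c. l c = 0} r \<noteq> 0" and Fr: "F * r \<in> Sp {c. l c \<ge> t}"
  shows "F \<in> Sp {c. l c \<ge> t}"
proof -
  obtain r0 t0 where F0: "F \<in> Sp {c. r0 \<le> l c \<and> l c < r0 + int t0}" using Sp_bounds[OF l F] by blast
  have "F \<in> Sp {c. l c \<ge> min (r0 + int k) t}" for k
  proof (induction k)
    case 0 then show ?case by (rule Sp_mono[OF F0]) auto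
  next
    case (Suc k)
    show ?case
    proof (cases "r0 + int k < t")
      case True
      then have F1: "F \<in> Sp {c. l c \<ge> r0 + int k}" using Suc by simp
      have "pr {c. l c = r0 + int k} F * pr {c. l c = 0} r = pr {c. l c = r0 + int k + 0} (F * r)"
        using pr_mult_low[OF l F1 r] by simp
      also have "\<dots> = 0" by (rule pr_eq_0[OF sat_eq[OF l] Fr]) (use True in auto)
      finally have "pr {c. l c = r0 + int k} F = 0" using nz by simp
      from Sp_raise[OF l F1 this] show ?thesis by (rule Sp_mono) auto
    next
      case False then show ?thesis using Suc by (auto elim: Sp_mono)
    qed
  qed
  from this[of "nat (t - r0)"] show ?thesis by (rule Sp_mono) auto
qed

end

context central_unit begin

lemma powi_q_comm:
  assumes "x * y = Q c * (y * x)" "x \<noteq> 0"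
  shows "x powi t * y = Q (t * c) * (y * x powi t)"
proof -
  have pow: "x ^ k * y = Q (int k * c) * (y * x ^ k)" for k
  proof (induction k)
    case (Suc k)
    have "x ^ Suc k * y = x ^ k * (x * y)" by (simp only: mult.assoc power_Suc2)
    also have "\<dots> = Q c * (x ^ k * (y * x))" by (simp only: assms Q_left_comm[of "x ^ k"])
    also have "\<dots> = Q c * ((x ^ k * y) * x)" by (simp only: mult.assoc)
    also have "\<dots> = Q (int (Suc k) * c) * (y * x ^ Suc k)"
      by (simp only: Suc mult.assoc Q_mult_left power_Suc2) (simp add: algebra_simps)
    finally show ?case .
  qed simp
  show ?thesis
  proof (cases "t \<ge> 0")
    case True
    then show ?thesis using pow[of "nat t"] by (simp add: power_int_def)
  next
    case False
    define k where "k = nat (- t)"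
    have t: "t = - int k" using False by (simp add: k_def)
    define z where "z = x ^ k"
    have z: "z * y = Q (int k * c) * (y * z)" "z \<noteq> 0" using pow[of k] assms(2) by (auto simp: z_def)
    have "inverse z * y = Q (t * c) * (inverse z * (Q (int k * c) * (y * z)) * inverse z)"
      using z(2) by (simp add: mult.assoc Q_left_comm[of "inverse z"] t)
    also have "\<dots> = Q (t * c) * (inverse z * (z * y) * inverse z)" by (simp only: z(1))
    also have "\<dots> = Q (t * c) * (y * inverse z)" using z(2) by (simp add: mult.assoc[symmetric])
    finally show ?thesis by (simp add: t z_def power_int_minus)
  qed
qed

end

section \<open>Leading terms and right division\<close>

context frame begin

text \<open>The leading coefficient has to be a power of \<open>qh\<close>. So the leading term is a
  unit of the torus, and dividing by it does not leave the torus.\<close>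

definition lead :: "((nat \<Rightarrow> int) \<Rightarrow> int) \<Rightarrow> (nat \<Rightarrow> int) \<Rightarrow> 'f \<Rightarrow> bool" where
  "lead l a y \<longleftrightarrow> (\<exists>s. y - Q s * M a \<in> Sp {c. l c > l a})"

lemma lead_M: "lead l a (Q s * M a)"
  unfolding lead_def by (rule exI[of _ s]) simp

lemma lead_1: "lead l 0 1"
  using lead_M[of l 0 0] by (simp add: M_0)

lemma lead_add: "lead l a y \<Longrightarrow> z \<in> Sp {c. l c > l a} \<Longrightarrow> lead l a (y + z)"
  unfolding lead_def using Sp_add by (metis add_diff_eq add.commute)

lemma lead_mem: "lead l a y \<Longrightarrow> y \<in> Sp {c. l c \<ge> l a}"
proof -
  assume "lead l a y"
  then obtain s where s: "y - Q s * M a \<in> Sp {c. l c > l a}" by (auto simp: lead_def)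
  have "(y - Q s * M a) + Q s * M a \<in> Sp {c. l c \<ge> l a}"
    by (rule Sp_add, rule Sp_mono[OF s]) (auto intro: Sp_M)
  then show ?thesis by simp
qed

lemma lead_mult:
  assumes l: "degree_map m l" and y: "lead l a y" and z: "lead l c z"
  shows "lead l (a + c) (y * z)"
proof -
  obtain s where s: "y - Q s * M a \<in> Sp {c. l c > l a}" using y by (auto simp: lead_def)
  obtain t where t: "z - Q t * M c \<in> Sp {e. l e > l c}" using z by (auto simp: lead_def)
  have e: "Q (s + t + L a c) * M (a + c) = (Q s * M a) * (Q t * M c)"
    by (simp add: mult.assoc Q_left_comm[of "M a"] M_mult algebra_simps)
  have 1: "(y - Q s * M a) * z \<in> Sp {e. l e > l (a + c)}"
    using s lead_mem[OF z] by (rule Sp_mult) (auto simp: degree_map_add[OF l])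
  have "Q s * M a \<in> Sp {e. l e \<ge> l a}" by (auto intro: Sp_M)
  then have 2: "(Q s * M a) * (z - Q t * M c) \<in> Sp {e. l e > l (a + c)}"
    using t by (rule Sp_mult) (auto simp: degree_map_add[OF l])
  have "y * z - Q (s + t + L a c) * M (a + c) = (y - Q s * M a) * z + (Q s * M a) * (z - Q t * M c)"
    unfolding e by (simp add: algebra_simps)
  then show ?thesis unfolding lead_def using Sp_add[OF 1 2] by metis
qed

lemma lead_cong:
  assumes "degree_map m l" "agree m a c" "lead l a y" shows "lead l c y"
  using assms M_cong[of a c] unfolding lead_def degree_map_def by metis

lemma lead_Q: "lead l a y \<Longrightarrow> lead l a (Q s * y)"
proof -
  assume "lead l a y"
  then obtain t where t: "y - Q t * M a \<in> Sp {c. l c > l a}" by (auto simp: lead_def)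
  have "Q s * y - Q (s + t) * M a = Q s * (y - Q t * M a)" by (simp add: right_diff_distrib)
  then show ?thesis unfolding lead_def using Sp_Q[OF t, of s] by metis
qed

lemma lead_power:
  assumes l: "degree_map m l" and y: "lead l a y"
  shows "lead l (\<lambda>i. int t * a i) (y ^ t)"
proof (induction t)
  case 0
  have e: "(\<lambda>i. int 0 * a i) = 0" by auto
  show ?case unfolding e power_0 by (rule lead_1)
next
  case (Suc t)
  have "a + (\<lambda>i. int t * a i) = (\<lambda>i. int (Suc t) * a i)" by (auto simp: algebra_simps)
  then show ?case using lead_mult[OF l y Suc] by simp
qed

lemma lead_prod_list:
  assumes l: "degree_map m l" and "\<And>i. i \<in> set xs \<Longrightarrow> lead l (g i) (f i)"
  shows "lead l (sum_list (map g xs)) (prod_list (map f xs))"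
  using assms(2)
proof (induction xs)
  case Nil show ?case unfolding list.map sum_list.Nil prod_list.Nil by (rule lead_1)
next
  case (Cons a xs)
  show ?case unfolding list.map sum_list.Cons prod_list.Cons
    by (rule lead_mult[OF l]) (use Cons in auto)
qed

lemma lead_pr:
  assumes l: "degree_map m l" and y: "lead l a y"
  shows "\<exists>s. pr {c. l c = l a} y = Q s * M a"
proof -
  obtain s where s: "y - Q s * M a \<in> Sp {c. l c > l a}" using y by (auto simp: lead_def)
  have "pr {c. l c = l a} y = Q s * M a"
    by (rule pr_eqI[OF sat_eq[OF l]]) (auto intro: Sp_M Sp_mono[OF s])
  then show ?thesis by blast
qed

lemma saturated_coords: "K \<subseteq> {1..m} \<Longrightarrow> saturated m {c. \<forall>i\<in>K. c i = x i}"
  by (auto simp: saturated_def agree_def subset_iff)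

text \<open>The induction peels off the lowest \<open>l\<close>-components of the \<open>F j\<close>; the monomials \<open>M (g j)\<close>
  leading the \<open>D j\<close> are told apart by the coordinates in \<open>K\<close>.\<close>

lemma division:
  assumes l: "degree_map m l" and J: "finite J" and K: "K \<subseteq> {1..m}"
    and F: "\<And>j. j \<in> J \<Longrightarrow> F j \<in> Sp {c. \<forall>i\<in>K. c i = x i}"
    and D: "\<And>j. j \<in> J \<Longrightarrow> lead l (g j) (D j)"
    and gl: "\<And>j. j \<in> J \<Longrightarrow> l (g j) = 0"
    and q: "q \<in> Sp {c. l c = 0 \<and> (\<forall>i\<in>K. c i = 0)}"
    and qD: "\<And>j. j \<in> J \<Longrightarrow> q * D j = D j * q"
    and qg: "\<And>j. j \<in> J \<Longrightarrow> q * M (g j) = M (g j) * q"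
    and sep: "\<And>j j'. j \<in> J \<Longrightarrow> j' \<in> J \<Longrightarrow> j \<noteq> j' \<Longrightarrow> \<exists>i\<in>K. g j i \<noteq> g j' i"
    and W: "W \<in> Sp UNIV" and eq: "(\<Sum>j\<in>J. F j * D j) = W * q"
  shows "\<exists>G. \<forall>j\<in>J. G j \<in> Sp {c. \<forall>i\<in>K. c i = x i} \<and> F j = G j * q"
proof -
  have DU: "D j \<in> Sp UNIV" if "j \<in> J" for j using lead_mem[OF D[OF that]] by (rule Sp_UNIV)
  \<comment> \<open>Generalized over the family \<open>F\<close>, the cofactor \<open>W\<close> and
    a window of length \<open>t\<close> that contains all \<open>l\<close>-degrees of the
    \<open>F j\<close>. Each induction step shortens the window from below.\<close>
  have main: "\<exists>G. \<forall>j\<in>J. G j \<in> Sp {c. \<forall>i\<in>K. c i = x i} \<and> F j = G j * q"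
    if "\<And>j. j \<in> J \<Longrightarrow> F j \<in> Sp {c. \<forall>i\<in>K. c i = x i}"
      "\<And>j. j \<in> J \<Longrightarrow> F j \<in> Sp {c. r \<le> l c \<and> l c < r + int t}"
      "W \<in> Sp UNIV" "(\<Sum>j\<in>J. F j * D j) = W * q" for F W r t
    using that
  proof (induction t arbitrary: F W r)
    case 0
    have "F j = 0" if "j \<in> J" for j
    proof -
      have "F j \<in> Sp {}" using 0(2)[OF that] by (rule Sp_mono) auto
      moreover from this have "F j \<in> Sp (- {})" by (rule Sp_mono) simp
      ultimately show ?thesis using direct[of "{}" "F j"] by (simp add: saturated_def)
    qed
    then show ?case by (intro exI[of _ "\<lambda>_. 0"]) auto
  next
    case (Suc t)
    let ?P = "{c. l c = r}"
    note sP = sat_eq[OF l, of r]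
    have Fge: "F j \<in> Sp {c. l c \<ge> r}" if "j \<in> J" for j by (rule Sp_mono[OF Suc.prems(2)[OF that]]) auto
    have FU: "F j \<in> Sp UNIV" if "j \<in> J" for j using Fge[OF that] by (rule Sp_UNIV)
    have "\<exists>s. pr {c. l c = 0} (D j) = Q s * M (g j)" if "j \<in> J" for j
      using lead_pr[OF l D[OF that]] gl[OF that] by simp
    then obtain s where s: "\<And>j. j \<in> J \<Longrightarrow> pr {c. l c = 0} (D j) = Q (s j) * M (g j)" by metis
    have prFD: "pr ?P (F j * D j) = pr ?P (F j) * (Q (s j) * M (g j))" if "j \<in> J" for j
      using pr_mult_low[OF l Fge[OF that], of "D j" 0] lead_mem[OF D[OF that]] gl[OF that] s[OF that] by simp
    \<comment> \<open>In degree \<open>r\<close>, only the summand of index \<open>j\<close> has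
      \<open>K\<close>-coordinates \<open>x + g j\<close>, by \<open>sep\<close>. Hence
      \<open>pr ?P (F j)\<close> times the leading term of \<open>D j\<close> is the corresponding
      part of \<open>W * q\<close>. As \<open>q\<close> commutes with \<open>M (g j)\<close>,
      multiplying by the inverse of the leading term gives the quotient.\<close>
    define G' where "G' j = pr {c. \<forall>i\<in>K. c i = x i + g j i} (pr ?P W) * (Q (- s j) * M (- g j))" for j
    have G': "G' j \<in> Sp {c. \<forall>i\<in>K. c i = x i} \<and> pr ?P (F j) = G' j * q" if j: "j \<in> J" for j
    proof -
      let ?X = "{c. \<forall>i\<in>K. c i = x i + g j i}"
      have sX: "saturated m ?X" using saturated_coords[OF K, of "\<lambda>i. x i + g j i"] by simp
      have XU: "pr ?P W \<in> Sp UNIV" using pr_mem(1)[OF sP Suc.prems(3)] by (rule Sp_UNIV)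
      have mem: "pr ?P (F j') * (Q (s j') * M (g j')) \<in> Sp {c. \<forall>i\<in>K. c i = x i + g j' i}" if "j' \<in> J" for j'
        by (rule Sp_mult[OF pr_mem(1)[OF sP Suc.prems(1)[OF that]], of _ "{g j'}"]) (auto intro: Sp_M)
      have "(\<Sum>j'\<in>J. pr ?X (pr ?P (F j' * D j'))) = pr ?X (pr ?P (\<Sum>j'\<in>J. F j' * D j'))"
      proof -
        have U: "F j' * D j' \<in> Sp UNIV" if "j' \<in> J" for j' by (rule Sp_mult[OF FU[OF that] DU[OF that]]) simp
        have U2: "pr ?P (F j' * D j') \<in> Sp UNIV" if "j' \<in> J" for j'
          using pr_mem(1)[OF sP U[OF that]] by (rule Sp_UNIV)
        show ?thesis by (simp add: pr_sum[OF sP U] pr_sum[OF sX U2])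
      qed
      also have "\<dots> = pr ?X (pr ?P (W * q))" by (simp only: Suc.prems(4))
      also have "pr ?P (W * q) = pr ?P W * q"
        by (rule pr_mult[OF sP sP Suc.prems(3) q]) (auto simp: degree_map_add[OF l])
      also have "pr ?X (pr ?P W * q) = pr ?X (pr ?P W) * q"
        by (rule pr_mult[OF sX sX XU q]) auto
      finally have *: "(\<Sum>j'\<in>J. pr ?X (pr ?P (F j' * D j'))) = pr ?X (pr ?P W) * q" .
      have "pr ?X (pr ?P (F j' * D j')) = (if j' = j then pr ?P (F j) * (Q (s j) * M (g j)) else 0)"
        if "j' \<in> J" for j'
      proof (cases "j' = j")
        case True
        then show ?thesis using pr_id[OF sX mem[OF j]] prFD[OF j] by simp
      next
        case False
        then have "pr ?X (pr ?P (F j') * (Q (s j') * M (g j'))) = 0"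
          using sep[OF that j] by (intro pr_eq_0[OF sX mem[OF that]]) auto
        then show ?thesis using False prFD[OF that] by simp
      qed
      then have "pr ?P (F j) * (Q (s j) * M (g j)) = pr ?X (pr ?P W) * q"
        using * J j by (simp add: sum.delta)
      then have "pr ?P (F j) * (Q (s j) * M (g j)) * (Q (- s j) * M (- g j)) =
          pr ?X (pr ?P W) * q * (Q (- s j) * M (- g j))" by simp
      moreover have "(Q (s j) * M (g j)) * (Q (- s j) * M (- g j)) = 1"
        by (simp add: mult.assoc Q_left_comm[of "M (g j)"])
      moreover have "q * (Q (- s j) * M (- g j)) = (Q (- s j) * M (- g j)) * q"
      proof -
        have "M (- g j) * (q * M (g j)) * M (- g j) = M (- g j) * (M (g j) * q) * M (- g j)"
          by (simp only: qg[OF j])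
        then have "M (- g j) * q = q * M (- g j)" by (simp add: mult.assoc)
        then show ?thesis by (simp add: Q_left_comm[of q] mult.assoc)
      qed
      ultimately have "pr ?P (F j) = G' j * q"
        unfolding G'_def by (simp only: mult.assoc mult_1_right)
      moreover have "G' j \<in> Sp {c. \<forall>i\<in>K. c i = x i}"
        unfolding G'_def by (rule Sp_mult[OF pr_mem(1)[OF sX XU], of _ "{- g j}"]) (auto intro: Sp_M)
      ultimately show ?thesis by blast
    qed
    define F' where "F' j = F j - pr ?P (F j)" for j
    have "\<exists>G. \<forall>j\<in>J. G j \<in> Sp {c. \<forall>i\<in>K. c i = x i} \<and> F' j = G j * q"
    proof (rule Suc.IH[of F' "r + 1" "W - (\<Sum>j\<in>J. G' j * D j)"])
      fix j assume j: "j \<in> J"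
      show "F' j \<in> Sp {c. \<forall>i\<in>K. c i = x i}"
        unfolding F'_def using pr_mem(2)[OF sP Suc.prems(1)[OF j]] by (rule Sp_mono) auto
      show "F' j \<in> Sp {c. r + 1 \<le> l c \<and> l c < r + 1 + int t}"
        unfolding F'_def using pr_mem(2)[OF sP Suc.prems(2)[OF j]] by (rule Sp_mono) auto
    next
      have "G' j * D j \<in> Sp UNIV" if "j \<in> J" for j
        by (rule Sp_mult[OF _ DU[OF that]]) (use G'[OF that] in \<open>auto intro: Sp_UNIV\<close>)
      then show "W - (\<Sum>j\<in>J. G' j * D j) \<in> Sp UNIV" by (intro Sp_diff Sp_sum Suc.prems)
      have "pr ?P (F j) * D j = G' j * D j * q" if "j \<in> J" for j
        using G'[OF that] qD[OF that] by (simp add: mult.assoc)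
      then have "(\<Sum>j\<in>J. F' j * D j) = W * q - (\<Sum>j\<in>J. G' j * D j * q)"
        unfolding F'_def by (simp add: left_diff_distrib sum_subtractf Suc.prems(4))
      then show "(\<Sum>j\<in>J. F' j * D j) = (W - (\<Sum>j\<in>J. G' j * D j)) * q"
        by (simp add: left_diff_distrib sum_distrib_right)
    qed
    then obtain G where G: "\<And>j. j \<in> J \<Longrightarrow> G j \<in> Sp {c. \<forall>i\<in>K. c i = x i} \<and> F' j = G j * q" by blast
    show ?case
    proof (intro exI[of _ "\<lambda>j. G j + G' j"] ballI conjI)
      fix j assume j: "j \<in> J"
      show "G j + G' j \<in> Sp {c. \<forall>i\<in>K. c i = x i}" using G[OF j] G'[OF j] by (blast intro: Sp_add)
      have "F j = F' j + pr ?P (F j)" by (simp add: F'_def)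
      then show "F j = (G j + G' j) * q" using G[OF j] G'[OF j] by (simp add: distrib_right)
    qed
  qed
  have "\<exists>r t. \<forall>j\<in>J. F j \<in> Sp {c. r \<le> l c \<and> l c < r + int t}"
    by (rule Sp_bounds_family[OF l J F])
  then show ?thesis using main[OF F _ W eq] by blast
qed

end

section \<open>Mutation of toric frames\<close>

text \<open>The vector \<open>b\<close> stands for the \<open>k\<close>-th column of the exchange matrix up to sign: replacing \<open>b\<close> by \<open>- b\<close>
  changes \<open>mut_exp\<close> but not \<open>mut_frame\<close>.\<close>

definition mut_vec :: "nat \<Rightarrow> (nat \<Rightarrow> int) \<Rightarrow> nat \<Rightarrow> int" where
  "mut_vec k b = (\<lambda>i. - unit_vector k i + max (- b i) 0)"

definition mut_exp :: "nat \<Rightarrow> (nat \<Rightarrow> int) \<Rightarrow> (nat \<Rightarrow> int) \<Rightarrow> nat \<Rightarrow> int" where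
  "mut_exp k b a = (\<lambda>i. (if i = k then 0 else a i) + a k * mut_vec k b i)"

definition mut_var :: "((nat \<Rightarrow> int) \<Rightarrow> 'f::division_ring) \<Rightarrow> nat \<Rightarrow> (nat \<Rightarrow> int) \<Rightarrow> 'f" where
  "mut_var M k b = M (\<lambda>i. - unit_vector k i + max (b i) 0) + M (\<lambda>i. - unit_vector k i + max (- b i) 0)"

text \<open>What remains of \<open>mut_var M k b powi t\<close> once its monomial part, with
  exponent \<open>t\<close> times \<open>mut_vec k b\<close>, is split off on the left.\<close>

definition mut_ratio :: "((nat \<Rightarrow> int) \<Rightarrow> 'f::division_ring) \<Rightarrow> nat \<Rightarrow> (nat \<Rightarrow> int) \<Rightarrow> int \<Rightarrow> 'f" where
  "mut_ratio M k b t = M (\<lambda>i. - t * mut_vec k b i) * mut_var M k b powi t"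

definition mut_frame ::
    "((nat \<Rightarrow> int) \<Rightarrow> 'f::division_ring) \<Rightarrow> nat \<Rightarrow> (nat \<Rightarrow> int) \<Rightarrow> (nat \<Rightarrow> int) \<Rightarrow> 'f" where
  "mut_frame M k b a = M (mut_exp k b a) * mut_ratio M k b (a k)"

text \<open>The assumption \<open>L_b\<close> is the compatibility of the column \<open>b\<close>
  with the form. The constant \<open>\<delta>\<close> may be negative: its sign changes when
  \<open>b\<close> is negated, and also when the mutation is undone.\<close>

locale mutation = frame qh m M L for qh :: "'f::division_ring" and m M L +
  fixes k :: nat and b :: "nat \<Rightarrow> int" and \<delta> :: int
  assumes k: "k \<in> {1..m}" and L_b: "L b a = \<delta> * a k" and \<delta>_nz: "\<delta> \<noteq> 0"
begin

abbreviation "u \<equiv> mut_vec k b"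
abbreviation "\<phi> \<equiv> mut_exp k b"
abbreviation "x' \<equiv> mut_var M k b"
abbreviation "r \<equiv> mut_ratio M k b"
abbreviation "M' \<equiv> mut_frame M k b"
abbreviation "Y \<equiv> {\<lambda>i. t * b i | t. True}"
abbreviation "Yp \<equiv> {\<lambda>i. t * b i | t. t \<ge> 1}"

lemma b_k[simp]: "b k = 0"
  using L_b[of b] \<delta>_nz by simp

lemma u_k[simp]: "u k = - 1" by (simp add: mut_vec_def unit_vector_def)

lemma phi_add: "\<phi> (a + c) = \<phi> a + \<phi> c"
  by (auto simp: mut_exp_def algebra_simps)

lemma phi_minus: "\<phi> (- c) = - \<phi> c"
  by (auto simp: mut_exp_def algebra_simps)

lemma phi_0[simp]: "\<phi> 0 = 0" by (auto simp: mut_exp_def)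

lemma phi_k[simp]: "\<phi> a k = - a k" by (simp add: mut_exp_def)

lemma phi_fix: "a k = 0 \<Longrightarrow> \<phi> a = a" by (auto simp: mut_exp_def)

lemma phi_phi[simp]: "\<phi> (\<phi> a) = a"
  by (auto simp: mut_exp_def)

lemma phi_agree: "agree m a c \<Longrightarrow> agree m (\<phi> a) (\<phi> c)"
  using k by (auto simp: agree_def mut_exp_def)

lemma phi_split: "\<phi> a = (\<lambda>i. if i = k then 0 else a i) + (\<lambda>i. a k * u i)"
  by (auto simp: mut_exp_def)

lemma M_u: "M (\<lambda>i. s * u i) * M (\<lambda>i. t * u i) = M (\<lambda>i. (s + t) * u i)"
proof -
  have "(\<lambda>i. s * u i) + (\<lambda>i. t * u i) = (\<lambda>i. (s + t) * u i)" by (auto simp: algebra_simps)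
  then show ?thesis by (simp add: M_mult L_scale_left L_scale_right)
qed

lemma M_u_inv[simp]: "M (\<lambda>i. - (t * u i)) * M (\<lambda>i. t * u i) = 1" "M (\<lambda>i. t * u i) * M (\<lambda>i. - (t * u i)) = 1"
proof -
  have e: "(\<lambda>i. - (t * u i)) = - (\<lambda>i. t * u i)" by auto
  show "M (\<lambda>i. - (t * u i)) * M (\<lambda>i. t * u i) = 1" "M (\<lambda>i. t * u i) * M (\<lambda>i. - (t * u i)) = 1"
    unfolding e by simp_all
qed

lemma var_eq: "x' = M u * (1 + Q (- \<delta>) * M b)"
proof -
  have e: "(\<lambda>i. - unit_vector k i + max (b i) 0) = u + b" by (auto simp: mut_vec_def)
  have "L u b = \<delta>" using L_b[of u] L_skew[of u b] by simp
  then have "M (u + b) = Q (- \<delta>) * (M u * M b)" by (simp add: M_mult)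
  moreover have "(\<lambda>i. - unit_vector k i + max (- b i) 0) = u" by (simp add: mut_vec_def)
  ultimately show ?thesis unfolding mut_var_def e
    by (simp only: distrib_left Q_left_comm[of "M u"] mult_1_right add.commute)
qed

lemma conj_span:
  assumes "z \<in> Sp B" shows "M a * z * M (- a) \<in> Sp B"
  using assms
proof (induction rule: Sp_induct)
  case (gen s c)
  have "M a * (Q s * M c) * M (- a) = Q (s + 2 * L a c) * M c"
    by (simp add: mult.assoc Q_left_comm[of "M a"] M_mult M_mult_left L_minus_right L_minus_left
        L_add_left L_add_right L_skew[of c a] algebra_simps)
  then show ?case using Sp_gen[OF gen] by metis
next
  case (diff v w)
  have "M a * (v - w) * M (- a) = M a * v * M (- a) - M a * w * M (- a)" by (simp add: algebra_simps)
  then show ?case using Sp_diff[OF diff.IH] by metis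
qed simp

lemma commute_span:
  assumes "z \<in> Sp A" "y \<in> Sp C" "\<And>a c. a \<in> A \<Longrightarrow> c \<in> C \<Longrightarrow> L a c = 0"
  shows "z * y = y * z"
  using assms(1)
proof (induction rule: Sp_induct)
  case (gen s a)
  from assms(2) show ?case
  proof (induction rule: Sp_induct)
    case (gen t c)
    then show ?case using assms(3)[OF \<open>a \<in> A\<close> gen] L_skew[of c a]
      by (simp add: mult.assoc Q_left_comm[of "M _"] M_mult add.commute)
  qed (auto simp: algebra_simps)
qed (auto simp: algebra_simps)

lemma L_Y: "c \<in> Y \<Longrightarrow> a k = 0 \<Longrightarrow> L c a = 0"
  by (auto simp: L_scale_left L_b)

lemma Y_comm:
  assumes "z \<in> Sp Y" "y \<in> Sp {c. c k = 0}" shows "z * y = y * z"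
  using assms by (rule commute_span) (use L_Y in auto)

lemma Y_deg0: "z \<in> Sp Y \<Longrightarrow> z \<in> Sp {c. c k = 0}"
  by (erule Sp_mono) auto

lemma Yp_Y: "z \<in> Sp Yp \<Longrightarrow> z \<in> Sp Y"
  by (erule Sp_mono) auto

lemma Y_mult: "z \<in> Sp Y \<Longrightarrow> w \<in> Sp Y \<Longrightarrow> z * w \<in> Sp Y"
proof (erule Sp_mult, assumption, clarsimp)
  fix s t show "\<exists>r. (\<lambda>i. s * b i) + (\<lambda>i. t * b i) = (\<lambda>i. r * b i)"
    by (rule exI[of _ "s + t"]) (auto simp: algebra_simps)
qed

lemma Yp_mult: "z \<in> Sp Yp \<Longrightarrow> w \<in> Sp Yp \<Longrightarrow> z * w \<in> Sp Yp"
proof (erule Sp_mult, assumption, clarsimp)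
  fix s t :: int assume "s \<ge> 1" "t \<ge> 1"
  then show "\<exists>r. (\<lambda>i. s * b i) + (\<lambda>i. t * b i) = (\<lambda>i. r * b i) \<and> r \<ge> 1"
    by (intro exI[of _ "s + t"]) (auto simp: algebra_simps)
qed

lemma one_Y: "1 \<in> Sp Y"
proof (rule Sp_1)
  have "0 = (\<lambda>i. 0 * b i)" by auto
  then show "0 \<in> Y" by blast
qed

text \<open>By compatibility, pairing with \<open>unit_vector k\<close> sends \<open>b\<close> to
  \<open>\<delta>\<close>; the additional factor makes the value on \<open>b\<close> the positive
  number \<open>\<delta> * \<delta>\<close>. This orders the powers of \<open>M b\<close>, whatever
  the entries of \<open>b\<close> are.\<close>

definition dual_degree :: "(nat \<Rightarrow> int) \<Rightarrow> int" where
  "dual_degree c = \<delta> * L c (unit_vector k)"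

lemma dual_degree: "degree_map m dual_degree"
  by (auto simp: degree_map_def dual_degree_def L_add_left algebra_simps intro: L_cong)

lemma dual_degree_b: "dual_degree (\<lambda>i. t * b i) = t * (\<delta> * \<delta>)"
  by (simp add: dual_degree_def L_scale_left L_b unit_vector_def)

lemma \<delta>_sq: "\<delta> * \<delta> > 0" using \<delta>_nz by (cases "\<delta> > 0") (auto simp: mult_neg_neg)

lemma Yp_lead: "z \<in> Sp Yp \<Longrightarrow> lead dual_degree 0 (1 + z)"
proof (rule lead_add[OF lead_1], erule Sp_mono, clarify)
  fix t :: int assume "t \<ge> 1"
  then show "dual_degree 0 < dual_degree (\<lambda>i. t * b i)"
    using \<delta>_sq by (simp add: dual_degree_b degree_map_zero[OF dual_degree])
qed

lemma Yp_nz: assumes "z \<in> Sp Yp" shows "1 + z \<noteq> 0"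
proof
  assume "1 + z = 0"
  then have "pr {c. dual_degree c = dual_degree 0} (1 + z) = 0" by (simp add: sat_eq[OF dual_degree])
  then show False using lead_pr[OF dual_degree Yp_lead[OF assms]] by (auto simp: M_0)
qed

lemma r1: "r 1 = 1 + Q (- \<delta>) * M b"
proof -
  have e: "(\<lambda>i. - 1 * u i) = - u" by auto
  show ?thesis unfolding mut_ratio_def e by (simp add: var_eq)
qed

lemma r1_Yp: "Q (- \<delta>) * M b \<in> Sp Yp"
proof (rule Sp_gen)
  have "b = (\<lambda>i. 1 * b i)" by simp
  then show "b \<in> Yp" by blast
qed

lemma var_nz[simp]: "x' \<noteq> 0"
  unfolding var_eq by (intro no_zero_divisors M_nz Yp_nz[OF r1_Yp])

lemma r_nz[simp]: "r t \<noteq> 0"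
  unfolding mut_ratio_def by simp

lemma var_pow: "x' powi t = M (\<lambda>i. t * u i) * r t"
  unfolding mut_ratio_def by (simp add: mult.assoc[symmetric])

text \<open>Splitting off one factor \<open>x'\<close> shows that \<open>r (n + 1)\<close> is the
  conjugate of \<open>r n\<close> by \<open>M (- u)\<close>, times \<open>r 1\<close>. Conjugation
  by a monomial only rescales the powers of \<open>M b\<close> by powers of
  \<open>qh\<close>.\<close>

lemma r_nonneg:
  assumes "t \<ge> 0" shows "\<exists>z. z \<in> Sp Yp \<and> r t = 1 + z"
proof -
  have "\<exists>z. z \<in> Sp Yp \<and> r (int n) = 1 + z" for n
  proof (induction n)
    case 0
    have "r (int 0) = 1" using M_0 by (simp add: mut_ratio_def zero_fun_def)
    then show ?case by (intro exI[of _ 0]) simp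
  next
    case (Suc n)
    then obtain z where z: "z \<in> Sp Yp" "r (int n) = 1 + z" by blast
    let ?w = "Q (- \<delta>) * M b" and ?v = "M (- u) * z * M (- (- u))"
    have v: "?v \<in> Sp Yp" by (rule conj_span[OF z(1)])
    have e: "M (\<lambda>i. - int (Suc n) * u i) * M (\<lambda>i. int n * u i) = M (- u)"
    proof -
      have "(\<lambda>i. (- int (Suc n) + int n) * u i) = - u" by auto
      then show ?thesis by (simp only: M_u)
    qed
    have "r (int (Suc n)) = M (\<lambda>i. - int (Suc n) * u i) * (x' powi int n * x')"
      unfolding mut_ratio_def by (simp add: power_int_def power_commutes nat_add_distrib add.commute)
    also have "\<dots> = (M (\<lambda>i. - int (Suc n) * u i) * M (\<lambda>i. int n * u i)) * r (int n) * x'"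
      by (simp only: var_pow mult.assoc)
    also have "\<dots> = M (- u) * (1 + z) * (M u * (1 + ?w))" by (simp only: e z(2) var_eq)
    also have "\<dots> = (1 + ?v) * (1 + ?w)" by (simp add: algebra_simps)
    also have "\<dots> = 1 + (?v + ?w + ?v * ?w)" by (simp add: algebra_simps)
    finally have "r (int (Suc n)) = 1 + (?v + ?w + ?v * ?w)" .
    moreover have "?v + ?w + ?v * ?w \<in> Sp Yp" by (rule Sp_add[OF Sp_add[OF v r1_Yp] Yp_mult[OF v r1_Yp]])
    ultimately show ?case by blast
  qed
  from this[of "nat t"] show ?thesis using assms by simp
qed

lemma r_nonneg_Y: "t \<ge> 0 \<Longrightarrow> r t \<in> Sp Y"
proof -
  assume "t \<ge> 0"
  then obtain z where "z \<in> Sp Yp" "r t = 1 + z" using r_nonneg by blast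
  then show ?thesis using Sp_add[OF one_Y Yp_Y] by simp
qed

text \<open>This carries polynomiality over to negative exponents: for \<open>t \<ge> 0\<close> the
  inverse of \<open>r (- t)\<close> is a conjugate of \<open>r t\<close>, hence again a polynomial
  in \<open>M b\<close> with constant term 1.\<close>

lemma r_neg:
  "inverse (r (- t)) = M (\<lambda>i. t * u i) * r t * M (- (\<lambda>i. t * u i))"
proof -
  have e: "(\<lambda>i. t * u i) = - (\<lambda>i. - (t * u i))" "- (\<lambda>i. - (t * u i)) = (\<lambda>i. t * u i)" by auto
  have 1: "inverse (M (\<lambda>i. - (- t) * u i)) = M (- (\<lambda>i. t * u i))" by (simp add: M_inverse)
  have "inverse (r (- t)) = inverse (x' powi (- t)) * inverse (M (\<lambda>i. - (- t) * u i))"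
    unfolding mut_ratio_def by (simp add: nonzero_inverse_mult_distrib)
  also have "inverse (x' powi (- t)) = x' powi t" by (simp add: power_int_minus)
  finally show ?thesis by (simp only: 1 var_pow)
qed

lemma r_denominator: "\<exists>D. D \<in> Sp Y \<and> D \<noteq> 0 \<and> r t * D \<in> Sp Y"
proof (cases "t \<ge> 0")
  case True then show ?thesis using r_nonneg_Y one_Y by (intro exI[of _ 1]) auto
next
  case False
  define D where "D = inverse (r t)"
  have "D \<in> Sp Y" using r_neg[of "- t"] conj_span[OF r_nonneg_Y[of "- t"]] False by (simp add: D_def)
  moreover have "r t * D = 1" by (simp add: D_def)
  ultimately show ?thesis using one_Y by (intro exI[of _ D]) (auto simp: D_def)
qed

lemma var_q_comm: "a k = 0 \<Longrightarrow> x' powi t * M a = Q (t * (2 * L u a)) * (M a * x' powi t)"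
proof (rule powi_q_comm)
  assume a: "a k = 0"
  have "(1 + Q (- \<delta>) * M b) * M a = M a * (1 + Q (- \<delta>) * M b)"
    using a by (intro Y_comm Sp_add one_Y Yp_Y r1_Yp Sp_M) simp
  then have "x' * M a = M u * M a * (1 + Q (- \<delta>) * M b)"
    by (simp add: var_eq mult.assoc)
  also have "\<dots> = Q (2 * L u a) * (M a * x')"
    by (simp only: M_comm[of u a] var_eq mult.assoc)
  finally show "x' * M a = Q (2 * L u a) * (M a * x')" .
qed simp

text \<open>The two factors of \<open>r t\<close>, a monomial and a power of \<open>x'\<close>,
  commute with \<open>M a\<close> up to opposite powers of \<open>qh\<close>.\<close>

lemma r_comm_M: "a k = 0 \<Longrightarrow> r t * M a = M a * r t"
proof -
  assume a: "a k = 0"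
  let ?v = "\<lambda>i. - t * u i"
  have v: "L ?v a = - t * L u a" by (rule L_scale_left)
  have "r t * M a = M ?v * (x' powi t * M a)" by (simp only: mut_ratio_def mult.assoc)
  also have "\<dots> = Q (t * (2 * L u a)) * (M ?v * M a * x' powi t)"
    by (simp only: var_q_comm[where a = a and t = t, OF a] Q_left_comm[of "M ?v"] mult.assoc)
  also have "M ?v * M a = Q (2 * (- t * L u a)) * (M a * M ?v)" by (simp only: M_comm[of ?v a] v)
  finally show ?thesis by (simp add: mult.assoc mut_ratio_def)
qed

lemma r_comm: assumes "y \<in> Sp {c. c k = 0}" shows "r t * y = y * r t"
  using assms
proof (induction rule: Sp_induct)
  case (gen s a)
  then show ?case using r_comm_M[of a t] by (simp add: Q_left_comm[of "r t"] mult.assoc)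
qed (simp_all add: algebra_simps)

section \<open>The mutated frame is a frame\<close>

abbreviation "L' \<equiv> \<lambda>a c. L (\<phi> a) (\<phi> c)"

text \<open>The point is the cocycle identity \<open>key\<close>: with \<open>s = a k\<close> and
  \<open>t = c k\<close>, both of its sides equal \<open>M (- s u)\<close> times
  \<open>x' powi (s + t)\<close>. The part of \<open>c\<close> away from \<open>k\<close> commutes
  with the ratios and causes no further factor.\<close>

lemma frame_mult: "M' a * M' c = Q (L' a c) * M' (a + c)"
proof -
  let ?c0 = "\<lambda>i. if i = k then 0 else c i" and ?s = "a k" and ?t = "c k"
  have phic: "M (\<phi> c) = Q (- L ?c0 (\<lambda>i. ?t * u i)) * (M ?c0 * M (\<lambda>i. ?t * u i))"
    by (simp add: M_mult phi_split[of c])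
  have key: "r ?s * M (\<lambda>i. ?t * u i) * r ?t = M (\<lambda>i. ?t * u i) * r (?s + ?t)"
  proof -
    have "r ?s * M (\<lambda>i. ?t * u i) * r ?t = r ?s * x' powi ?t" by (simp only: var_pow mult.assoc)
    also have "\<dots> = M (\<lambda>i. - ?s * u i) * x' powi (?s + ?t)"
      by (simp only: mut_ratio_def mult.assoc) (simp add: power_int_add)
    also have "M (\<lambda>i. - ?s * u i) = M (\<lambda>i. ?t * u i) * M (\<lambda>i. - (?s + ?t) * u i)"
      by (simp add: M_u)
    finally show ?thesis by (simp only: mut_ratio_def mult.assoc)
  qed
  have "r ?s * M (\<phi> c) * r ?t = Q (- L ?c0 (\<lambda>i. ?t * u i)) * (r ?s * M ?c0 * M (\<lambda>i. ?t * u i) * r ?t)"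
    by (simp only: phic Q_left_comm[of "r ?s"] mult.assoc)
  also have "r ?s * M ?c0 = M ?c0 * r ?s" by (rule r_comm_M) simp
  also have "Q (- L ?c0 (\<lambda>i. ?t * u i)) * (M ?c0 * r ?s * M (\<lambda>i. ?t * u i) * r ?t) =
      Q (- L ?c0 (\<lambda>i. ?t * u i)) * (M ?c0 * (r ?s * M (\<lambda>i. ?t * u i) * r ?t))"
    by (simp only: mult.assoc)
  also have "\<dots> = M (\<phi> c) * r (?s + ?t)" unfolding key by (simp only: phic mult.assoc)
  finally have *: "r ?s * M (\<phi> c) * r ?t = M (\<phi> c) * r (?s + ?t)" .
  have "M' a * M' c = M (\<phi> a) * (r ?s * M (\<phi> c) * r ?t)" by (simp only: mut_frame_def mult.assoc)
  also have "\<dots> = M (\<phi> a) * M (\<phi> c) * r (?s + ?t)" unfolding * by (simp only: mult.assoc)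
  also have "\<dots> = Q (L' a c) * M' (a + c)" by (simp add: M_mult mut_frame_def phi_add mult.assoc)
  finally show ?thesis .
qed

lemma r_0[simp]: "r 0 = 1"
  using M_0 by (simp add: mut_ratio_def zero_fun_def)

lemma M'_fix: "a k = 0 \<Longrightarrow> M' a = M a" by (simp add: mut_frame_def phi_fix)

lemma M'_var: "M' (unit_vector k) = x'"
proof -
  have "\<phi> (unit_vector k) = u" by (auto simp: mut_exp_def unit_vector_def)
  moreover have "unit_vector k k = 1" by (simp add: unit_vector_def)
  ultimately show ?thesis by (simp only: mut_frame_def r1 var_eq)
qed

abbreviation "Sp' \<equiv> monomial_span qh M'"

lemma Sp'_factor:
  assumes "y \<in> Sp' A" "A \<subseteq> {a. a k = t}"
  shows "\<exists>z. z \<in> Sp (\<phi> ` A) \<and> y = z * r t"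
  using assms(1) unfolding monomial_span_def
proof (induction rule: additive_span.induct)
  case (gen g)
  then obtain s a where "g = Q s * M' a" "a \<in> A" by auto
  then have "g = (Q s * M (\<phi> a)) * r t" "Q s * M (\<phi> a) \<in> Sp (\<phi> ` A)"
    using assms(2) by (auto simp: mut_frame_def mult.assoc intro!: Sp_M)
  then show ?case unfolding monomial_span_def by blast
next
  case zero then show ?case by (intro exI[of _ 0]) (auto intro: additive_span.zero)
next
  case (diff v w)
  then obtain z z' where "z \<in> Sp (\<phi> ` A)" "v = z * r t" "z' \<in> Sp (\<phi> ` A)" "w = z' * r t"
    unfolding monomial_span_def by auto
  then show ?case using Sp_diff[of z "\<phi> ` A" z'] unfolding monomial_span_def
    by (intro exI[of _ "z - z'"]) (simp add: left_diff_distrib)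
qed

text \<open>Elements of \<open>x\<^sub>k\<close>-degree \<open>- t\<close> in the localization at the nonzero Laurent polynomials in \<open>M b\<close>;
  this localization contains both the torus and the mutated torus.\<close>

definition local_degree :: "int \<Rightarrow> 'f set" where
  "local_degree t = {y. \<exists>D. D \<in> Sp Y \<and> D \<noteq> 0 \<and> y * D \<in> Sp {c. c k = - t}}"

lemma deg_mult_Y:
  assumes "y \<in> Sp {c. c k = t}" "z \<in> Sp Y" shows "y * z \<in> Sp {c. c k = t}"
  by (rule Sp_mult[OF assms]) auto

lemma local_degree_diff:
  assumes "y \<in> local_degree t" "z \<in> local_degree t" shows "y - z \<in> local_degree t"
proof -
  obtain D E where D: "D \<in> Sp Y" "D \<noteq> 0" "y * D \<in> Sp {c. c k = - t}"
    and E: "E \<in> Sp Y" "E \<noteq> 0" "z * E \<in> Sp {c. c k = - t}" using assms by (auto simp: local_degree_def)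
  have c: "D * E = E * D" by (rule Y_comm[OF D(1) Y_deg0[OF E(1)]])
  have "y * D * E - z * E * D \<in> Sp {c. c k = - t}"
    by (rule Sp_diff[OF deg_mult_Y[OF D(3) E(1)] deg_mult_Y[OF E(3) D(1)]])
  then have "(y - z) * (D * E) \<in> Sp {c. c k = - t}"
    by (simp add: left_diff_distrib mult.assoc c)
  then show ?thesis using D E Y_mult[of D E] unfolding local_degree_def by (auto intro!: exI[of _ "D * E"])
qed

lemma local_degree_Sp: "y \<in> Sp {c. c k = - t} \<Longrightarrow> y \<in> local_degree t"
  unfolding local_degree_def using one_Y by (auto intro!: exI[of _ 1])

lemma local_degree_Sp': assumes "y \<in> Sp' {c. c k = t}" shows "y \<in> local_degree t"
proof -
  obtain z where z: "z \<in> Sp (\<phi> ` {c. c k = t})" "y = z * r t"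
    using Sp'_factor[OF assms] by auto
  obtain D where D: "D \<in> Sp Y" "D \<noteq> 0" "r t * D \<in> Sp Y" using r_denominator by blast
  have "z \<in> Sp {c. c k = - t}" using z(1) by (rule Sp_mono) auto
  then have "y * D \<in> Sp {c. c k = - t}" unfolding z(2) mult.assoc using D(3) by (rule deg_mult_Y)
  then show ?thesis using D unfolding local_degree_def by blast
qed

text \<open>A common denominator moves all \<open>y t\<close> into the torus. It exists because
  elements of \<open>Sp Y\<close> commute with each other, and it keeps the
  \<open>x_k\<close>-degrees, which then separate the summands.\<close>

lemma local_degree_direct:
  assumes J: "finite J" and y: "\<And>t. t \<in> J \<Longrightarrow> y t \<in> local_degree t" and sum: "(\<Sum>t\<in>J. y t) = 0"
    and t: "t \<in> J"
  shows "y t = 0"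
proof -
  have "\<exists>D. D \<in> Sp Y \<and> D \<noteq> 0 \<and> (\<forall>t\<in>J. y t * D \<in> Sp {c. c k = - t})"
    using J y
  proof (induction J)
    case empty show ?case using one_Y by (intro exI[of _ 1]) auto
  next
    case (insert t J)
    then obtain D where D: "D \<in> Sp Y" "D \<noteq> 0" "\<And>t. t \<in> J \<Longrightarrow> y t * D \<in> Sp {c. c k = - t}" by auto
    obtain E where E: "E \<in> Sp Y" "E \<noteq> 0" "y t * E \<in> Sp {c. c k = - t}"
      using insert.prems by (auto simp: local_degree_def)
    have c: "D * E = E * D" by (rule Y_comm[OF D(1) Y_deg0[OF E(1)]])
    have "y s * (D * E) \<in> Sp {c. c k = - s}" if "s \<in> insert t J" for s
    proof (cases "s = t")
      case True
      then show ?thesis using deg_mult_Y[OF E(3) D(1)] by (simp add: c mult.assoc)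
    next
      case False
      then show ?thesis using deg_mult_Y[OF D(3) E(1), of s] that by (simp add: mult.assoc)
    qed
    then show ?case using D E Y_mult[of D E] by (intro exI[of _ "D * E"]) auto
  qed
  then obtain D where D: "D \<in> Sp Y" "D \<noteq> 0" "\<And>t. t \<in> J \<Longrightarrow> y t * D \<in> Sp {c. c k = - t}" by blast
  have s: "saturated m {c. c k = - t}" using saturated_coord[OF k, of "\<lambda>x. x = - t"] by simp
  have "(\<Sum>i\<in>J. y i * D) = 0" using sum by (simp add: sum_distrib_right[symmetric])
  then have "0 = pr {c. c k = - t} (\<Sum>i\<in>J. y i * D)" using s by simp
  also have "\<dots> = (\<Sum>i\<in>J. pr {c. c k = - t} (y i * D))"
    using D(3) by (intro pr_sum s) (auto intro: Sp_UNIV)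
  also have "\<dots> = (\<Sum>i\<in>J. if i = t then y t * D else 0)"
  proof (rule sum.cong[OF refl])
    fix i assume i: "i \<in> J"
    show "pr {c. c k = - t} (y i * D) = (if i = t then y t * D else 0)"
    proof (cases "i = t")
      case True then show ?thesis using pr_id[OF s D(3)[OF i]] by simp
    next
      case False
      then have "pr {c. c k = - t} (y i * D) = 0" by (intro pr_eq_0[OF s D(3)[OF i]]) auto
      then show ?thesis using False by simp
    qed
  qed
  also have "\<dots> = y t * D" using J t by simp
  finally show ?thesis using D(2) by simp
qed

lemma Sp'_decompose:
  assumes "y \<in> Sp' A"
  shows "\<exists>J f. finite J \<and> y = (\<Sum>t\<in>J. f t) \<and> (\<forall>t. f t \<in> Sp' (A \<inter> {c. c k = t})) \<and> (\<forall>t. t \<notin> J \<longrightarrow> f t = 0)"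
  using assms unfolding monomial_span_def
proof (induction rule: additive_span.induct)
  case (gen g)
  then obtain s a where a: "g = Q s * M' a" "a \<in> A" by auto
  then show ?case
    by (intro exI[of _ "{a k}"] exI[of _ "\<lambda>t. if t = a k then g else 0"])
       (auto intro: additive_span.gen additive_span.zero)
next
  case zero then show ?case by (intro exI[of _ "{}"] exI[of _ "\<lambda>_. 0"]) (auto intro: additive_span.zero)
next
  case (diff v w)
  then obtain I J f g where *: "finite I" "v = (\<Sum>t\<in>I. f t)"
    "\<forall>t. f t \<in> Sp' (A \<inter> {c. c k = t})" "\<forall>t. t \<notin> I \<longrightarrow> f t = 0" "finite J" "w = (\<Sum>t\<in>J. g t)"
    "\<forall>t. g t \<in> Sp' (A \<inter> {c. c k = t})" "\<forall>t. t \<notin> J \<longrightarrow> g t = 0" unfolding monomial_span_def by auto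
  have "v = (\<Sum>t\<in>I \<union> J. f t)" "w = (\<Sum>t\<in>I \<union> J. g t)"
    unfolding *(2,6) using * by (auto intro!: sum.mono_neutral_left)
  then show ?case using * unfolding monomial_span_def
    by (intro exI[of _ "I \<union> J"] exI[of _ "\<lambda>t. f t - g t"]) (auto simp: sum_subtractf intro: additive_span.diff)
qed

text \<open>Both expressions of \<open>y\<close> are split by the exponent of the mutated variable.
  Parts with the same exponent \<open>t\<close> agree in the localization and have the right factor
  \<open>r t\<close>. Once it is cancelled, the supports lie in the images of \<open>A\<close> and
  of its complement under the bijection \<open>\<phi>\<close>, and the old frame separates
  these.\<close>

lemma mutation_direct:
  assumes A: "saturated m A" and y: "y \<in> Sp' A" "y \<in> Sp' (- A)" shows "y = 0"
proof -
  obtain I f where I: "finite I" "y = (\<Sum>t\<in>I. f t)" "\<And>t. f t \<in> Sp' (A \<inter> {c. c k = t})"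
    "\<And>t. t \<notin> I \<Longrightarrow> f t = 0" using Sp'_decompose[OF y(1)] by blast
  obtain J g where J: "finite J" "y = (\<Sum>t\<in>J. g t)" "\<And>t. g t \<in> Sp' (- A \<inter> {c. c k = t})"
    "\<And>t. t \<notin> J \<Longrightarrow> g t = 0" using Sp'_decompose[OF y(2)] by blast
  have IJ: "y = (\<Sum>t\<in>I \<union> J. f t)"
    unfolding I(2) using I J by (intro sum.mono_neutral_left) auto
  have JI: "y = (\<Sum>t\<in>I \<union> J. g t)"
    unfolding J(2) using I J by (intro sum.mono_neutral_left) auto
  have loc: "f t \<in> local_degree t" "g t \<in> local_degree t" for t
    using I(3)[of t] J(3)[of t] unfolding monomial_span_def
    by (auto intro!: local_degree_Sp'[unfolded monomial_span_def] elim!: subsetD[OF additive_span_mono, rotated])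
  have fg: "f t = g t" if "t \<in> I \<union> J" for t
  proof -
    have "(\<Sum>t\<in>I \<union> J. f t - g t) = 0" using IJ JI by (simp only: sum_subtractf) simp
    then have "f t - g t = 0"
      by (rule local_degree_direct[rotated 2]) (use I J that loc local_degree_diff in auto)
    then show ?thesis by simp
  qed
  have sat: "saturated m (\<phi> ` A)"
    unfolding saturated_def
  proof (intro allI impI)
    fix a c assume ac: "agree m a c" "a \<in> \<phi> ` A"
    then have "\<phi> a \<in> A" by auto
    then have "\<phi> c \<in> A" using A phi_agree[OF ac(1)] unfolding saturated_def by blast
    then have "\<phi> (\<phi> c) \<in> \<phi> ` A" by (rule imageI)
    then show "c \<in> \<phi> ` A" by simp
  qed
  have "f t = 0" for t
  proof (cases "t \<in> I \<union> J")
    case True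
    obtain z where z: "z \<in> Sp (\<phi> ` (A \<inter> {c. c k = t}))" "f t = z * r t" using Sp'_factor[OF I(3)] by auto
    obtain w where w: "w \<in> Sp (\<phi> ` (- A \<inter> {c. c k = t}))" "g t = w * r t" using Sp'_factor[OF J(3)] by auto
    have "z = w" using fg[OF True] z w by simp
    moreover have "z \<in> Sp (\<phi> ` A)" using z(1) by (rule Sp_mono) auto
    moreover have "w \<in> Sp (- \<phi> ` A)" using w(1)
    proof (rule Sp_mono, clarify)
      fix a c assume "a \<notin> A" "\<phi> a = \<phi> c" "c \<in> A"
      then show False by (metis phi_phi)
    qed
    ultimately have "z = 0" using direct[OF sat, of z] by simp
    then show ?thesis using z by simp
  next
    case False then show ?thesis using I(4) by blast
  qed
  then show ?thesis using I(2) by simp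
qed

lemma frame_mutation: "frame qh m M' L'"
proof unfold_locales
  fix a c e
  show "L' (a + c) e = L' a e + L' c e" by (simp add: phi_add L_add_left)
  show "L' a c = - L' c a" by (rule L_skew)
  show "M' a * M' c = Q (L' a c) * M' (a + c)" by (rule frame_mult)
  show "M' 0 = 1" by (simp add: mut_frame_def M_0)
  show "L' a e = L' c e" if "agree m a c" using L_cong[OF phi_agree[OF that]] .
  show "M' a = M' c" if "agree m a c"
    using M_cong[OF phi_agree[OF that]] agreeD[OF that k] by (simp add: mut_frame_def)
next
  show "y = 0" if "saturated m A" "y \<in> Sp' A" "y \<in> Sp' (- A)" for A y
    using mutation_direct[OF that] .
qed

lemma inter_component:
  assumes "y \<in> Sp UNIV" "y \<in> Sp' UNIV"
  shows "\<exists>z. z \<in> Sp {c. c k = - t} \<and> pr {c. c k = - t} y = z * r t"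
proof -
  note dk = degree_map_coord[OF k]
  obtain I where I: "finite I" "\<And>J. finite J \<Longrightarrow> I \<subseteq> J \<Longrightarrow> y = (\<Sum>s\<in>J. pr {c. c k = s} y)"
    using Sp_decompose[OF dk assms(1)] by blast
  obtain J f where J: "finite J" "y = (\<Sum>t\<in>J. f t)" "\<And>t. f t \<in> Sp' (UNIV \<inter> {c. c k = t})"
    "\<And>t. t \<notin> J \<Longrightarrow> f t = 0" using Sp'_decompose[OF assms(2)] by blast
  \<comment> \<open>Exponent \<open>s\<close> of the new variable corresponds to old degree
    \<open>- s\<close>, whence the negated indices. The index \<open>t\<close> is inserted so that
    it occurs even if its component vanishes.\<close>
  let ?K = "insert t (uminus ` I \<union> J)"
  have K: "finite ?K" using I J by auto
  have "y = (\<Sum>s\<in>uminus ` ?K. pr {c. c k = s} y)"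
  proof (rule I(2))
    show "finite (uminus ` ?K)" using K by simp
    show "I \<subseteq> uminus ` ?K"
    proof
      fix x assume "x \<in> I"
      then have "- x \<in> ?K" by simp
      then have "- (- x) \<in> uminus ` ?K" by (rule imageI)
      then show "x \<in> uminus ` ?K" by simp
    qed
  qed
  also have "\<dots> = (\<Sum>s\<in>?K. pr {c. c k = - s} y)"
    by (subst sum.reindex) (auto simp: inj_on_def)
  finally have 1: "y = (\<Sum>s\<in>?K. pr {c. c k = - s} y)" .
  have 2: "y = (\<Sum>s\<in>?K. f s)" using J K by (subst J(2)) (auto intro!: sum.mono_neutral_left)
  have "(\<Sum>s\<in>?K. pr {c. c k = - s} y - f s) = 0" using 1 2 by (simp only: sum_subtractf) simp
  then have "pr {c. c k = - t} y - f t = 0"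
  proof (rule local_degree_direct[rotated 2])
    fix s
    have "pr {c. c k = - s} y \<in> Sp {c. c k = - s}"
      using pr_mem(1)[OF sat_eq[OF dk] assms(1)] by (rule Sp_mono) auto
    moreover have "f s \<in> Sp' {c. c k = s}" using J(3)[of s] by simp
    ultimately show "pr {c. c k = - s} y - f s \<in> local_degree s"
      by (intro local_degree_diff local_degree_Sp local_degree_Sp')
  qed (use K in auto)
  moreover obtain z where "z \<in> Sp (\<phi> ` (UNIV \<inter> {c. c k = t}))" "f t = z * r t" using Sp'_factor[OF J(3)] by auto
  moreover from this(1) have "z \<in> Sp {c. c k = - t}" by (rule Sp_mono) auto
  ultimately show ?thesis by auto
qed

text \<open>Solving the definition of \<open>M'\<close> at \<open>\<phi> a\<close> for
  \<open>M a\<close> leaves the inverse of \<open>r (- a k)\<close>, which \<open>r_neg\<close>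
  turns into a polynomial.\<close>

lemma M_reverse:
  assumes "a k \<ge> 0" shows "\<exists>z. z \<in> Sp Yp \<and> M a = M' (\<phi> a) * (1 + z)"
proof -
  let ?v = "\<lambda>i. a k * u i"
  obtain z where z: "z \<in> Sp Yp" "r (a k) = 1 + z" using r_nonneg[OF assms] by blast
  have "inverse (r (- a k)) = 1 + M ?v * z * M (- ?v)"
    unfolding r_neg z(2) by (simp add: algebra_simps)
  moreover have "M a = M' (\<phi> a) * inverse (r (- a k))" by (simp add: mut_frame_def mult.assoc)
  ultimately show ?thesis using conj_span[OF z(1), of ?v] by auto
qed

lemma Yp_Sp': "z \<in> Sp B \<Longrightarrow> B \<subseteq> Y \<Longrightarrow> z \<in> Sp' B"
proof -
  assume z: "z \<in> Sp B" and B: "B \<subseteq> Y"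
  have e: "M' a = M a" if "a \<in> B" for a using B that by (intro M'_fix) auto
  have "{Q s * M' a | s a. a \<in> B} = {Q s * M a | s a. a \<in> B}"
    by (intro Collect_cong ex_cong1) (auto simp: e)
  then show "z \<in> Sp' B" using z by (simp only: monomial_span_def)
qed

lemma nonneg_Sp':
  assumes "y \<in> Sp {a. a k \<ge> 0}" shows "y \<in> Sp' UNIV"
proof -
  interpret F: frame qh m M' L' by (rule frame_mutation)
  from assms show ?thesis
  proof (induction rule: Sp_induct)
    case (gen s a)
    then obtain z where z: "z \<in> Sp Yp" "M a = M' (\<phi> a) * (1 + z)" using M_reverse[of a] by auto
    have "Yp \<subseteq> Y" by auto
    then have "z \<in> Sp' UNIV" by (intro F.Sp_UNIV[OF Yp_Sp'[OF z(1)]])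
    then have "1 + z \<in> Sp' UNIV" by (intro F.Sp_add F.Sp_1) auto
    then have "M' (\<phi> a) * (1 + z) \<in> Sp' UNIV"
      by (intro F.Sp_mult[of "M' (\<phi> a)" UNIV "1 + z" UNIV] F.Sp_M) auto
    then have "M a \<in> Sp' UNIV" by (simp only: z(2))
    then show ?case by (rule F.Sp_Q)
  next
    case (diff v w) then show ?case by (intro F.Sp_diff)
  qed simp
qed

end

section \<open>Sign independence and involutivity of mutation\<close>

context frame begin

lemma M_powi: "M a powi t = M (\<lambda>i. t * a i)"
proof -
  have nat: "M a ^ n = M (\<lambda>i. int n * a i)" for n
  proof (induction n)
    case 0
    have "(\<lambda>i. int 0 * a i) = 0" by auto
    then show ?case by (simp only: power_0 M_0)
  next
    case (Suc n)
    have "a + (\<lambda>i. int n * a i) = (\<lambda>i. int (Suc n) * a i)" by (auto simp: algebra_simps)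
    then show ?case by (simp only: power_Suc Suc M_mult L_scale_right) simp
  qed
  show ?thesis
  proof (cases "t \<ge> 0")
    case True then show ?thesis using nat[of "nat t"] by (simp add: power_int_def)
  next
    case False
    have "- (\<lambda>i. int (nat (- t)) * a i) = (\<lambda>i. t * a i)" using False by auto
    moreover have "M a powi t = inverse (M a ^ nat (- t))"
      using False by (simp add: power_int_def power_inverse)
    ultimately show ?thesis by (simp only: nat M_inverse)
  qed
qed

end

context mutation begin

text \<open>The mutated variable does not depend on the sign of \<open>b\<close>, so in this form
  the sign enters only through a power of \<open>qh\<close>. This makes it possible to compare the
  two signs and to recognize the frame mutated back.\<close>

lemma frame_alt:
  "M' a = Q (- (a k * L (a(k := 0)) u)) * (M (a(k := 0)) * x' powi a k)"
proof -
  have p: "\<phi> a = a(k := 0) + (\<lambda>i. a k * u i)" by (auto simp: mut_exp_def)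
  have "M (\<phi> a) = Q (- (a k * L (a(k := 0)) u)) * (M (a(k := 0)) * M (\<lambda>i. a k * u i))"
    unfolding p by (simp add: M_mult L_scale_right)
  then show ?thesis by (simp add: mut_frame_def var_pow mult.assoc)
qed

lemma frame_minus: "mut_frame M k (- b) = M'"
proof
  fix a
  have "mutation qh m M L k (- b) (- \<delta>)"
    by unfold_locales (use k \<delta>_nz in \<open>simp_all add: L_minus_left L_b\<close>)
  then have "mut_frame M k (- b) a =
      Q (- (a k * L (a(k := 0)) (mut_vec k (- b)))) * (M (a(k := 0)) * mut_var M k (- b) powi a k)"
    by (rule mutation.frame_alt)
  moreover have "mut_vec k (- b) = u + b" by (auto simp: mut_vec_def)
  moreover have "L (a(k := 0)) b = 0" using L_b[of "a(k := 0)"] L_skew[of "a(k := 0)" b] by simp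
  moreover have "mut_var M k (- b) = x'" by (simp add: mut_var_def add.commute)
  ultimately show "mut_frame M k (- b) a = M' a" by (simp add: frame_alt[of a] L_add_right)
qed

lemma phi_u: "\<phi> u = unit_vector k"
  by (auto simp: mut_exp_def) (auto simp: unit_vector_def mut_vec_def)

lemma mutation_back: "mutation qh m M' L' k b (- \<delta>)"
proof -
  interpret F: frame qh m M' L' by (rule frame_mutation)
  show ?thesis by unfold_locales (use k \<delta>_nz in \<open>simp_all add: phi_fix L_b\<close>)
qed

lemma var_back: "mut_var M' k b = M (unit_vector k)"
proof -
  let ?e = "unit_vector k" and ?c = "1 + Q (- \<delta>) * M b"
  have c: "?c \<noteq> 0" by (rule Yp_nz[OF r1_Yp])
  have e: "(\<lambda>i. - unit_vector k i + max (b i) 0) = u + b" "(\<lambda>i. - unit_vector k i + max (- b i) 0) = u"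
    by (auto simp: mut_vec_def)
  have "mut_var M' k b = (M (?e + b) + M ?e) * r (- 1)"
    unfolding mut_var_def e by (simp add: mut_frame_def phi_add phi_u phi_fix[of b] distrib_right)
  also have "M (?e + b) = Q \<delta> * (M ?e * M b)"
    using L_b[of ?e] L_skew[of ?e b] by (simp add: M_mult unit_vector_def)
  also have "Q \<delta> * (M ?e * M b) + M ?e = M ?e * (1 + Q \<delta> * M b)"
    by (simp add: distrib_left Q_left_comm[of "M ?e"])
  also have "r (- 1) = M u * (inverse ?c * M (- u))"
  proof -
    have "(\<lambda>i. - (- 1) * u i) = u" by auto
    then have "r (- 1) = M u * inverse x'" unfolding mut_ratio_def by (simp add: power_int_minus)
    then show ?thesis using c by (simp add: var_eq nonzero_inverse_mult_distrib M_inverse)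
  qed
  also have "M ?e * (1 + Q \<delta> * M b) * (M u * (inverse ?c * M (- u))) =
      M ?e * (((1 + Q \<delta> * M b) * M u) * (inverse ?c * M (- u)))" by (simp only: mult.assoc)
  \<comment> \<open>Since \<open>L b u = - \<delta>\<close>, moving \<open>M u\<close> past
    \<open>M b\<close> costs \<open>Q (- 2 * \<delta>)\<close>. The result is exactly the binomial
    in \<open>x'\<close>, and it cancels.\<close>
  also have "(1 + Q \<delta> * M b) * M u = M u * ?c"
    using L_b[of u] by (simp add: distrib_left distrib_right mult.assoc M_comm[of b u] Q_left_comm[of "M u"])
  also have "M ?e * (M u * ?c * (inverse ?c * M (- u))) = M ?e"
    using c by (simp add: mult.assoc[of _ ?c] mult.assoc[symmetric, of ?c "inverse ?c"])
  finally show ?thesis .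
qed

lemma frame_back: "mut_frame M' k b = M"
proof
  fix a :: "nat \<Rightarrow> int"
  let ?a = "a(k := 0)" and ?e = "unit_vector k"
  interpret B: mutation qh m M' L' k b "- \<delta>" by (rule mutation_back)
  have "M' ?a = M ?a" by (simp add: M'_fix)
  then have 1: "mut_frame M' k b a = Q (- (a k * L ?a ?e)) * (M ?a * M ?e powi a k)"
    using B.frame_alt[of a] by (simp add: var_back phi_fix phi_u)
  have s: "?a + (\<lambda>i. a k * ?e i) = a" by (auto simp: unit_vector_def)
  have "M ?a * M (\<lambda>i. a k * ?e i) = Q (a k * L ?a ?e) * M a" unfolding M_mult s by (simp add: L_scale_right)
  then show "mut_frame M' k b a = M a" by (simp add: 1 M_powi)
qed

text \<open>Compare the lowest and the highest degree of the quotient \<open>h\<close>.\<close>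

lemma ratio_unique:
  assumes "h \<in> Sp UNIV" and eq: "M a + Q s * M (a + b) = h * r 1"
  shows "M a + Q s * M (a + b) = M a * r 1"
proof -
  let ?l = dual_degree and ?w = "Q (- \<delta>) * M b"
  have lm: "degree_map m (\<lambda>c. - ?l c)"
    using dual_degree by (auto simp: degree_map_def)
  have lb: "?l b = \<delta> * \<delta>" using dual_degree_b[of 1] by simp
  define \<eta> where "\<eta> = h - M a"
  have \<eta>U: "\<eta> \<in> Sp UNIV" unfolding \<eta>_def by (intro Sp_diff assms Sp_M) simp
  have "\<eta> * (1 + ?w) = Q s * M (a + b) - Q (- \<delta>) * (M a * M b)"
    unfolding \<eta>_def left_diff_distrib using eq by (simp add: r1 distrib_left Q_left_comm[of "M a"] algebra_simps)
  then have \<eta>: "\<eta> * (1 + ?w) \<in> Sp {a + b}"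
    by (simp add: M_mult) (intro Sp_diff Sp_gen; simp)
  have 1: "\<eta> \<in> Sp {c. ?l c \<ge> ?l (a + b)}"
  proof (rule Sp_cancel_low[OF dual_degree \<eta>U])
    have ld: "lead ?l 0 (1 + ?w)" by (rule Yp_lead[OF r1_Yp])
    show "1 + ?w \<in> Sp {c. 0 \<le> ?l c}" using lead_mem[OF ld] by (simp add: degree_map_zero[OF dual_degree])
    show "pr {c. ?l c = 0} (1 + ?w) \<noteq> 0"
      using lead_pr[OF dual_degree ld] by (auto simp: degree_map_zero[OF dual_degree])
    show "\<eta> * (1 + ?w) \<in> Sp {c. ?l (a + b) \<le> ?l c}" by (rule Sp_mono[OF \<eta>]) auto
  qed
  have 2: "\<eta> \<in> Sp {c. - ?l c \<ge> - ?l a}"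
  proof (rule Sp_cancel_low[OF lm \<eta>U])
    \<comment> \<open>With respect to the negated degree the top term of \<open>1 + ?w\<close>
      leads; the factor \<open>M (- b)\<close> shifts it to degree 0, as the cancellation lemma
      requires.\<close>
    have e: "(1 + ?w) * M (- b) = Q (- \<delta>) + M (- b)" by (simp add: distrib_right mult.assoc)
    have ld: "lead (\<lambda>c. - ?l c) 0 ((1 + ?w) * M (- b))"
      unfolding e using lead_M[of "\<lambda>c. - ?l c" 0 "- \<delta>"] \<delta>_sq
      by (intro lead_add) (auto intro!: Sp_M simp: M_0 degree_map_minus[OF dual_degree] degree_map_zero[OF dual_degree] lb)
    show "(1 + ?w) * M (- b) \<in> Sp {c. 0 \<le> - ?l c}"
      using lead_mem[OF ld] by (simp add: degree_map_zero[OF dual_degree])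
    show "pr {c. - ?l c = 0} ((1 + ?w) * M (- b)) \<noteq> 0"
      using lead_pr[OF lm ld] by (auto simp: degree_map_zero[OF dual_degree])
    have "\<eta> * (1 + ?w) * M (- b) \<in> Sp {a}" by (rule Sp_mult[OF \<eta>, of _ "{- b}"]) (auto intro: Sp_M)
    then show "\<eta> * ((1 + ?w) * M (- b)) \<in> Sp {c. - ?l a \<le> - ?l c}"
      unfolding mult.assoc by (rule Sp_mono) auto
  qed
  have "\<eta> \<in> Sp (- {c. ?l c \<ge> ?l (a + b)})"
    by (rule Sp_mono[OF 2]) (use \<delta>_sq lb in \<open>auto simp: degree_map_add[OF dual_degree]\<close>)
  then have "\<eta> = 0" using direct[OF sat_ge[OF dual_degree] 1] by blast
  then show ?thesis using eq by (simp add: \<eta>_def)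
qed

end

section \<open>Rank two exchange\<close>

lemma (in frame) pr_pr:
  assumes "saturated m P" "saturated m P'" "y \<in> Sp UNIV"
  shows "pr P (pr P' y) = pr (P \<inter> P') y"
proof (rule pr_eqI[symmetric])
  show "saturated m (P \<inter> P')" using assms unfolding saturated_def by blast
  note 1 = pr_mem'[OF assms(2,3)]
  note 2 = pr_mem[OF assms(1) 1(1)]
  show "pr P (pr P' y) \<in> Sp (P \<inter> P')" using 2(1) by (rule Sp_mono) auto
  have "pr P' y - pr P (pr P' y) \<in> Sp (- (P \<inter> P'))" "y - pr P' y \<in> Sp (- (P \<inter> P'))"
    by (rule Sp_mono[OF 2(2)], blast, rule Sp_mono[OF 1(2)], blast)
  then have "(pr P' y - pr P (pr P' y)) + (y - pr P' y) \<in> Sp (- (P \<inter> P'))" by (rule Sp_add)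
  then show "y - pr P (pr P' y) \<in> Sp (- (P \<inter> P'))" by simp
qed

text \<open>The columns \<open>b\<close> and \<open>c\<close> are taken with the signs for which the leading exponents of the mutated
  variables, \<open>J.u\<close> at \<open>j\<close> and \<open>K.u\<close> at \<open>k\<close>, have \<open>x\<^sub>k\<close>-degree and \<open>x\<^sub>j\<close>-degree 0, respectively.\<close>

locale mutation_pair = frame qh m M L + J: mutation qh m M L j b \<delta> + K: mutation qh m M L k c \<epsilon>
  for qh :: "'f::division_ring" and m M L j b \<delta> k c \<epsilon> +
  assumes jk: "j \<noteq> k" and b_k: "b k \<ge> 0" and c_j: "c j \<ge> 0"
begin

lemma bc_zero: "b k = 0 \<longleftrightarrow> c j = 0"
  using J.L_b[of c] K.L_b[of b] L_skew[of b c] J.\<delta>_nz K.\<delta>_nz by auto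

lemma u_k: "J.u k = 0" and v_j: "K.u j = 0"
  using jk b_k c_j by (simp_all add: mut_vec_def unit_vector_def)

lemma phi_j_k: "J.\<phi> a k = a k"
  using jk by (simp add: mut_exp_def u_k)

abbreviation "M2 \<equiv> mut_frame J.M' k (J.\<phi> c)"
abbreviation "T2 \<equiv> monomial_span qh M2 UNIV"
abbreviation "TJ \<equiv> monomial_span qh J.M' UNIV"
abbreviation "TK \<equiv> monomial_span qh K.M' UNIV"
abbreviation "T \<equiv> monomial_span qh M UNIV"

lemma mutation_second: "mutation qh m J.M' J.L' k (J.\<phi> c) \<epsilon>"
proof -
  interpret F: frame qh m J.M' J.L' by (rule J.frame_mutation)
  show ?thesis
    by unfold_locales (use K.k K.\<delta>_nz in \<open>simp_all add: K.L_b phi_j_k\<close>)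
qed

sublocale FJ: frame qh m J.M' J.L' by (rule J.frame_mutation)
sublocale FK: frame qh m K.M' K.L' by (rule K.frame_mutation)
sublocale S: mutation qh m J.M' J.L' k "J.\<phi> c" \<epsilon> by (rule mutation_second)
sublocale F2: frame qh m M2 S.L' by (rule S.frame_mutation)

lemma T2_nonneg: "y \<in> FJ.Sp {a. a k \<ge> 0} \<Longrightarrow> y \<in> T2"
  by (rule S.nonneg_Sp')

lemma J_Yp_nonneg: "z \<in> Sp J.Yp \<Longrightarrow> z \<in> Sp {a. a k \<ge> 0}"
  using b_k by (elim Sp_mono) auto

lemma J_r_nonneg: "t \<ge> 0 \<Longrightarrow> J.r t \<in> Sp {a. a k \<ge> 0}"
  using J.r_nonneg[of t] J_Yp_nonneg Sp_add[OF Sp_1] by fastforce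

lemma M_T2: assumes "a j \<ge> 0" "a k \<ge> 0" shows "M a \<in> T2"
proof -
  obtain z where z: "z \<in> Sp J.Yp" "M a = J.M' (J.\<phi> a) * (1 + z)" using J.M_reverse[of a] assms by blast
  have "J.Yp \<subseteq> J.Y" by auto
  then have "z \<in> FJ.Sp J.Yp" by (rule J.Yp_Sp'[OF z(1)])
  then have "z \<in> FJ.Sp {a. a k \<ge> 0}" by (rule FJ.Sp_mono) (use b_k in auto)
  then have "1 + z \<in> FJ.Sp {a. a k \<ge> 0}" by (intro FJ.Sp_add FJ.Sp_1) auto
  moreover have "J.M' (J.\<phi> a) \<in> FJ.Sp {a. a k \<ge> 0}" by (rule FJ.Sp_M) (use assms in \<open>simp add: phi_j_k\<close>)
  ultimately have "J.M' (J.\<phi> a) * (1 + z) \<in> FJ.Sp {a. a k \<ge> 0}" by (elim FJ.Sp_mult) auto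
  then show ?thesis unfolding z(2) by (rule T2_nonneg)
qed

text \<open>The monomial \<open>M a\<close> with the correction that membership in \<open>TJ\<close>
  requires: for \<open>a j < 0\<close> it is a monomial of the frame mutated at \<open>j\<close>. By
  \<open>component_j\<close>, the elements common to \<open>T\<close> and \<open>TJ\<close> are
  combinations of these.\<close>

definition N :: "(nat \<Rightarrow> int) \<Rightarrow> 'f" where "N a = M a * J.r (max 0 (- a j))"

lemma N_neg: "a j \<le> 0 \<Longrightarrow> N a = J.M' (J.\<phi> a)"
  by (simp add: N_def mut_frame_def max_def)

lemma N_nonneg: "a j \<ge> 0 \<Longrightarrow> N a = M a"
  by (simp add: N_def max_def)

lemma N_T2: assumes "a k \<ge> 0" shows "N a \<in> T2"
proof (cases "a j \<ge> 0")
  case True then show ?thesis using M_T2[of a] assms by (simp add: N_nonneg)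
next
  case False
  then have "N a \<in> FJ.Sp {a. a k \<ge> 0}" using assms by (auto simp: N_neg phi_j_k intro!: FJ.Sp_M)
  then show ?thesis by (rule T2_nonneg)
qed

lemma N_TJ: "N a \<in> TJ"
proof (cases "a j \<ge> 0")
  case True then show ?thesis by (auto simp: N_nonneg intro!: J.nonneg_Sp' Sp_M)
next
  case False then show ?thesis by (auto simp: N_neg intro!: FJ.Sp_M)
qed

lemma N_deg: assumes "a k \<ge> 0" shows "N a \<in> Sp {a. a k \<ge> 0}"
proof -
  have "M a \<in> Sp {a. a k \<ge> 0}" using assms by (intro Sp_M) simp
  moreover have "J.r (max 0 (- a j)) \<in> Sp {a. a k \<ge> 0}" by (rule J_r_nonneg) simp
  ultimately show ?thesis unfolding N_def by (elim Sp_mult) auto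
qed

lemma N_TK: "a k \<ge> 0 \<Longrightarrow> N a \<in> TK"
  by (rule K.nonneg_Sp'[OF N_deg])

lemma var_T: "K.x' \<in> T" unfolding mut_var_def by (intro Sp_add Sp_M) auto

lemma var_TK: "K.x' \<in> TK" using FK.Sp_M[of "unit_vector k" UNIV] by (simp add: K.M'_var)

lemma var_TJ: "K.x' \<in> TJ"
  using jk unfolding mut_var_def by (intro J.nonneg_Sp' Sp_add Sp_M) (auto simp: unit_vector_def)

text \<open>The heart of the rank two case. If \<open>c j = 0\<close>, the variable is also the one
  obtained by mutating at \<open>j\<close> and then at \<open>k\<close>. Otherwise the term
  \<open>M a\<close> of \<open>K.x'\<close> is rewritten in the frame mutated at \<open>j\<close>.
  Its part with a positive power of \<open>M b\<close> has \<open>x_k\<close>-degree at least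
  \<open>- 1 + b k \<ge> 0\<close>, hence lies in \<open>T2\<close>; what is left, together with the
  other term of \<open>K.x'\<close>, is a monomial times the new variable
  \<open>S.x'\<close>.\<close>

lemma var_T2: "K.x' \<in> T2"
proof (cases "c j = 0")
  case True
  have p: "J.\<phi> c = c" using True by (simp add: J.phi_fix)
  have "mut_var M k c = mut_var J.M' k c" using jk True
    unfolding mut_var_def by (subst (1 2) J.M'_fix) (auto simp: unit_vector_def)
  also have "\<dots> \<in> T2" using F2.Sp_M[of "unit_vector k" UNIV] S.M'_var p by simp
  finally show ?thesis .
next
  case False
  then have bpos: "b k \<ge> 1" using bc_zero b_k by auto
  define a where "a = (\<lambda>i. - unit_vector k i + max (c i) 0)"
  define h where "h = K.u"
  have ah: "a = h + c" by (auto simp: a_def h_def mut_vec_def)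
  have hj: "h j = 0" and hk: "h k = - 1" using v_j by (simp_all add: h_def)
  have xk: "K.x' = M a + M h" by (simp add: mut_var_def a_def h_def mut_vec_def)
  have Mh: "M h = J.M' h" using hj by (simp add: J.M'_fix)
  obtain z where z: "z \<in> Sp J.Yp" "M a = J.M' (J.\<phi> a) * (1 + z)"
    using J.M_reverse[of a] c_j jk by (auto simp: a_def unit_vector_def)
  have "J.Yp \<subseteq> J.Y" by auto
  then have z': "z \<in> FJ.Sp J.Yp" by (rule J.Yp_Sp'[OF z(1)])
  have "J.M' (J.\<phi> a) * z \<in> FJ.Sp {a. a k \<ge> 0}"
  proof (rule FJ.Sp_mult[of "J.M' (J.\<phi> a)" "{J.\<phi> a}" z, OF _ z'])
    show "J.M' (J.\<phi> a) \<in> FJ.Sp {J.\<phi> a}" by (rule FJ.Sp_M) simp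
    fix e f assume "e \<in> {J.\<phi> a}" "f \<in> J.Yp"
    then obtain t where "e = J.\<phi> a" "f = (\<lambda>i. t * b i)" "t \<ge> 1" by auto
    moreover have "a k = - 1" using hk by (simp add: ah)
    moreover from \<open>t \<ge> 1\<close> bpos have "1 * 1 \<le> t * b k" by (intro mult_mono) auto
    ultimately show "e + f \<in> {a. a k \<ge> 0}" by (simp add: phi_j_k)
  qed
  then have 1: "J.M' (J.\<phi> a) * z \<in> T2" by (rule T2_nonneg)
  have "J.\<phi> a = h + J.\<phi> c" by (simp add: ah J.phi_add J.phi_fix[of h] hj)
  moreover have "J.L' h (J.\<phi> c) = \<epsilon>" using S.L_b[of h] FJ.L_skew[of h "J.\<phi> c"] hk by simp
  ultimately have "J.M' (J.\<phi> a) = Q (- \<epsilon>) * (J.M' h * J.M' (J.\<phi> c))" by (simp add: FJ.M_mult)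
  then have "J.M' (J.\<phi> a) + J.M' h = J.M' h * (1 + Q (- \<epsilon>) * J.M' (J.\<phi> c))"
    by (simp add: distrib_left Q_left_comm[of "J.M' h"])
  also have "\<dots> = J.M' h * J.M' (- S.u) * S.x'" by (simp add: S.var_eq mult.assoc)
  also have "\<dots> = Q (J.L' h (- S.u)) * (M2 (h - S.u) * S.x')"
    using hk by (subst S.M'_fix) (simp_all add: FJ.M_mult mult.assoc)
  also have "\<dots> \<in> T2"
    unfolding S.M'_var[symmetric] by (intro F2.Sp_Q F2.Sp_mult[of _ UNIV _ UNIV] F2.Sp_M) auto
  finally have 2: "J.M' (J.\<phi> a) + J.M' h \<in> T2" .
  have "K.x' = (J.M' (J.\<phi> a) + J.M' h) + J.M' (J.\<phi> a) * z"
    unfolding xk Mh z(2) by (simp add: distrib_left)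
  then show ?thesis using F2.Sp_add[OF 2 1] by simp
qed

lemma var_pow_mem: "K.x' powi (int t) \<in> T" "K.x' powi (int t) \<in> TJ" "K.x' powi (int t) \<in> TK" "K.x' powi (int t) \<in> T2"
proof -
  have "K.x' ^ t \<in> T \<and> K.x' ^ t \<in> TJ \<and> K.x' ^ t \<in> TK \<and> K.x' ^ t \<in> T2"
  proof (induction t)
    case 0 show ?case by (simp add: Sp_1 FJ.Sp_1 FK.Sp_1 F2.Sp_1)
  next
    case (Suc t)
    then show ?case unfolding power_Suc
      using Sp_mult[OF var_T, of _ UNIV UNIV] FJ.Sp_mult[OF var_TJ, of _ UNIV UNIV]
        FK.Sp_mult[OF var_TK, of _ UNIV UNIV] F2.Sp_mult[OF var_T2, of _ UNIV UNIV] by blast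
  qed
  then show "K.x' powi (int t) \<in> T" "K.x' powi (int t) \<in> TJ" "K.x' powi (int t) \<in> TK" "K.x' powi (int t) \<in> T2"
    by simp_all
qed

lemma dk: "degree_map m (\<lambda>a. a k)" by (rule degree_map_coord[OF K.k])
lemma dj: "degree_map m (\<lambda>a. a j)" by (rule degree_map_coord[OF J.k])

lemma K_r_nonneg: "t \<ge> 0 \<Longrightarrow> K.r t \<in> Sp {a. a k = 0}"
  using K.Y_deg0[OF K.r_nonneg_Y] .

lemma pow_deg: "t \<ge> 0 \<Longrightarrow> K.x' powi t \<in> Sp {a. a k = - t}"
  unfolding K.var_pow
  by (rule Sp_mult[OF Sp_M[of _ "{\<lambda>i. t * K.u i}"] K_r_nonneg]) auto

definition good :: "int \<Rightarrow> 'f \<Rightarrow> bool" where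
  "good t w \<longleftrightarrow> w \<in> TJ \<and> w \<in> TK \<and> w \<in> T2 \<and> w \<in> Sp {a. a k \<ge> - t}"

lemma good_diff: "good t v \<Longrightarrow> good t w \<Longrightarrow> good t (v - w)"
  by (simp add: good_def Sp_diff FJ.Sp_diff FK.Sp_diff F2.Sp_diff)

lemma good_0: "good t 0" by (simp add: good_def)

lemma good_sum: "(\<And>i. i \<in> I \<Longrightarrow> good t (f i)) \<Longrightarrow> good t (sum f I)"
  by (simp add: good_def Sp_sum FJ.Sp_sum FK.Sp_sum F2.Sp_sum)

lemma good_Q: "good t w \<Longrightarrow> good t (Q s * w)"
  by (simp add: good_def)

lemma good_gen: assumes "a k = 0" shows "good (int t) (N a * K.x' powi int t)"
proof -
  have "N a * K.x' powi int t \<in> TJ" by (rule FJ.Sp_mult[OF N_TJ var_pow_mem(2)]) simp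
  moreover have "N a * K.x' powi int t \<in> TK" by (rule FK.Sp_mult[OF N_TK var_pow_mem(3)]) (use assms in auto)
  moreover have "N a * K.x' powi int t \<in> T2" by (rule F2.Sp_mult[OF N_T2 var_pow_mem(4)]) (use assms in auto)
  moreover have "N a * K.x' powi int t \<in> Sp {a. a k \<ge> - int t}"
    by (rule Sp_mult[OF N_deg pow_deg]) (use assms in auto)
  ultimately show ?thesis by (simp add: good_def)
qed

lemma shift:
  assumes "a k = - t"
  shows "M a = Q (- L (a - (\<lambda>i. t * K.u i)) (\<lambda>i. t * K.u i)) * (M (a - (\<lambda>i. t * K.u i)) * M (\<lambda>i. t * K.u i))"
    and "(a - (\<lambda>i. t * K.u i)) k = 0" and "(a - (\<lambda>i. t * K.u i)) j = a j"
  using assms v_j by (simp_all add: M_mult)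

text \<open>For \<open>b k > 0\<close> every positive power of \<open>M b\<close> contains a
  positive power of \<open>x_k\<close>. So the correction factor in \<open>N\<close> is invisible in
  the lowest \<open>x_k\<close>-degree, and each monomial of \<open>h\<close> can be lifted
  separately.\<close>

lemma lift_generic:
  assumes "b k > 0" "h \<in> Sp {a. a k = - int t}"
  shows "\<exists>w. good (int t) w \<and> pr {a. a k = - int t} w = h * K.r (int t)"
  using assms(2)
proof (induction rule: Sp_induct)
  case (gen s a)
  \<comment> \<open>The monomial part of \<open>K.x' powi int t\<close> is taken out of
    \<open>a\<close>. Since \<open>K.u\<close> has entry -1 at \<open>k\<close> and 0 at
    \<open>j\<close>, the \<open>x_k\<close>-exponent becomes 0 and the \<open>x_j\<close>-exponent
    is unchanged.\<close>
  define a' where "a' = a - (\<lambda>i. int t * K.u i)"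
  note sh = shift[of a "int t", folded a'_def]
  have ak: "a k = - int t" using gen by simp
  let ?w = "N a' * K.x' powi int t"
  have a'k: "a' k = 0" using sh(2) ak by blast
  have N1: "pr {a. a k = 0} (N a') = M a'"
  proof -
    obtain z where z: "z \<in> Sp J.Yp" "J.r (max 0 (- a' j)) = 1 + z" using J.r_nonneg[of "max 0 (- a' j)"] by auto
    have "M a' * z \<in> Sp (- {a. a k = 0})"
    proof (rule Sp_mult[OF Sp_M[of a' "{a'}"] z(1)])
      fix e f assume "e \<in> {a'}" "f \<in> J.Yp"
      then obtain s where "e = a'" "f = (\<lambda>i. s * b i)" "s \<ge> 1" by auto
      moreover from \<open>s \<ge> 1\<close> assms(1) have "0 < s * b k" by simp
      ultimately show "e + f \<in> - {a. a k = 0}" using a'k by auto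
    qed simp
    then show ?thesis unfolding N_def z(2)
      by (intro pr_eqI sat_eq[OF dk]) (auto simp: distrib_left a'k intro!: Sp_M)
  qed
  have "pr {a. a k = - int t} ?w = pr {a. a k = 0} (N a') * K.x' powi int t"
    by (rule pr_mult[OF sat_eq[OF dk] sat_eq[OF dk] Sp_UNIV[OF N_deg] pow_deg]) (auto simp: a'k)
  also have "\<dots> = M a' * M (\<lambda>i. int t * K.u i) * K.r (int t)" by (simp only: N1 K.var_pow mult.assoc)
  finally have "pr {a. a k = - int t} ?w = M a' * M (\<lambda>i. int t * K.u i) * K.r (int t)" .
  moreover define s' where "s' = s - L a' (\<lambda>i. int t * K.u i)"
  moreover have "pr {a. a k = - int t} (Q s' * ?w) = Q s' * pr {a. a k = - int t} ?w"
  proof (rule pr_Q[OF sat_eq[OF dk]])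
    show "?w \<in> Sp UNIV" using good_gen[where a = a', OF a'k] Sp_UNIV unfolding good_def by blast
  qed
  ultimately have "pr {a. a k = - int t} (Q s' * ?w) = Q s * M a * K.r (int t)"
    using sh(1)[OF ak] by (simp add: mult.assoc)
  then show ?case using good_Q[OF good_gen[where a = a', OF a'k]] by blast
next
  case zero then show ?case using good_0 by (intro exI[of _ 0]) (simp add: sat_eq[OF dk])
next
  case (diff u v)
  then obtain w w' where w: "good (int t) w" "pr {a. a k = - int t} w = u * K.r (int t)"
    "good (int t) w'" "pr {a. a k = - int t} w' = v * K.r (int t)" by blast
  moreover have "w \<in> Sp UNIV" "w' \<in> Sp UNIV" using w Sp_UNIV unfolding good_def by blast+
  ultimately show ?case using good_diff[of "int t" w w']
    by (intro exI[of _ "w - w'"]) (simp add: pr_diff[OF sat_eq[OF dk]] left_diff_distrib)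
qed

lemma component_j:
  assumes "y \<in> T" "y \<in> TJ"
  shows "\<exists>z. z \<in> Sp {a. a j = s} \<and> pr {a. a j = s} y = z * J.r (max 0 (- s))"
proof (cases "s < 0")
  case True then show ?thesis using J.inter_component[OF assms, of "- s"] by (simp add: max_def)
next
  case False
  then show ?thesis using pr_mem'(1)[OF sat_eq[OF dj] assms(1), of s]
    by (intro exI[of _ "pr {a. a j = s} y"]) (simp add: max_def)
qed

text \<open>If \<open>b k = 0\<close>, the ratios at \<open>j\<close> survive in the lowest
  \<open>x_k\<close>-degree, so membership in \<open>TJ\<close> must be exploited: it makes
  \<open>h * K.r (int t)\<close> divisible by a ratio at \<open>j\<close> in each
  \<open>x_j\<close>-degree. The two ratios are coprime, as \<open>K.dual_degree\<close> vanishes on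
  \<open>b\<close> whereas \<open>K.r (int t)\<close> has leading term 1 for it. So \<open>h\<close>
  itself is divisible, and the quotient times both ratios is a combination of elements
  \<open>N a' * K.x' powi int t\<close>.\<close>

lemma lift_disjoint:
  assumes bk: "b k = 0" and y: "y \<in> T" "y \<in> TJ" and h: "h \<in> Sp {a. a k = - int t}"
    and eq: "pr {a. a k = - int t} y = h * K.r (int t)"
  shows "good (int t) (h * K.r (int t))"
proof -
  have cj: "c j = 0" using bk bc_zero by simp
  let ?g = "h * K.r (int t)" and ?r = "K.r (int t)"
  have r0: "?r \<in> Sp {a. a j = 0}"
    by (rule Sp_mono[OF K.r_nonneg_Y]) (auto simp: cj)
  have Jr0: "J.r s \<in> Sp {a. a k = 0}" if "s \<ge> 0" for s
    by (rule Sp_mono[OF J.r_nonneg_Y[OF that]]) (auto simp: bk)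
  have gU: "?g \<in> Sp UNIV" by (rule Sp_mult[OF h r0]) simp
  have gen: "good (int t) (G * J.r (max 0 (- s)) * ?r)" if "G \<in> Sp {a. a j = s \<and> a k = - int t}" for G s
    using that
  proof (induction rule: Sp_induct)
    case (gen q a)
    define a' where "a' = a - (\<lambda>i. int t * K.u i)"
    note sh = shift[of a "int t", folded a'_def]
    have ak: "a k = - int t" "a j = s" using gen by simp_all
    have "M (\<lambda>i. int t * K.u i) * J.r (max 0 (- s)) = J.r (max 0 (- s)) * M (\<lambda>i. int t * K.u i)"
      by (rule J.r_comm_M[symmetric]) (simp add: v_j)
    then have "M a' * (M (\<lambda>i. int t * K.u i) * J.r (max 0 (- s))) * ?r = N a' * K.x' powi int t"
      using sh(3) ak by (simp add: N_def K.var_pow[symmetric] mult.assoc del: power_int_of_nat)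
    then have "Q q * M a * J.r (max 0 (- s)) * ?r =
        Q (q - L a' (\<lambda>i. int t * K.u i)) * (N a' * K.x' powi int t)"
      using sh(1)[OF ak(1)] by (simp add: mult.assoc)
    then show ?case using good_Q[OF good_gen] sh(2)[OF ak(1)] by simp
  next
    case zero show ?case by (simp add: good_0)
  next
    case (diff v w) then show ?case by (simp add: left_diff_distrib good_diff)
  qed
  have comp: "good (int t) (pr {a. a j = s} ?g)" for s
  proof -
    let ?h = "pr {a. a j = s} h"
    have hs: "?h \<in> Sp {a. a j = s \<and> a k = - int t}"
      using pr_mem(1)[OF sat_eq[OF dj] h] by (rule Sp_mono) auto
    have gs: "pr {a. a j = s} ?g = ?h * ?r"
      by (rule pr_mult[OF sat_eq[OF dj] sat_eq[OF dj] h r0]) auto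
    obtain z where z: "z \<in> Sp {a. a j = s}" "pr {a. a j = s} y = z * J.r (max 0 (- s))"
      using component_j[OF y] by blast
    have "pr {a. a j = s} ?g = pr {a. a k = - int t} (pr {a. a j = s} y)"
      unfolding eq[symmetric] by (simp add: pr_pr sat_eq[OF dk] sat_eq[OF dj] y Int_commute)
    also have "\<dots> = pr {a. a k = - int t} z * J.r (max 0 (- s))" unfolding z(2)
      by (rule pr_mult[OF sat_eq[OF dk] sat_eq[OF dk] z(1) Jr0]) auto
    finally have e: "?h * ?r = pr {a. a k = - int t} z * J.r (max 0 (- s))" using gs by simp
    let ?q = "J.r (max 0 (- s))"
    have "\<exists>G. \<forall>i\<in>{0::nat}. G i \<in> Sp {a. \<forall>i\<in>{j, k}. a i = (if i = j then s else - int t)} \<and> ?h = G i * ?q"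
    proof (rule division[of K.dual_degree _ "{j, k}" "\<lambda>_. ?h" _ "\<lambda>_. 0" "\<lambda>_. ?r" _ "pr {a. a k = - int t} z"])
      show "degree_map m K.dual_degree" by (rule K.dual_degree)
      show "{j, k} \<subseteq> {1..m}" using J.k K.k by auto
      show "?h \<in> Sp {a. \<forall>i\<in>{j, k}. a i = (if i = j then s else - int t)}"
        by (rule Sp_mono[OF hs]) (use jk in auto)
      obtain w where "w \<in> Sp K.Yp" "?r = 1 + w" using K.r_nonneg[of "int t"] by auto
      then show "lead K.dual_degree 0 ?r" using K.Yp_lead by simp
      show "K.dual_degree 0 = 0" by (rule degree_map_zero[OF K.dual_degree])
      show "?q \<in> Sp {a. K.dual_degree a = 0 \<and> (\<forall>i\<in>{j, k}. a i = 0)}"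
        by (rule Sp_mono[OF J.r_nonneg_Y])
          (use jk in \<open>auto simp: bk K.dual_degree_def L_scale_left J.L_b unit_vector_def\<close>)
      show "?q * ?r = ?r * ?q" by (rule J.r_comm[OF r0])
      show "?q * M 0 = M 0 * ?q" by (simp add: M_0)
      show "pr {a. a k = - int t} z \<in> Sp UNIV"
        using pr_mem(1)[OF sat_eq[OF dk] z(1)] by (rule Sp_UNIV)
      show "(\<Sum>i\<in>{0::nat}. ?h * ?r) = pr {a. a k = - int t} z * ?q" by (simp add: e)
    qed auto
    then obtain G where G: "G \<in> Sp {a. \<forall>i\<in>{j, k}. a i = (if i = j then s else - int t)}" "?h = G * ?q"
      by auto
    have "G \<in> Sp {a. a j = s \<and> a k = - int t}" using G(1) by (rule Sp_mono) (use jk in auto)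
    from gen[OF this] show ?thesis unfolding gs G(2) .
  qed
  obtain I where "?g = (\<Sum>s\<in>I. pr {a. a j = s} ?g)"
    using Sp_decompose[OF dj gU] by blast
  moreover have "good (int t) (\<Sum>s\<in>I. pr {a. a j = s} ?g)" by (rule good_sum[OF comp])
  ultimately show ?thesis by simp
qed

text \<open>In each \<open>x_j\<close>-degree \<open>y\<close> is some \<open>z\<close> times a
  ratio that has only nonnegative \<open>x_k\<close>-degrees and a nonzero part in degree 0. Hence
  the bound on the degree passes to \<open>z\<close>, and \<open>y\<close> is a combination of
  elements \<open>N a\<close> with \<open>a k \<ge> 0\<close>.\<close>

lemma nonneg_T2:
  assumes y: "y \<in> T" "y \<in> TJ" and deg: "y \<in> Sp {a. a k \<ge> 0}"
  shows "y \<in> T2"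
proof -
  have "pr {a. a j = s} y \<in> T2" for s
  proof -
    obtain z where z: "z \<in> Sp {a. a j = s}" "pr {a. a j = s} y = z * J.r (max 0 (- s))"
      using component_j[OF y] by blast
    let ?r = "J.r (max 0 (- s))"
    have "z * ?r \<in> Sp {a. a k \<ge> 0}"
      unfolding z(2)[symmetric] using pr_mem(1)[OF sat_eq[OF dj] deg] by (rule Sp_mono) auto
    moreover have "pr {a. a k = 0} ?r \<noteq> 0"
    proof -
      obtain w where w: "w \<in> Sp J.Yp" "?r = 1 + w" using J.r_nonneg[of "max 0 (- s)"] by auto
      show ?thesis
      proof (cases "b k = 0")
        case True
        have "?r \<in> Sp {a. a k = 0}" by (rule Sp_mono[OF J.r_nonneg_Y]) (auto simp: True)
        then show ?thesis using pr_id[OF sat_eq[OF dk]] by simp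
      next
        case False
        have "pr {a. a k = 0} ?r = 1" unfolding w(2)
        proof (rule pr_eqI[OF sat_eq[OF dk]])
          show "1 \<in> Sp {a. a k = 0}" by (rule Sp_1) simp
          have "w \<in> Sp (- {a. a k = 0})" by (rule Sp_mono[OF w(1)]) (use False in auto)
          then show "1 + w - 1 \<in> Sp (- {a. a k = 0})" by simp
        qed
        then show ?thesis by simp
      qed
    qed
    ultimately have "z \<in> Sp {a. a k \<ge> 0}"
      by (intro Sp_cancel_low[OF dk z(1) J_r_nonneg, of "max 0 (- s)" 0]) auto
    then have "z \<in> Sp ({a. a k \<ge> 0} \<inter> {a. a j = s})" by (rule Sp_Int[OF _ z(1) sat_eq[OF dj]])
    then have "z * ?r \<in> T2"
    proof (induction rule: Sp_induct)
      case (gen q a)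
      then have "Q q * M a * ?r = Q q * N a" by (simp add: N_def mult.assoc)
      then show ?case using N_T2[of a] gen by simp
    next
      case (diff v w) then show ?case by (simp add: left_diff_distrib F2.Sp_diff)
    qed simp
    then show ?thesis by (simp add: z(2))
  qed
  then have sum: "(\<Sum>s\<in>I. pr {a. a j = s} y) \<in> T2" for I by (rule F2.Sp_sum)
  obtain I where "y = (\<Sum>s\<in>I. pr {a. a j = s} y)"
    using Sp_decompose[OF dj y(1)] by blast
  then show ?thesis using sum[of I] by simp
qed

text \<open>Induction on how negative the \<open>x_k\<close>-degree may be: the lowest component
  lifts to an element of all four tori with the same lower bound, and subtracting it raises the
  bound.\<close>

theorem three_tori:
  assumes "y \<in> T" "y \<in> TJ" "y \<in> TK" shows "y \<in> T2"
proof -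
  have "y \<in> T2" if "y \<in> T" "y \<in> TJ" "y \<in> TK" "y \<in> Sp {a. a k \<ge> - int t}" for y t
    using that
  proof (induction t arbitrary: y)
    case 0 then show ?case using nonneg_T2 by simp
  next
    case (Suc t)
    let ?t = "Suc t"
    obtain h where h: "h \<in> Sp {a. a k = - int ?t}" "pr {a. a k = - int ?t} y = h * K.r (int ?t)"
      using K.inter_component[OF Suc.prems(1,3)] by blast
    have "\<exists>w. good (int ?t) w \<and> pr {a. a k = - int ?t} w = h * K.r (int ?t)"
    proof (cases "b k = 0")
      case True
      have "pr {a. a k = - int ?t} (h * K.r (int ?t)) = h * K.r (int ?t)"
        unfolding h(2)[symmetric] using pr_mem'(1)[OF sat_eq[OF dk] Suc.prems(1)]
        by (intro pr_id[OF sat_eq[OF dk]]) auto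
      then show ?thesis using lift_disjoint[OF True Suc.prems(1,2) h] by blast
    next
      case False then show ?thesis using lift_generic[OF _ h(1)] b_k by simp
    qed
    then obtain w where w: "good (int ?t) w" "pr {a. a k = - int ?t} w = h * K.r (int ?t)" by blast
    then have wT: "w \<in> T" "w \<in> TJ" "w \<in> TK" "w \<in> T2" "w \<in> Sp {a. a k \<ge> - int ?t}"
      using Sp_UNIV unfolding good_def by blast+
    have "pr {a. a k = - int ?t} (y - w) = 0"
      using h(2) w(2) by (simp add: pr_diff[OF sat_eq[OF dk] Suc.prems(1) wT(1)])
    then have "y - w \<in> Sp {a. a k \<ge> - int ?t + 1}"
      by (rule Sp_raise[OF dk Sp_diff[OF Suc.prems(4) wT(5)]])
    then have "y - w \<in> T2"
      using Suc.prems wT by (intro Suc.IH) (simp_all add: Sp_diff FJ.Sp_diff FK.Sp_diff)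
    then show ?case using F2.Sp_add[OF _ wT(4)] by fastforce
  qed
  note main = this
  obtain r t where "y \<in> Sp {a. r \<le> a k \<and> a k < r + int t}" using Sp_bounds[OF dk assms(1)] by blast
  then have "y \<in> Sp {a. a k \<ge> - int (nat (- r))}" by (rule Sp_mono) auto
  then show ?thesis by (rule main[OF assms])
qed

end

section \<open>Quantum seeds as toric frames\<close>

lemma (in frame) L_sum:
  "L e (\<lambda>i. if i \<in> {1..r} then a i else 0) = (\<Sum>l=1..r. a l * L e (unit_vector l))"
proof (induction r)
  case 0
  have "(\<lambda>i. if i \<in> {1..0} then a i else 0) = 0" by auto
  then show ?case by simp
next
  case (Suc r)
  have "(\<lambda>i. if i \<in> {1..Suc r} then a i else 0) =
      (\<lambda>i. if i \<in> {1..r} then a i else 0) + (\<lambda>i. a (Suc r) * unit_vector (Suc r) i)"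
    by (auto simp: fun_eq_iff unit_vector_def)
  then show ?case by (simp only: L_add_right Suc L_scale_right) simp
qed

lemma (in frame) L_expand:
  "L a c = (\<Sum>i=1..m. \<Sum>j=1..m. a i * c j * L (unit_vector i) (unit_vector j))"
proof -
  have e: "L e c = (\<Sum>j=1..m. c j * L e (unit_vector j))" for e c
    using L_sum[of e m c] L_cong_right[of c "\<lambda>i. if i \<in> {1..m} then c i else 0" e]
    by (simp add: agree_def)
  have "L a c = - (\<Sum>i=1..m. a i * L c (unit_vector i))" using e[of c a] L_skew[of a c] by simp
  also have "\<dots> = (\<Sum>i=1..m. a i * L (unit_vector i) c)"
    by (simp only: sum_negf[symmetric] L_skew[of c] minus_mult_right[symmetric] minus_minus)
  finally show ?thesis by (simp add: e[of _ c] sum_distrib_left mult.assoc)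
qed

lemma bilinear_form_unit:
  assumes "i \<in> {1..m}" "j \<in> {1..m}"
  shows "bilinear_form m A (unit_vector i) (unit_vector j) = A i j"
proof -
  have "bilinear_form m A (unit_vector i) (unit_vector j) =
      (\<Sum>k=1..m. if k = i then (\<Sum>l=1..m. if l = j then A k l else 0) else 0)"
    unfolding bilinear_form_def unit_vector_def
    by (intro sum.cong) (auto simp: if_distrib[of "\<lambda>x. x * _"] cong: if_cong)
  then show ?thesis using assms by simp
qed

lemma bilinear_form_add: "bilinear_form m A (a + c) e = bilinear_form m A a e + bilinear_form m A c e"
  by (simp add: bilinear_form_def distrib_right sum.distrib)

lemma bilinear_form_cong: "agree m a c \<Longrightarrow> bilinear_form m A a e = bilinear_form m A c e"
  unfolding bilinear_form_def by (intro sum.cong) (auto simp: agree_def)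

lemma bilinear_form_skew:
  assumes "skew_symmetric m A" shows "bilinear_form m A a c = - bilinear_form m A c a"
proof -
  have "bilinear_form m A a c = (\<Sum>j=1..m. \<Sum>i=1..m. a i * c j * A i j)"
    unfolding bilinear_form_def by (rule sum.swap)
  also have "\<dots> = - bilinear_form m A c a"
    unfolding bilinear_form_def sum_negf[symmetric]
  proof (intro sum.cong refl)
    fix i j assume "i \<in> {1..m}" "j \<in> {1..m}"
    then have "A j i = - A i j" using assms unfolding skew_symmetric_def by blast
    then show "a j * c i * A j i = - (c i * a j * A i j)" by simp
  qed
  finally show ?thesis .
qed

lemma bilinear_form_expand:
  "bilinear_form m A e a = (\<Sum>i=1..m. a i * bilinear_form m A e (unit_vector i))"
proof -
  have "bilinear_form m A e (unit_vector i) = (\<Sum>k=1..m. e k * A k i)" if "i \<in> {1..m}" for i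
  proof -
    have "bilinear_form m A e (unit_vector i) = (\<Sum>k=1..m. \<Sum>l=1..m. if l = i then e k * A k l else 0)"
      unfolding bilinear_form_def unit_vector_def by (intro sum.cong) auto
    then show ?thesis using that by simp
  qed
  then have "(\<Sum>i=1..m. a i * bilinear_form m A e (unit_vector i)) =
      (\<Sum>i=1..m. \<Sum>k=1..m. e k * a i * A k i)"
    by (intro sum.cong) (auto simp: sum_distrib_left algebra_simps)
  also have "\<dots> = bilinear_form m A e a" unfolding bilinear_form_def by (rule sum.swap)
  finally show ?thesis by simp
qed

lemma seed_monomial_cong: "agree (2*n) a c \<Longrightarrow> seed_monomial n qh S a = seed_monomial n qh S c"
proof -
  assume a: "agree (2*n) a c"
  have "map (\<lambda>i. cluster S i powi a i) [1..<Suc (2*n)] = map (\<lambda>i. cluster S i powi c i) [1..<Suc (2*n)]"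
    using a by (auto simp: agree_def)
  moreover have "(\<Sum>k=1..2*n. \<Sum>l=1..<k. a k * a l * qform S k l) = (\<Sum>k=1..2*n. \<Sum>l=1..<k. c k * c l * qform S k l)"
    using a by (intro sum.cong) (auto simp: agree_def)
  ultimately show ?thesis by (simp only: seed_monomial_def)
qed

text \<open>A frame is determined by its form and its values on unit vectors. Extending the
  truncated exponent \<open>?a r\<close> by one coordinate produces exactly the next powers of
  \<open>qh\<close> in the normalization.\<close>

lemma seed_monomial_eq:
  assumes "frame qh (2*n) N L"
    and cl: "\<And>i. i \<in> {1..2*n} \<Longrightarrow> cluster S i = N (unit_vector i)"
    and qf: "\<And>i j. i \<in> {1..2*n} \<Longrightarrow> j \<in> {1..2*n} \<Longrightarrow> qform S i j = L (unit_vector i) (unit_vector j)"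
  shows "seed_monomial n qh S = N"
proof
  fix a :: "nat \<Rightarrow> int"
  interpret frame qh "2*n" N L by fact
  let ?a = "\<lambda>r i. if i \<in> {1..r} then a i else 0"
  have "N (?a r) = Q (\<Sum>k=1..r. \<Sum>l=1..<k. a k * a l * qform S k l) *
      prod_list (map (\<lambda>i. cluster S i powi a i) [1..<Suc r])" if "r \<le> 2*n" for r
    using that
  proof (induction r)
    case 0
    have "?a 0 = 0" by auto
    then show ?case by (simp add: M_0)
  next
    case (Suc r)
    let ?e = "\<lambda>i. a (Suc r) * unit_vector (Suc r) i"
    have s: "?a (Suc r) = ?a r + ?e" by (auto simp: fun_eq_iff unit_vector_def)
    have "L ?e (?a r) = (\<Sum>l=1..r. a (Suc r) * a l * L (unit_vector (Suc r)) (unit_vector l))"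
      by (simp only: L_scale_left L_sum sum_distrib_left mult.assoc)
    also have "\<dots> = (\<Sum>l=1..<Suc r. a (Suc r) * a l * qform S (Suc r) l)"
      using Suc.prems by (intro sum.cong) (auto simp: qf)
    finally have L: "L ?e (?a r) = (\<Sum>l=1..<Suc r. a (Suc r) * a l * qform S (Suc r) l)" .
    have "N (?a (Suc r)) = Q (L ?e (?a r)) * (N (?a r) * N ?e)"
      unfolding s using L_skew[of "?a r" ?e] by (simp add: M_mult)
    also have "N ?e = cluster S (Suc r) powi a (Suc r)" using cl[of "Suc r"] Suc.prems by (simp add: M_powi)
    finally show ?case using Suc unfolding L
      by (simp add: mult.assoc add.commute)
  qed
  from this[of "2*n"] have "N (?a (2*n)) = seed_monomial n qh S a" by (simp add: seed_monomial_def)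
  moreover have "N (?a (2*n)) = N a" by (rule M_cong) (simp add: agree_def)
  ultimately show "seed_monomial n qh S a = N a" by simp
qed

lemma seed_monomial_unit: assumes "i \<in> {1..2*n}"
  shows "seed_monomial n qh S (unit_vector i) = cluster S i"
proof -
  have "(\<Sum>k=1..2*n. \<Sum>l=1..<k. unit_vector i k * unit_vector i l * qform S k l) = 0"
    by (intro sum.neutral ballI) (auto simp: unit_vector_def)
  moreover have "prod_list (map (\<lambda>l. cluster S l powi unit_vector i l) xs) = (if i \<in> set xs then cluster S i else 1)"
    if "distinct xs" for xs
    using that by (induction xs) (auto simp: unit_vector_def)
  from this[of "[1..<Suc (2*n)]"]
  have "prod_list (map (\<lambda>l. cluster S l powi unit_vector i l) [1..<Suc (2*n)]) = cluster S i"
    using assms by (auto simp del: upt_Suc)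
  ultimately show ?thesis unfolding seed_monomial_def by simp
qed

context mutation begin

lemma phi_minus_b: "mut_exp k (- b) a = \<phi> a + (\<lambda>i. a k * b i)"
proof
  fix i
  have "mut_vec k (- b) i = u i + b i" by (simp add: mut_vec_def)
  then show "mut_exp k (- b) a i = (\<phi> a + (\<lambda>i. a k * b i)) i" by (simp add: mut_exp_def distrib_left)
qed

lemma form_minus_b: "L (mut_exp k (- b) a) (mut_exp k (- b) c) = L' a c"
  unfolding phi_minus_b L_add_left L_add_right L_scale_left L_scale_right
  using L_skew[of "\<phi> a" b] by (simp add: L_b)

lemma mutation_minus: "mutation qh m M L k (- b) (- \<delta>)"
  by unfold_locales (use k \<delta>_nz in \<open>simp_all add: L_minus_left L_b\<close>)

end

section \<open>Mutation of seeds as mutation of frames\<close>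

locale seed_setting = central_unit qh for qh :: "'f::division_ring" +
  fixes n :: nat and d :: "nat \<Rightarrow> int"
  assumes d_pos: "j \<in> {1..n} \<Longrightarrow> d j > 0"
begin

abbreviation mono :: "'f quantum_seed \<Rightarrow> (nat \<Rightarrow> int) \<Rightarrow> 'f" where
  "mono S \<equiv> seed_monomial n qh S"
abbreviation form :: "'f quantum_seed \<Rightarrow> (nat \<Rightarrow> int) \<Rightarrow> (nat \<Rightarrow> int) \<Rightarrow> int" where
  "form S \<equiv> bilinear_form (2*n) (qform S)"
abbreviation col :: "'f quantum_seed \<Rightarrow> nat \<Rightarrow> nat \<Rightarrow> int" where
  "col S j \<equiv> \<lambda>i. exch S i j"
abbreviation mu where "mu \<equiv> mutate n qh"

definition good_seed :: "'f quantum_seed \<Rightarrow> bool" where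
  "good_seed S \<longleftrightarrow> frame qh (2*n) (mono S) (form S) \<and>
     (\<forall>j\<in>{1..n}. \<forall>a. form S (col S j) a = d j * a j)"

lemma good_frame: "good_seed S \<Longrightarrow> frame qh (2*n) (mono S) (form S)"
  by (simp add: good_seed_def)

lemma good_mutation: "good_seed S \<Longrightarrow> k \<in> {1..n} \<Longrightarrow> mutation qh (2*n) (mono S) (form S) k (col S k) (d k)"
  using d_pos[of k] unfolding good_seed_def mutation_def mutation_axioms_def by auto

text \<open>Pairing columns \<open>k\<close> and \<open>j\<close> in both orders, compatibility and
  skew-symmetry of the form give opposite values of \<open>d k * exch S k j\<close> and
  \<open>d j * exch S j k\<close>.\<close>

lemma exch_sign:
  assumes "good_seed S" "j \<in> {1..n}" "k \<in> {1..n}"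
  shows "exch S j k \<ge> 0 \<longleftrightarrow> exch S k j \<le> 0" "exch S j k \<le> 0 \<longleftrightarrow> exch S k j \<ge> 0"
proof -
  interpret frame qh "2*n" "mono S" "form S" using good_frame[OF assms(1)] .
  have "form S (col S k) (col S j) = d k * exch S k j" "form S (col S j) (col S k) = d j * exch S j k"
    using assms unfolding good_seed_def by auto
  then have e: "d k * exch S k j = - (d j * exch S j k)" using L_skew[of "col S k" "col S j"] by simp
  have "d j * exch S j k \<ge> 0 \<longleftrightarrow> exch S j k \<ge> 0" "d j * exch S j k \<le> 0 \<longleftrightarrow> exch S j k \<le> 0"
    "d k * exch S k j \<ge> 0 \<longleftrightarrow> exch S k j \<ge> 0" "d k * exch S k j \<le> 0 \<longleftrightarrow> exch S k j \<le> 0"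
    using d_pos[OF assms(2)] d_pos[OF assms(3)] by (auto simp: zero_le_mult_iff mult_le_0_iff)
  then show "exch S j k \<ge> 0 \<longleftrightarrow> exch S k j \<le> 0" "exch S j k \<le> 0 \<longleftrightarrow> exch S k j \<ge> 0"
    using e by linarith+
qed

lemma col_mutate_same: "col (mu k S) k = - col S k"
  by (auto simp: mutate_def mutated_exch_def)

text \<open>Matrix mutation of a column is the tropical exponent map, with the sign of column
  \<open>k\<close> chosen according to \<open>exch S k j\<close>. This matches the columns of
  mutated seeds with the exponents of the rank two argument.\<close>

lemma col_mutate:
  assumes "k \<noteq> j" "exch S k k = 0"
  shows "exch S k j \<ge> 0 \<Longrightarrow> col (mu k S) j = mut_exp k (- col S k) (col S j)"
    and "exch S k j \<le> 0 \<Longrightarrow> col (mu k S) j = mut_exp k (col S k) (col S j)"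
proof -
  have e: "(\<bar>x\<bar> * y + x * \<bar>y\<bar>) div 2 = y * max x 0" if "y \<ge> 0" for x y :: int
    using that by (cases "x \<ge> 0") (auto simp: algebra_simps max_def)
  have e': "(\<bar>x\<bar> * y + x * \<bar>y\<bar>) div 2 = y * max (- x) 0" if "y \<le> 0" for x y :: int
  proof (cases "x \<ge> 0")
    case True then show ?thesis using that by (auto simp: algebra_simps max_def)
  next
    case False
    then have "\<bar>x\<bar> * y + x * \<bar>y\<bar> = 2 * (y * (- x))" using that by (simp add: algebra_simps)
    then have "(\<bar>x\<bar> * y + x * \<bar>y\<bar>) div 2 = y * (- x)"
      using nonzero_mult_div_cancel_left[of 2 "y * (- x)"] by (simp only:)
    then show ?thesis using False by (simp add: max_def)
  qed
  have s: "col (mu k S) j i = (if i = k then - exch S k j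
      else exch S i j + (\<bar>exch S i k\<bar> * exch S k j + exch S i k * \<bar>exch S k j\<bar>) div 2)" for i
    using assms(1) by (simp add: mutate_def mutated_exch_def)
  show "col (mu k S) j = mut_exp k (- col S k) (col S j)" if "exch S k j \<ge> 0"
    by (rule ext) (simp only: s e[OF that], simp add: mut_exp_def mut_vec_def unit_vector_def assms(2))
  show "col (mu k S) j = mut_exp k (col S k) (col S j)" if "exch S k j \<le> 0"
    by (rule ext) (simp only: s e'[OF that], simp add: mut_exp_def mut_vec_def unit_vector_def assms(2))
qed

lemma mono_mutate:
  assumes S: "good_seed S" and k: "k \<in> {1..n}"
  shows "mono (mu k S) = mut_frame (mono S) k (col S k)"
    and "form (mu k S) a c = form S (mut_exp k (col S k) a) (mut_exp k (col S k) c)"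
proof -
  interpret P: mutation qh "2*n" "mono S" "form S" k "col S k" "d k" by (rule good_mutation[OF assms])
  \<comment> \<open>Mutation of the form uses the positive parts of the column, which is
    \<open>mut_vec\<close> for the negated column. The opposite sign is recovered at the end by
    \<open>frame_minus\<close> and \<open>form_minus_b\<close>.\<close>
  interpret N: mutation qh "2*n" "mono S" "form S" k "- col S k" "- d k" by (rule P.mutation_minus)
  interpret F: frame qh "2*n" N.M' N.L' by (rule N.frame_mutation)
  have fix_unit: "N.\<phi> (unit_vector i) = (if i = k then N.u else unit_vector i)" for i
  proof (cases "i = k")
    case True then show ?thesis using N.phi_u N.phi_phi by metis
  next
    case False then show ?thesis by (simp add: N.phi_fix unit_vector_def)
  qed
  have row: "mutated_form_row n k (exch S) (qform S) j = form S N.u (unit_vector j)" if j: "j \<in> {1..2*n}" for j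
  proof -
    have u: "N.u = - unit_vector k + (\<lambda>i. max (exch S i k) 0)" by (auto simp: mut_vec_def)
    have "form S (unit_vector j) (\<lambda>i. max (exch S i k) 0) = (\<Sum>t=1..2*n. max (exch S t k) 0 * qform S j t)"
      using j by (subst bilinear_form_expand) (simp add: bilinear_form_unit)
    then have "form S (\<lambda>i. max (exch S i k) 0) (unit_vector j) = - (\<Sum>t=1..2*n. max (exch S t k) 0 * qform S j t)"
      using P.L_skew by metis
    also have "\<dots> = (\<Sum>t=1..2*n. max (exch S t k) 0 * qform S t j)"
    proof -
      have "qform S j t = - qform S t j" if "t \<in> {1..2*n}" for t
        using P.L_skew[of "unit_vector j" "unit_vector t"] j that by (simp add: bilinear_form_unit)
      then show ?thesis by (simp add: sum_negf[symmetric])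
    qed
    finally show ?thesis using j P.k unfolding u P.L_add_left P.L_minus_left mutated_form_row_def
      by (simp add: bilinear_form_unit)
  qed
  have qf: "qform (mu k S) i j = N.L' (unit_vector i) (unit_vector j)" if "i \<in> {1..2*n}" "j \<in> {1..2*n}" for i j
    using that row[of i] row[of j] P.L_skew[of "unit_vector i" N.u]
    by (auto simp: mutate_def mutated_form_def fix_unit bilinear_form_unit)
  have "mono (mu k S) = N.M'"
  proof (rule seed_monomial_eq[OF N.frame_mutation _ qf])
    fix i assume i: "i \<in> {1..2*n}"
    show "cluster (mu k S) i = N.M' (unit_vector i)"
    proof (cases "i = k")
      case True
      have "N.M' (unit_vector k) = mut_var (mono S) k (- col S k)" by (rule N.M'_var)
      then show ?thesis using True by (simp add: mutate_def mutated_var_def mut_var_def add.commute)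
    next
      case False
      then have "N.M' (unit_vector i) = mono S (unit_vector i)" by (simp add: N.M'_fix unit_vector_def)
      then show ?thesis using False i by (simp add: seed_monomial_unit mutate_def)
    qed
  qed
  then show "mono (mu k S) = mut_frame (mono S) k (col S k)" by (simp add: P.frame_minus)
  have "form (mu k S) a c = (\<Sum>i=1..2*n. \<Sum>j=1..2*n. a i * c j * N.L' (unit_vector i) (unit_vector j))"
    unfolding bilinear_form_def[of "2*n" "qform (mu k S)"] by (intro sum.cong refl) (simp add: qf)
  also have "\<dots> = N.L' a c" by (rule F.L_expand[symmetric])
  finally show "form (mu k S) a c = form S (mut_exp k (col S k) a) (mut_exp k (col S k) c)"
    by (simp add: P.form_minus_b)
qed

text \<open>For \<open>j \<noteq> k\<close>, the sign of column \<open>k\<close> that turns column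
  \<open>j\<close> into its mutation also makes the \<open>j\<close>-th entry of
  \<open>mut_vec\<close> vanish. The tropical map then fixes \<open>j\<close>-th coordinates, and
  compatibility of column \<open>j\<close> is inherited.\<close>

lemma good_mutate:
  assumes S: "good_seed S" and k: "k \<in> {1..n}" shows "good_seed (mu k S)"
proof -
  interpret P: mutation qh "2*n" "mono S" "form S" k "col S k" "d k" by (rule good_mutation[OF assms])
  interpret N: mutation qh "2*n" "mono S" "form S" k "- col S k" "- d k" by (rule P.mutation_minus)
  have form: "form (mu k S) = P.L'" by (intro ext) (simp add: mono_mutate[OF assms])
  have mono: "mono (mu k S) = P.M'" by (rule mono_mutate[OF assms])
  have "P.L' (col (mu k S) j) a = d j * a j" if j: "j \<in> {1..n}" for j a
  proof -
    have c: "form S (col S j) a = d j * a j" for a using S j by (simp add: good_seed_def)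
    consider "j = k" | "j \<noteq> k" "exch S k j \<ge> 0" | "j \<noteq> k" "exch S k j \<le> 0" by linarith
    then show ?thesis
    proof cases
      case 1
      then show ?thesis by (simp add: col_mutate_same P.phi_minus P.phi_fix P.L_minus_left P.L_b)
    next
      case 2
      have "exch S j k \<le> 0" using exch_sign[OF S j k] 2 by simp
      then have "N.u j = 0" using 2 by (simp add: mut_vec_def unit_vector_def)
      then have "N.\<phi> a j = a j" using 2 by (simp add: mut_exp_def)
      then show ?thesis using 2 by (simp add: P.form_minus_b[symmetric] col_mutate(1)[OF _ P.b_k] c)
    next
      case 3
      have "exch S j k \<ge> 0" using exch_sign[OF S j k] 3 by simp
      then have "P.u j = 0" using 3 by (simp add: mut_vec_def unit_vector_def)
      then have "P.\<phi> a j = a j" using 3 by (simp add: mut_exp_def)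
      then show ?thesis using 3 by (simp add: col_mutate(2)[OF _ P.b_k] c)
    qed
  qed
  then show ?thesis unfolding good_seed_def mono form using P.frame_mutation by simp
qed

section \<open>Invariance of the upper bound\<close>

abbreviation torus :: "((nat \<Rightarrow> int) \<Rightarrow> 'f) \<Rightarrow> 'f set" where "torus M \<equiv> monomial_span qh M UNIV"

definition upper_bound :: "'f quantum_seed \<Rightarrow> 'f set" where
  "upper_bound S = torus (mono S) \<inter> (\<Inter>k\<in>{1..n}. torus (mono (mu k S)))"

text \<open>The rank two theorem is applied at the seed \<open>mu j S\<close>. Mutation at
  \<open>j\<close> leads back to \<open>S\<close>, so mutation at \<open>j\<close> and then at
  \<open>k\<close> leads to \<open>mu k S\<close>, the torus to be reached.\<close>

lemma upper_bound_mutate: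
  assumes S: "good_seed S" and j: "j \<in> {1..n}"
  shows "upper_bound (mu j S) \<subseteq> upper_bound S"
proof
  fix y assume y: "y \<in> upper_bound (mu j S)"
  let ?S = "mu j S"
  have S': "good_seed ?S" by (rule good_mutate[OF assms])
  interpret A: mutation qh "2*n" "mono S" "form S" j "col S j" "d j" by (rule good_mutation[OF assms])
  have M': "mono ?S = A.M'" by (rule mono_mutate[OF assms])
  have F': "form ?S = A.L'" by (intro ext) (simp add: mono_mutate[OF assms])
  interpret B: mutation qh "2*n" "mono ?S" "form ?S" j "col S j" "- d j"
    unfolding M' F' by (rule A.mutation_back)
  interpret B': mutation qh "2*n" "mono ?S" "form ?S" j "- col S j" "- (- d j)" by (rule B.mutation_minus)
  have bk: "B.M' = mono S" unfolding M' by (rule A.frame_back)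
  have bk': "B'.M' = mono S" using B.frame_minus bk by simp
  have mm: "mono (mu j ?S) = mono S" using mono_mutate(1)[OF S' j] bk' by (simp add: col_mutate_same)
  have y0: "y \<in> torus (mono ?S)" and y1: "y \<in> torus (mono S)"
    and yk: "\<And>k. k \<in> {1..n} \<Longrightarrow> y \<in> torus (mono (mu k ?S))"
    using y mm j unfolding upper_bound_def by (blast, metis (no_types, lifting) IntD2 INT_D, blast)
  have "y \<in> torus (mono (mu k S))" if k: "k \<in> {1..n}" for k
  proof (cases "k = j")
    case True then show ?thesis using y0 by simp
  next
    case False
    interpret K: mutation qh "2*n" "mono S" "form S" k "col S k" "d k" by (rule good_mutation[OF S k])
    interpret C: mutation qh "2*n" "mono ?S" "form ?S" k "col ?S k" "d k" by (rule good_mutation[OF S' k])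
    interpret C': mutation qh "2*n" "mono ?S" "form ?S" k "- col ?S k" "- d k" by (rule C.mutation_minus)
    have C: "C.M' = mono (mu k ?S)" by (rule mono_mutate(1)[OF S' k, symmetric])
    have cj: "col ?S k j = - exch S j k" using False by (simp add: mutate_def mutated_exch_def)
    \<comment> \<open>Both columns are negated together when necessary, so that their entries at the
      other index are nonnegative, as \<open>mutation_pair\<close> demands.\<close>
    show ?thesis
    proof (cases "exch S j k \<ge> 0")
      case True
      have "- col S j k \<ge> 0" using exch_sign[OF S j k] True by simp
      then interpret P: mutation_pair qh "2*n" "mono ?S" "form ?S" j "- col S j" "- (- d j)" k "- col ?S k" "- d k"
        by unfold_locales (use False True cj in auto)
      have e: "col ?S k = mut_exp j (- col S j) (col S k)" using False True A.b_k by (intro col_mutate) auto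
      have "B'.\<phi> (- col ?S k) = - col S k" unfolding B'.phi_minus e B'.phi_phi ..
      then have "P.M2 = mono (mu k S)"
        using K.frame_minus mono_mutate(1)[OF S k] by (simp only: bk')
      moreover have "y \<in> P.T2"
        by (rule P.three_tori[OF y0]) (use y1 yk[OF k] C.frame_minus C in \<open>simp_all only: bk'\<close>)
      ultimately show ?thesis by simp
    next
      case neg: False
      have "col S j k \<ge> 0" using exch_sign[OF S j k] neg by simp
      then interpret P: mutation_pair qh "2*n" "mono ?S" "form ?S" j "col S j" "- d j" k "col ?S k" "d k"
        by unfold_locales (use False neg cj in auto)
      have e: "col ?S k = mut_exp j (col S j) (col S k)" using False neg A.b_k by (intro col_mutate) auto
      have "B.\<phi> (col ?S k) = col S k" unfolding e by (rule B.phi_phi)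
      then have "P.M2 = mono (mu k S)"
        using mono_mutate(1)[OF S k] by (simp only: bk)
      moreover have "y \<in> P.T2"
        by (rule P.three_tori[OF y0]) (use y1 yk[OF k] C in \<open>simp_all only: bk\<close>)
      ultimately show ?thesis by simp
    qed
  qed
  then show "y \<in> upper_bound S" using y1 unfolding upper_bound_def by simp
qed

lemma good_fold: "good_seed S \<Longrightarrow> set ks \<subseteq> {1..n} \<Longrightarrow> good_seed (fold mu ks S)"
  by (induction ks arbitrary: S) (simp_all add: good_mutate)

lemma upper_bound_fold:
  "good_seed S \<Longrightarrow> set ks \<subseteq> {1..n} \<Longrightarrow> upper_bound (fold mu ks S) \<subseteq> upper_bound S"
proof (induction ks arbitrary: S)
  case (Cons k ks)
  then have "upper_bound (fold mu ks (mu k S)) \<subseteq> upper_bound (mu k S)" by (intro Cons.IH good_mutate) auto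
  also have "\<dots> \<subseteq> upper_bound S" using Cons.prems by (intro upper_bound_mutate) auto
  finally show ?case by simp
qed simp

lemma mono_nonneg_torus:
  assumes "good_seed S" "k \<in> {1..n}" "a k \<ge> 0" shows "mono S a \<in> torus (mono (mu k S))"
proof -
  interpret P: mutation qh "2*n" "mono S" "form S" k "col S k" "d k" by (rule good_mutation[OF assms(1,2)])
  show ?thesis unfolding mono_mutate(1)[OF assms(1,2)] using assms(3) by (intro P.nonneg_Sp' P.Sp_M) simp
qed

lemma cluster_upper_bound:
  assumes S: "good_seed S" and i: "i \<in> {1..2*n}" shows "cluster S i \<in> upper_bound S"
proof -
  interpret frame qh "2*n" "mono S" "form S" using good_frame[OF S] .
  have "mono S (unit_vector i) \<in> torus (mono S)" by (rule Sp_M) simp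
  moreover have "mono S (unit_vector i) \<in> torus (mono (mu k S))" if "k \<in> {1..n}" for k
    by (rule mono_nonneg_torus[OF S that]) (simp add: unit_vector_def)
  ultimately show ?thesis using i by (simp add: upper_bound_def seed_monomial_unit)
qed

lemma torus_ring:
  assumes "good_seed S"
  shows "1 \<in> torus (mono S)" "y \<in> torus (mono S) \<Longrightarrow> z \<in> torus (mono S) \<Longrightarrow> y - z \<in> torus (mono S)"
    "y \<in> torus (mono S) \<Longrightarrow> z \<in> torus (mono S) \<Longrightarrow> y * z \<in> torus (mono S)"
proof -
  interpret frame qh "2*n" "mono S" "form S" using good_frame[OF assms] .
  show "1 \<in> torus (mono S)" by (rule Sp_1) simp
  show "y - z \<in> torus (mono S)" if "y \<in> torus (mono S)" "z \<in> torus (mono S)" using that by (rule Sp_diff)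
  show "y * z \<in> torus (mono S)" if "y \<in> torus (mono S)" "z \<in> torus (mono S)" using that by (rule Sp_mult) simp
qed

lemma upper_bound_ring:
  assumes "good_seed S"
  shows "1 \<in> upper_bound S" "y \<in> upper_bound S \<Longrightarrow> z \<in> upper_bound S \<Longrightarrow> y - z \<in> upper_bound S"
    "y \<in> upper_bound S \<Longrightarrow> z \<in> upper_bound S \<Longrightarrow> y * z \<in> upper_bound S"
  using torus_ring[OF assms] torus_ring[OF good_mutate[OF assms]] unfolding upper_bound_def by auto

lemma subring_upper_bound:
  assumes "good_seed S" "G \<subseteq> upper_bound S" shows "subring_generated G \<subseteq> upper_bound S"
proof
  fix y assume "y \<in> subring_generated G"
  then show "y \<in> upper_bound S"
    by induction (use assms upper_bound_ring in auto)
qed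

end

section \<open>Projective cluster variables\<close>

lemma span_family:
  fixes R :: "'f::ring_1 set"
  assumes "0 \<in> R" "\<And>u v. u \<in> R \<Longrightarrow> v \<in> R \<Longrightarrow> u - v \<in> R"
    and "y \<in> additive_span {r * D g | r g. r \<in> R \<and> g \<in> B}"
  shows "\<exists>J F. finite J \<and> J \<subseteq> B \<and> (\<forall>g. F g \<in> R) \<and> (\<forall>g. g \<notin> J \<longrightarrow> F g = 0) \<and> y = (\<Sum>g\<in>J. F g * D g)"
  using assms(3)
proof induction
  case (gen x)
  then obtain r g where "x = r * D g" "r \<in> R" "g \<in> B" by auto
  then show ?case by (intro exI[of _ "{g}"] exI[of _ "\<lambda>h. if h = g then r else 0"]) (auto simp: assms(1))
next
  case zero show ?case by (intro exI[of _ "{}"] exI[of _ "\<lambda>_. 0"]) (auto simp: assms(1))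
next
  case (diff u v)
  then obtain I F J G where *: "finite I" "I \<subseteq> B" "\<forall>g. F g \<in> R" "\<forall>g. g \<notin> I \<longrightarrow> F g = 0" "u = (\<Sum>g\<in>I. F g * D g)"
    "finite J" "J \<subseteq> B" "\<forall>g. G g \<in> R" "\<forall>g. g \<notin> J \<longrightarrow> G g = 0" "v = (\<Sum>g\<in>J. G g * D g)" by auto
  have u: "u = (\<Sum>g\<in>I \<union> J. F g * D g)" unfolding *(5) using * by (intro sum.mono_neutral_left) auto
  have v: "v = (\<Sum>g\<in>I \<union> J. G g * D g)" unfolding *(10) using * by (intro sum.mono_neutral_left) auto
  show ?case using * assms(2)
    by (intro exI[of _ "I \<union> J"] exI[of _ "\<lambda>g. F g - G g"]) (auto simp: u v sum_subtractf left_diff_distrib)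
qed

context frame begin

lemma span_Q:
  assumes "y \<in> additive_span {r * D g | r g. r \<in> Sp A \<and> g \<in> B}"
  shows "Q s * y \<in> additive_span {r * D g | r g. r \<in> Sp A \<and> g \<in> B}"
  using assms
proof induction
  case (gen x)
  then obtain r g where "x = r * D g" "r \<in> Sp A" "g \<in> B" by auto
  then have "Q s * x = (Q s * r) * D g" "Q s * r \<in> Sp A" by (simp_all add: mult.assoc)
  then have "Q s * x \<in> {r * D g | r g. r \<in> Sp A \<and> g \<in> B}" using \<open>g \<in> B\<close> by blast
  then show ?case by (rule additive_span.gen)
qed (auto simp: algebra_simps intro: additive_span.intros)

lemma Sp_diffD: "y - x \<in> Sp A \<Longrightarrow> x \<in> Sp A \<Longrightarrow> y \<in> Sp A"
  using Sp_add[of "y - x" A x] by simp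

lemma Sp_prod_list:
  assumes "0 \<in> H" "\<And>a c. a \<in> H \<Longrightarrow> c \<in> H \<Longrightarrow> a + c \<in> H" "\<And>i. i \<in> set xs \<Longrightarrow> f i \<in> Sp H"
  shows "prod_list (map f xs) \<in> Sp H"
  using assms(3)
proof (induction xs)
  case (Cons a xs)
  then show ?case using Sp_mult[of "f a" H "prod_list (map f xs)" H H] assms(2) by simp
qed (simp add: Sp_1 assms(1))

lemma Sp_power:
  assumes "0 \<in> H" "\<And>a c. a \<in> H \<Longrightarrow> c \<in> H \<Longrightarrow> a + c \<in> H" "y \<in> Sp H"
  shows "y ^ t \<in> Sp H"
proof (induction t)
  case (Suc t) then show ?case using Sp_mult[of y H "y ^ t" H H] assms by simp
qed (simp add: Sp_1 assms(1))

end

locale acyclic_seed = seed_setting +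
  fixes S :: "'a quantum_seed"
  assumes S: "good_seed S"
    and order: "i \<in> {1..n} \<Longrightarrow> j \<in> {1..n} \<Longrightarrow> j < i \<Longrightarrow> exch S i j \<ge> 0"
    and principal: "i \<in> {1..n} \<Longrightarrow> j \<in> {1..n} \<Longrightarrow> exch S (n + i) j = (if i = j then 1 else 0)"
begin

abbreviation "P \<equiv> projective_seed n qh S"
abbreviation "M \<equiv> mono S"
abbreviation "Z \<equiv> mono (P n)"
abbreviation z :: "nat \<Rightarrow> 'a" where "z i \<equiv> cluster (P i) i"

sublocale frame qh "2*n" M "form S" by (rule good_frame[OF S])

lemma P_0: "P 0 = S" by (simp add: projective_seed_def)

lemma P_Suc: "P (Suc i) = mu (Suc i) (P i)" by (simp add: projective_seed_def)

lemma good_P: "i \<le> n \<Longrightarrow> good_seed (P i)"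
  unfolding projective_seed_def by (rule good_fold[OF S]) auto

lemma order': "i \<in> {1..n} \<Longrightarrow> j \<in> {1..n} \<Longrightarrow> i < j \<Longrightarrow> exch S i j \<le> 0"
  using exch_sign(2)[OF S, of i j] order[of j i] by simp

lemma exch_diag: "i \<in> {1..n} \<Longrightarrow> exch S i i = 0"
  using mutation.b_k[OF good_mutation[OF S]] by blast

lemma order_frozen: "i \<in> {1..2*n} \<Longrightarrow> j \<in> {1..n} \<Longrightarrow> j < i \<Longrightarrow> exch S i j \<ge> 0"
proof (cases "i \<le> n")
  case False
  assume i: "i \<in> {1..2*n}" and j: "j \<in> {1..n}"
  have "i - n \<in> {1..n}" "n + (i - n) = i" using i False by auto
  then show ?thesis using principal[of "i - n" j] j by auto
qed (auto intro: order)

text \<open>When index \<open>k + 1\<close> is mutated, its column has become nonnegative and its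
  row nonpositive. The correction terms of matrix mutation then vanish, and only the signs in that
  row and column change.\<close>

lemma exch_P:
  assumes "k \<le> n" "i \<in> {1..2*n}" "j \<in> {1..n}"
  shows "exch (P k) i j = (if (i \<le> k) \<noteq> (j \<le> k) then - exch S i j else exch S i j)"
  using assms
proof (induction k arbitrary: i j)
  case 0 then show ?case by (simp add: P_0)
next
  case (Suc k)
  let ?l = "Suc k"
  have l: "?l \<in> {1..n}" using Suc.prems by simp
  note IH = Suc.IH[OF Suc_leD[OF Suc.prems(1)]]
  have e: "exch (P ?l) i j = (if i = ?l \<or> j = ?l then - exch (P k) i j
     else exch (P k) i j + (\<bar>exch (P k) i ?l\<bar> * exch (P k) ?l j + exch (P k) i ?l * \<bar>exch (P k) ?l j\<bar>) div 2)"
    by (simp add: P_Suc mutate_def mutated_exch_def)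
  show ?case
  proof (cases "i = ?l \<or> j = ?l")
    case True
    then show ?thesis unfolding e using IH[OF Suc.prems(2,3)] exch_diag[OF l]
      by (cases "i = j") (auto simp: le_Suc_eq)
  next
    case False
    have "exch (P k) i ?l \<ge> 0"
    proof (cases "i \<le> k")
      case True
      then have "exch S i ?l \<le> 0" using Suc.prems l by (intro order') auto
      then show ?thesis using IH[OF Suc.prems(2) l] True by simp
    next
      case ik: False
      then have "exch S i ?l \<ge> 0" using Suc.prems l False by (intro order_frozen) auto
      then show ?thesis using IH[OF Suc.prems(2) l] ik by simp
    qed
    moreover have "exch (P k) ?l j \<le> 0"
    proof (cases "j \<le> k")
      case True
      then have "exch S ?l j \<ge> 0" using Suc.prems l by (intro order) auto
      then show ?thesis using IH[of ?l j] l Suc.prems True by simp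
    next
      case jk: False
      then have "exch S ?l j \<le> 0" using Suc.prems l False by (intro order') auto
      then show ?thesis using IH[of ?l j] l Suc.prems jk by simp
    qed
    ultimately have "exch (P ?l) i j = exch (P k) i j" unfolding e using False by simp
    then show ?thesis using IH[OF Suc.prems(2,3)] False by (auto simp: le_Suc_eq)
  qed
qed

lemma cluster_P: "cluster (P k) i = (if 1 \<le> i \<and> i \<le> k then z i else cluster S i)"
proof (induction k)
  case 0 then show ?case by (simp add: P_0)
next
  case (Suc k)
  have "cluster (P (Suc k)) i = (if i = Suc k then z (Suc k) else cluster (P k) i)"
    by (simp add: P_Suc mutate_def)
  then show ?case using Suc by (auto simp: le_Suc_eq)
qed

lemma mono_proportional:
  assumes "\<And>i. i \<in> {1..2*n} \<Longrightarrow> a i \<noteq> 0 \<Longrightarrow> cluster S1 i = cluster S2 i"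
  shows "\<exists>s. mono S1 a = Q s * mono S2 a"
proof -
  have e: "map (\<lambda>i. cluster S1 i powi a i) [1..<Suc (2*n)] = map (\<lambda>i. cluster S2 i powi a i) [1..<Suc (2*n)]"
  proof (rule map_cong[OF refl])
    fix i assume "i \<in> set [1..<Suc (2*n)]"
    then show "cluster S1 i powi a i = cluster S2 i powi a i" using assms[of i] by (cases "a i = 0") auto
  qed
  let ?s = "\<lambda>S::'a quantum_seed. \<Sum>k=1..2*n. \<Sum>l=1..<k. a k * a l * qform S k l"
  have "mono S1 a = Q (?s S1 - ?s S2) * mono S2 a"
    unfolding seed_monomial_def e by (simp only: Q_mult_left) simp
  then show ?thesis by blast
qed

definition nonneg_exps :: "nat \<Rightarrow> (nat \<Rightarrow> int) set" where
  "nonneg_exps i = {e. (\<forall>l. e l \<ge> 0) \<and> (\<forall>l. l \<notin> {1..i} \<longrightarrow> e l = 0)}"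

lemma mono_P_prod:
  assumes "i \<le> n" "i \<le> k" "e \<in> nonneg_exps i"
  shows "\<exists>s. mono (P k) e = Q s * prod_list (map (\<lambda>l. z l ^ nat (e l)) [1..<Suc (2*n)])"
proof -
  have "map (\<lambda>l. cluster (P k) l powi e l) [1..<Suc (2*n)] = map (\<lambda>l. z l ^ nat (e l)) [1..<Suc (2*n)]"
  proof (rule map_cong[OF refl])
    fix l assume "l \<in> set [1..<Suc (2*n)]"
    then show "cluster (P k) l powi e l = z l ^ nat (e l)"
      using assms cluster_P[of k l] by (cases "l \<le> i") (auto simp: nonneg_exps_def power_int_def)
  qed
  then show ?thesis unfolding seed_monomial_def by (simp only:) blast
qed

lemma sum_list_apply: "sum_list (map g xs) i = (\<Sum>l\<leftarrow>xs. g l i)" for g :: "'b \<Rightarrow> nat \<Rightarrow> int"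
  by (induction xs) auto

lemma lead_mono_P:
  assumes l: "degree_map (2*n) l" and i: "i \<le> n" "i \<le> k" "e \<in> nonneg_exps i"
    and z: "\<And>j. j \<in> {1..i} \<Longrightarrow> e j \<noteq> 0 \<Longrightarrow> lead l (- unit_vector j) (z j)"
  shows "lead l (- e) (mono (P k) e)"
proof -
  let ?xs = "[1..<Suc (2*n)]" and ?g = "\<lambda>j i. int (nat (e j)) * (- unit_vector j) i"
  have "lead l (sum_list (map ?g ?xs)) (prod_list (map (\<lambda>j. z j ^ nat (e j)) ?xs))"
  proof (rule lead_prod_list[OF l])
    fix j assume "j \<in> set ?xs"
    show "lead l (?g j) (z j ^ nat (e j))"
    proof (cases "e j = 0")
      case True
      have "?g j = 0" using True by (auto simp: fun_eq_iff)
      then show ?thesis using lead_1[of l] True by (metis power_0 nat_0)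
    next
      case False
      then have "j \<in> {1..i}" using i(3) by (auto simp: nonneg_exps_def)
      then show ?thesis by (rule lead_power[OF l z[OF _ False]])
    qed
  qed
  moreover have "agree (2*n) (sum_list (map ?g ?xs)) (- e)"
    unfolding agree_def
  proof
    fix q assume q: "q \<in> {1..2*n}"
    have "(\<Sum>j\<leftarrow>xs. ?g j q) = (if q \<in> set xs then - e q else 0)" if "distinct xs" for xs
      using that i(3) by (induction xs) (auto simp: unit_vector_def nonneg_exps_def)
    from this[of ?xs] show "sum_list (map ?g ?xs) q = (- e) q"
      unfolding sum_list_apply using q by (simp del: upt_Suc)
  qed
  ultimately have "lead l (- e) (prod_list (map (\<lambda>j. z j ^ nat (e j)) ?xs))"
    using lead_cong[OF l] by blast
  moreover obtain s where "mono (P k) e = Q s * prod_list (map (\<lambda>j. z j ^ nat (e j)) ?xs)"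
    using mono_P_prod[OF i] by blast
  ultimately show ?thesis by (simp only: lead_Q)
qed

definition tail_exps :: "nat \<Rightarrow> (nat \<Rightarrow> int) set" where
  "tail_exps k = {c. (\<forall>l\<in>{k<..n}. c l \<ge> exch S l k \<and> c (n + l) = 0) \<and> c (n + k) \<ge> 1 \<and> (\<forall>l\<in>{1..n}. c (n + l) \<ge> 0)}"

text \<open>Holds the exponents of products of the \<open>z j\<close> with \<open>j < k\<close>. It
  is closed under addition, and adding the exponent of the old variables in the exchange relation at
  \<open>k\<close> leads into \<open>tail_exps k\<close>.\<close>

definition head_exps :: "nat \<Rightarrow> (nat \<Rightarrow> int) set" where
  "head_exps k = {c. (\<forall>l\<in>{k..n}. c l \<ge> 0 \<and> c (n + l) = 0) \<and> (\<forall>l\<in>{1..n}. c (n + l) \<ge> 0)}"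

text \<open>The mutated column is nonnegative at this moment, so one term of the exchange relation
  is just the inverse of the variable. The other splits into variables already replaced, with
  exponent \<open>e\<close>, and variables still original, with exponent \<open>a\<close>.\<close>

lemma mono_P_first:
  assumes k: "Suc k \<in> {1..n}"
  defines "e \<equiv> \<lambda>i. if i \<in> {1..k} then - exch S i (Suc k) else 0"
    and "a \<equiv> \<lambda>i. if i \<in> {Suc k..2*n} then exch S i (Suc k) - unit_vector (Suc k) i else 0"
  shows "e \<in> nonneg_exps k"
    and "\<exists>s. z (Suc k) = M (- unit_vector (Suc k)) + Q s * (mono (P k) e * M a)"
proof -
  let ?k = "Suc k"
  have kn: "k \<le> n" using k by simp
  interpret F: frame qh "2*n" "mono (P k)" "form (P k)" by (rule good_frame[OF good_P[OF kn]])
  show en: "e \<in> nonneg_exps k"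
    using order'[of _ ?k] k by (auto simp: nonneg_exps_def e_def)
  have b: "exch (P k) i ?k = (if i \<le> k then - exch S i ?k else exch S i ?k)" if "i \<in> {1..2*n}" for i
    using exch_P[OF kn that k] by simp
  have b0: "exch (P k) i ?k \<ge> 0" if "i \<in> {1..2*n}" for i
    using b[OF that] order'[of i ?k] order_frozen[of i ?k] exch_diag[OF k] that k by (cases "i = ?k") auto
  have "mono (P k) (\<lambda>i. - unit_vector ?k i + max (- exch (P k) i ?k) 0) = mono (P k) (- unit_vector ?k)"
    using b0 by (intro seed_monomial_cong) (auto simp: agree_def)
  also have "\<dots> = inverse (mono (P k) (unit_vector ?k))" by (simp only: F.M_inverse)
  also have "mono (P k) (unit_vector ?k) = M (unit_vector ?k)"
    using k cluster_P[of k ?k] by (simp add: seed_monomial_unit)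
  finally have 1: "mono (P k) (\<lambda>i. - unit_vector ?k i + max (- exch (P k) i ?k) 0) = M (- unit_vector ?k)"
    by (simp only: M_inverse)
  have "mono (P k) (\<lambda>i. - unit_vector ?k i + max (exch (P k) i ?k) 0) = mono (P k) (e + a)"
  proof (rule seed_monomial_cong, unfold agree_def, rule)
    fix i assume i: "i \<in> {1..2*n}"
    show "- unit_vector ?k i + max (exch (P k) i ?k) 0 = (e + a) i"
      using b[OF i] b0[OF i] i by (auto simp: e_def a_def unit_vector_def)
  qed
  also have "\<dots> = Q (- form (P k) e a) * (mono (P k) e * mono (P k) a)" by (simp add: F.M_mult)
  also have "\<exists>s. mono (P k) a = Q s * M a"
    by (rule mono_proportional) (auto simp: a_def cluster_P[of k])
  then obtain s where "mono (P k) a = Q s * M a" ..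
  finally have 2: "mono (P k) (\<lambda>i. - unit_vector ?k i + max (exch (P k) i ?k) 0) =
      Q (- form (P k) e a + s) * (mono (P k) e * M a)"
    by (simp add: Q_left_comm[of "mono (P k) e"])
  have "z ?k = mutated_var n qh ?k (P k)" by (simp add: P_Suc mutate_def)
  then have "z ?k = M (- unit_vector ?k) + Q (- form (P k) e a + s) * (mono (P k) e * M a)"
    unfolding mutated_var_def 1 2 by (simp add: add.commute)
  then show "\<exists>s. z ?k = M (- unit_vector ?k) + Q s * (mono (P k) e * M a)" by blast
qed

lemma tail_head: "k \<in> {1..n} \<Longrightarrow> k < l \<Longrightarrow> tail_exps k \<subseteq> head_exps l"
proof (unfold tail_exps_def head_exps_def, clarify, intro conjI ballI)
  fix c q assume *: "k \<in> {1..n}" "k < l" "\<forall>l\<in>{k<..n}. c l \<ge> exch S l k \<and> c (n + l) = 0" "q \<in> {l..n}"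
  then have q: "q \<in> {k<..n}" "q \<in> {1..n}" by auto
  show "c q \<ge> 0" using order_trans[OF order[of q k], of "c q"] * q by simp
  show "c (n + q) = 0" using * q by simp
qed

lemma z_expansion:
  assumes "k \<in> {1..n}"
  shows "z k - M (- unit_vector k) \<in> Sp (tail_exps k)"
  using assms
proof (induction k rule: less_induct)
  case (less k)
  obtain k' where k': "k = Suc k'" using less.prems by (cases k) auto
  define e where "e = (\<lambda>i. if i \<in> {1..k'} then - exch S i k else 0)"
  define a where "a = (\<lambda>i. if i \<in> {k..2*n} then exch S i k - unit_vector k i else 0)"
  note f = mono_P_first[OF less.prems[unfolded k'], folded k', folded e_def a_def]
  have H0: "0 \<in> head_exps k" by (auto simp: head_exps_def)
  have Ha: "u + v \<in> head_exps k" if "u \<in> head_exps k" "v \<in> head_exps k" for u v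
    using that by (auto simp: head_exps_def)
  have zH: "z j \<in> Sp (head_exps k)" if "j \<in> {1..k'}" for j
  proof -
    have "j \<in> {1..n}" "j < k" using that k' less.prems by auto
    then have "z j - M (- unit_vector j) \<in> Sp (head_exps k)"
      using Sp_mono[OF less.IH tail_head] by blast
    moreover have "M (- unit_vector j) \<in> Sp (head_exps k)"
      using that k' less.prems by (intro Sp_M) (auto simp: head_exps_def unit_vector_def)
    ultimately show ?thesis using Sp_diffD by blast
  qed
  have "prod_list (map (\<lambda>l. z l ^ nat (e l)) [1..<Suc (2*n)]) \<in> Sp (head_exps k)"
  proof (rule Sp_prod_list[OF H0 Ha])
    fix l show "z l ^ nat (e l) \<in> Sp (head_exps k)"
      using Sp_power[OF H0 Ha zH, of l] Sp_1[OF H0] by (cases "l \<in> {1..k'}") (auto simp: e_def)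
  qed
  then have "mono (P k') e \<in> Sp (head_exps k)"
    using mono_P_prod[OF _ _ f(1), of k'] less.prems k' by auto
  then have "mono (P k') e * M a \<in> Sp (tail_exps k)"
  proof (rule Sp_mult[OF _ Sp_M[of a "{a}"]])
    fix u v assume "u \<in> head_exps k" "v \<in> {a}"
    then show "u + v \<in> tail_exps k"
      using less.prems principal[OF _ less.prems] by (auto simp: head_exps_def tail_exps_def a_def unit_vector_def)
  qed simp
  moreover obtain s where "z k = M (- unit_vector k) + Q s * (mono (P k') e * M a)" using f(2) by blast
  ultimately show ?case by (simp only: add_diff_cancel_left' Sp_Q)
qed

section \<open>Leading terms and lowest components of the projective variables\<close>

definition frozen_degree :: "nat \<Rightarrow> (nat \<Rightarrow> int) \<Rightarrow> int" where
  "frozen_degree i c = (\<Sum>l=1..i. c (n + l))"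

lemma frozen_degree: "i \<le> n \<Longrightarrow> degree_map (2*n) (frozen_degree i)"
  by (auto simp: degree_map_def frozen_degree_def sum.distrib agree_def intro!: sum.cong)

lemma lead_z_frozen:
  assumes "i \<le> n" "j \<in> {1..i}" shows "lead (frozen_degree i) (- unit_vector j) (z j)"
proof -
  have "z j - M (- unit_vector j) \<in> Sp {c. frozen_degree i c > frozen_degree i (- unit_vector j)}"
  proof (rule Sp_mono[OF z_expansion], use assms in simp, clarify)
    fix c assume c: "c \<in> tail_exps j"
    have "1 \<le> c (n + j)" using c by (simp add: tail_exps_def)
    also have "\<dots> \<le> frozen_degree i c" unfolding frozen_degree_def
      using assms c by (intro member_le_sum) (auto simp: tail_exps_def)
    finally show "frozen_degree i c > frozen_degree i (- unit_vector j)"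
      using assms by (simp add: frozen_degree_def unit_vector_def)
  qed
  then show ?thesis unfolding lead_def by (intro exI[of _ 0]) simp
qed

lemma z_nonneg:
  assumes "j \<in> {1..n}" "k \<in> {1..n}" "j < k" shows "z j \<in> Sp {c. c k \<ge> 0}"
proof -
  have "z j - M (- unit_vector j) \<in> Sp {c. c k \<ge> 0}"
    using tail_head[OF assms(1,3)] assms by (intro Sp_mono[OF z_expansion]) (auto simp: head_exps_def)
  moreover have "M (- unit_vector j) \<in> Sp {c. c k \<ge> 0}" using assms by (intro Sp_M) (simp add: unit_vector_def)
  ultimately show ?thesis using Sp_diffD by blast
qed

text \<open>Each further term of \<open>z j\<close> contains \<open>x_k\<close> at least to the
  power \<open>exch S k j\<close>, so at \<open>x_k = 0\<close> only the inverse of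
  \<open>x_j\<close> survives.\<close>

lemma lead_z_neighbour:
  assumes "j \<in> {1..n}" "k \<in> {1..n}" "j < k" "exch S k j > 0"
  shows "lead (\<lambda>c. c k) (- unit_vector j) (z j)"
proof -
  have "z j - M (- unit_vector j) \<in> Sp {c. c k > (- unit_vector j) k}"
  proof (intro Sp_mono[OF z_expansion[OF assms(1)]] subsetI CollectI)
    fix c assume "c \<in> tail_exps j"
    then have "exch S k j \<le> c k" using assms unfolding tail_exps_def by simp
    then show "c k > (- unit_vector j) k" using assms by (simp add: unit_vector_def)
  qed
  then show ?thesis unfolding lead_def by (intro exI[of _ 0]) simp
qed

lemma mono_P_nonneg:
  assumes "k \<in> {1..n}" "i < k" "i \<le> q" "e \<in> nonneg_exps i"
  shows "mono (P q) e \<in> Sp {c. c k \<ge> 0}"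
proof -
  have "prod_list (map (\<lambda>l. z l ^ nat (e l)) [1..<Suc (2*n)]) \<in> Sp {c. c k \<ge> 0}"
  proof (rule Sp_prod_list)
    fix l show "z l ^ nat (e l) \<in> Sp {c. c k \<ge> 0}"
    proof (cases "l \<in> {1..i}")
      case True
      then show ?thesis using assms by (intro Sp_power z_nonneg) auto
    next
      case False
      then show ?thesis using assms by (auto simp: nonneg_exps_def intro!: Sp_1)
    qed
  qed auto
  then show ?thesis using mono_P_prod[OF _ assms(3,4)] assms by auto
qed

text \<open>The variables \<open>z j\<close> that enter the second term of the exchange relation
  belong to indices with \<open>exch S k j > 0\<close>. In lowest \<open>x_k\<close>-degree they
  reduce to inverses of \<open>x_j\<close>, and together they restore the entries of column
  \<open>k\<close> below \<open>k\<close>. The power of \<open>qh\<close> remains open.\<close>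

lemma z_component:
  assumes k: "k \<in> {1..n}"
  shows "\<exists>s. pr {c. c k = - 1} (z k) = M (- unit_vector k) + Q s * M (- unit_vector k + col S k)"
    and "z k \<in> Sp {c. c k \<ge> - 1}"
proof -
  have kd: "degree_map (2*n) (\<lambda>c. c k)" using k by (intro degree_map_coord) auto
  obtain k' where k': "k = Suc k'" using k by (cases k) auto
  define e where "e = (\<lambda>i. if i \<in> {1..k'} then - exch S i k else 0)"
  define a where "a = (\<lambda>i. if i \<in> {k..2*n} then exch S i k - unit_vector k i else 0)"
  note f = mono_P_first[OF k[unfolded k'], folded k', folded e_def a_def]
  have "lead (\<lambda>c. c k) (- e) (mono (P k') e)"
  proof (rule lead_mono_P[OF kd _ _ f(1)])
    fix j assume j: "j \<in> {1..k'}" "e j \<noteq> 0"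
    then have "exch S j k \<noteq> 0" by (auto simp: e_def split: if_splits)
    moreover have jn: "j \<in> {1..n}" using j k k' by auto
    ultimately have "exch S k j > 0"
      using exch_sign[OF S jn k] order'[OF jn k] j k' by force
    then show "lead (\<lambda>c. c k) (- unit_vector j) (z j)"
      using j k k' by (intro lead_z_neighbour) auto
  qed (use k k' in auto)
  then have "lead (\<lambda>c. c k) (- e + a) (mono (P k') e * M a)"
    using lead_M[of "\<lambda>c. c k" a 0] by (intro lead_mult[OF kd]) auto
  moreover have "agree (2*n) (- e + a) (- unit_vector k + col S k)"
    by (auto simp: agree_def e_def a_def k' unit_vector_def)
  ultimately have "lead (\<lambda>c. c k) (- unit_vector k + col S k) (mono (P k') e * M a)"
    using lead_cong[OF kd] by blast
  moreover obtain s where s: "z k = M (- unit_vector k) + Q s * (mono (P k') e * M a)" using f(2) by blast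
  ultimately have "lead (\<lambda>c. c k) (- unit_vector k + col S k) (Q s * (mono (P k') e * M a))" by (intro lead_Q)
  then obtain t where t: "Q s * (mono (P k') e * M a) - Q t * M (- unit_vector k + col S k) \<in> Sp {c. c k > - 1}"
    unfolding lead_def using exch_diag[OF k] by (auto simp: unit_vector_def)
  have m: "M (- unit_vector k) + Q t * M (- unit_vector k + col S k) \<in> Sp {c. c k = - 1}"
    using exch_diag[OF k] by (intro Sp_add Sp_gen Sp_M) (auto simp: unit_vector_def)
  have d: "z k - (M (- unit_vector k) + Q t * M (- unit_vector k + col S k)) \<in> Sp {c. c k > - 1}"
    unfolding s using t by (simp add: algebra_simps)
  have "pr {c. c k = - 1} (z k) = M (- unit_vector k) + Q t * M (- unit_vector k + col S k)"
    by (rule pr_eqI[OF sat_eq[OF kd] m]) (rule Sp_mono[OF d], auto)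
  then show "\<exists>s. pr {c. c k = - 1} (z k) = M (- unit_vector k) + Q s * M (- unit_vector k + col S k)" by blast
  have "(z k - (M (- unit_vector k) + Q t * M (- unit_vector k + col S k))) +
      (M (- unit_vector k) + Q t * M (- unit_vector k + col S k)) \<in> Sp {c. c k \<ge> - 1}"
    by (rule Sp_add, rule Sp_mono[OF d], force, rule Sp_mono[OF m], force)
  then show "z k \<in> Sp {c. c k \<ge> - 1}" by simp
qed

lemma z_upper_bound: assumes "i \<in> {1..n}" shows "z i \<in> upper_bound S"
proof -
  have "z i \<in> upper_bound (P i)" using assms by (intro cluster_upper_bound good_P) auto
  moreover have "upper_bound (P i) \<subseteq> upper_bound S"
    unfolding projective_seed_def using assms by (intro upper_bound_fold[OF S]) auto
  ultimately show ?thesis by blast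
qed

text \<open>The open power of \<open>qh\<close> is found indirectly: \<open>z k\<close> lies in the
  upper bound, so its component is divisible by \<open>A.r 1\<close>, and
  \<open>ratio_unique\<close> then forces the value. That value is a monomial of the frame mutated
  at \<open>k\<close>, whose powers are known.\<close>

lemma z_power_component:
  assumes k: "k \<in> {1..n}"
  shows "pr {c. c k = - int t} (z k ^ t) = M (\<lambda>i. - int t * unit_vector k i) * mut_ratio M k (col S k) (int t)"
    and "z k ^ t \<in> Sp {c. c k \<ge> - int t}"
proof -
  have kd: "degree_map (2*n) (\<lambda>c. c k)" using k by (intro degree_map_coord) auto
  interpret A: mutation qh "2*n" M "form S" k "col S k" "d k" by (rule good_mutation[OF S k])
  interpret F: frame qh "2*n" A.M' A.L' by (rule A.frame_mutation)
  have "z k \<in> Sp UNIV" "z k \<in> A.Sp' UNIV"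
    using z_upper_bound[OF k] k unfolding upper_bound_def mono_mutate(1)[OF S k, symmetric] by auto
  then obtain h where h: "h \<in> Sp {c. c k = - 1}" "pr {c. c k = - 1} (z k) = h * A.r 1"
    using A.inter_component[of "z k" 1] by auto
  obtain s where s: "pr {c. c k = - 1} (z k) = M (- unit_vector k) + Q s * M (- unit_vector k + col S k)"
    using z_component(1)[OF k] by blast
  have z1: "pr {c. c k = - 1} (z k) = M (- unit_vector k) * A.r 1"
    unfolding s using h s by (intro A.ratio_unique) (auto intro: Sp_UNIV)
  define a where "a = A.\<phi> (- unit_vector k)"
  have ak: "a k = 1" by (simp add: a_def unit_vector_def)
  have z1': "pr {c. c k = - 1} (z k) = A.M' a"
    unfolding z1 mut_frame_def ak by (simp add: a_def)
  have *: "pr {c. c k = - int t} (z k ^ t) = A.M' a ^ t \<and> z k ^ t \<in> Sp {c. c k \<ge> - int t}" for t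
  proof (induction t)
    case 0
    have "pr {c. c k = 0} 1 = 1" by (rule pr_id[OF sat_eq[OF kd] Sp_1[of "{0}"]]) auto
    then show ?case by (auto intro: Sp_1)
  next
    case (Suc t)
    have e: "- int (Suc t) = - 1 + - int t" by simp
    have "pr {c. c k = - 1 + - int t} (z k * z k ^ t) = pr {c. c k = - 1} (z k) * pr {c. c k = - int t} (z k ^ t)"
      using Suc by (intro pr_mult_low[OF kd z_component(2)[OF k]]) auto
    moreover have "z k * z k ^ t \<in> Sp {c. c k \<ge> - 1 + - int t}"
      by (rule Sp_mult[OF z_component(2)[OF k]]) (use Suc in auto)
    ultimately show ?case unfolding power_Suc e using Suc z1' by simp
  qed
  show "z k ^ t \<in> Sp {c. c k \<ge> - int t}" using * by blast
  have "A.M' a ^ t = A.M' (\<lambda>i. int t * a i)" using F.M_powi[of a "int t"] by simp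
  also have "\<dots> = M (A.\<phi> (\<lambda>i. int t * a i)) * A.r (int t)" by (simp add: mut_frame_def ak)
  also have "A.\<phi> (\<lambda>i. int t * a i) = (\<lambda>i. int t * A.\<phi> a i)" by (auto simp: mut_exp_def algebra_simps)
  also have "\<dots> = (\<lambda>i. - int t * unit_vector k i)" unfolding a_def A.phi_phi by auto
  finally show "pr {c. c k = - int t} (z k ^ t) = M (\<lambda>i. - int t * unit_vector k i) * mut_ratio M k (col S k) (int t)"
    using * by simp
qed

end

section \<open>Spanning by projective standard monomials\<close>

lemma (in frame) sum_component_zero:
  assumes l: "degree_map m l" and y: "(\<Sum>g\<in>J. F g * D g) \<in> Sp {c. l c > r}"
    and F: "\<And>g. g \<in> J \<Longrightarrow> F g \<in> Sp {c. l c \<ge> r}" and D: "\<And>g. g \<in> J \<Longrightarrow> D g \<in> Sp {c. l c \<ge> 0}"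
  shows "(\<Sum>g\<in>J. pr {c. l c = r} (F g) * pr {c. l c = 0} (D g)) = 0"
proof -
  have "0 = pr {c. l c = r} (\<Sum>g\<in>J. F g * D g)" by (rule pr_eq_0[OF sat_eq[OF l] y, symmetric]) auto
  also have "\<dots> = (\<Sum>g\<in>J. pr {c. l c = r} (F g * D g))"
    using F D by (intro pr_sum sat_eq l Sp_mult[of _ UNIV _ UNIV]) (auto intro: Sp_UNIV)
  also have "\<dots> = (\<Sum>g\<in>J. pr {c. l c = r} (F g) * pr {c. l c = 0} (D g))"
    using pr_mult_low[OF l F D] by (intro sum.cong refl) simp
  finally show ?thesis by simp
qed

context acyclic_seed begin

definition pos :: "(nat \<Rightarrow> int) \<Rightarrow> nat \<Rightarrow> int" where "pos g = (\<lambda>l. max (g l) 0)"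
definition neg :: "(nat \<Rightarrow> int) \<Rightarrow> nat \<Rightarrow> int" where "neg g = (\<lambda>l. max (- g l) 0)"
definition supported :: "nat set \<Rightarrow> (nat \<Rightarrow> int) set" where "supported I = {g. \<forall>l. l \<notin> I \<longrightarrow> g l = 0}"
definition vanishing :: "nat set \<Rightarrow> (nat \<Rightarrow> int) set" where "vanishing I = {c. \<forall>l\<in>I. c l = 0}"

lemma pos_neg: "pos g - neg g = g" by (auto simp: pos_def neg_def fun_eq_iff)

lemma neg_exps: "g \<in> supported I \<Longrightarrow> I \<subseteq> {1..i} \<Longrightarrow> neg g \<in> nonneg_exps i"
proof -
  assume g: "g \<in> supported I" and I: "I \<subseteq> {1..i}"
  have "g l = 0" if "l \<notin> {1..i}" for l using g I that unfolding supported_def by blast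
  then show ?thesis by (simp add: neg_def nonneg_exps_def)
qed

text \<open>As \<open>a\<^sub>k a'\<^sub>k = 0\<close>, a pair of standard exponents is encoded by the integer vector \<open>g = a - a'\<close>.\<close>

definition std :: "(nat \<Rightarrow> int) \<Rightarrow> 'a" where "std g = M (pos g) * Z (neg g)"

text \<open>Interpolates between the torus for \<open>i = 0\<close> and the span over
  \<open>ZP\<close> of all standard monomials for \<open>i = n\<close>: the coefficients may still
  contain \<open>x_l\<close> and its inverse for \<open>l > i\<close>. In the same way
  \<open>U\<close> interpolates between the torus and the upper bound.\<close>

definition V :: "nat \<Rightarrow> 'a set" where
  "V i = additive_span {r * std g | r g. r \<in> Sp (vanishing {1..i}) \<and> g \<in> supported {1..i}}"

definition U :: "nat \<Rightarrow> 'a set" where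
  "U i = Sp UNIV \<inter> (\<Inter>k\<in>{1..i}. torus (mono (mu k S)))"

lemma U_diff: "i \<le> n \<Longrightarrow> y \<in> U i \<Longrightarrow> x \<in> U i \<Longrightarrow> y - x \<in> U i"
  using torus_ring(2)[OF S] torus_ring(2)[OF good_mutate[OF S]] unfolding U_def by auto

lemma U_mult: "i \<le> n \<Longrightarrow> y \<in> U i \<Longrightarrow> x \<in> U i \<Longrightarrow> y * x \<in> U i"
  using torus_ring(3)[OF S] torus_ring(3)[OF good_mutate[OF S]] unfolding U_def by auto

lemma U_M: "i \<le> n \<Longrightarrow> (\<And>l. l \<in> {1..i} \<Longrightarrow> c l \<ge> 0) \<Longrightarrow> M c \<in> U i"
  unfolding U_def by (auto intro!: Sp_M mono_nonneg_torus[OF S])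

lemma U_0: "i \<le> n \<Longrightarrow> 0 \<in> U i"
  using U_diff[OF _ U_M U_M, of i 0 0] by simp

lemma U_Q: "i \<le> n \<Longrightarrow> y \<in> U i \<Longrightarrow> Q s * y \<in> U i"
proof -
  assume i: "i \<le> n" and y: "y \<in> U i"
  have "Q s * y \<in> torus (mono (mu k S))" if "k \<in> {1..i}" for k
  proof -
    have "k \<in> {1..n}" using that i by auto
    then interpret F: frame qh "2*n" "mono (mu k S)" "form (mu k S)" by (intro good_frame good_mutate[OF S])
    show ?thesis using y that by (intro F.Sp_Q) (auto simp: U_def)
  qed
  then show ?thesis using y by (simp add: U_def)
qed

lemma upper_bound_U_n: "upper_bound S = U n" unfolding upper_bound_def U_def ..

lemma mono_P_U:
  assumes "i \<le> n" "i \<le> k" "e \<in> nonneg_exps i" shows "mono (P k) e \<in> U n"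
proof -
  have "prod_list (map (\<lambda>l. z l ^ nat (e l)) xs) \<in> U n" for xs
  proof (induction xs)
    case Nil show ?case using upper_bound_ring(1)[OF S] upper_bound_U_n by simp
  next
    case (Cons l xs)
    have "z l ^ t \<in> U n" if "l \<in> {1..n}" for t
    proof (induction t)
      case 0 show ?case using upper_bound_ring(1)[OF S] upper_bound_U_n by simp
    next
      case (Suc t)
      then show ?case using U_mult[of n "z l" "z l ^ t"] z_upper_bound[OF that] upper_bound_U_n by simp
    qed
    then have "z l ^ nat (e l) \<in> U n"
      using assms upper_bound_ring(1)[OF S] upper_bound_U_n
      by (cases "l \<in> {1..n}") (auto simp: nonneg_exps_def)
    then show ?case using Cons U_mult[of n] by simp
  qed
  then show ?thesis using mono_P_prod[OF assms] U_Q[of n] by auto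
qed

lemma U_mono: "i \<le> k \<Longrightarrow> U k \<subseteq> U i" unfolding U_def by auto

lemma V_U: assumes "i \<le> n" shows "V i \<subseteq> U i"
proof
  fix y assume "y \<in> V i"
  then show "y \<in> U i" unfolding V_def
  proof induction
    case (gen x)
    then obtain r g where x: "x = r * std g" "r \<in> Sp (vanishing {1..i})" "g \<in> supported {1..i}" by auto
    have "r \<in> U i" using x(2)
    proof (induction rule: Sp_induct)
      case (gen s a)
      then show ?case using assms by (intro U_Q U_M) (auto simp: vanishing_def)
    qed (auto simp: U_0 U_diff assms)
    moreover have "M (pos g) \<in> U i" using assms by (intro U_M) (auto simp: pos_def)
    moreover have "Z (neg g) \<in> U i"
      using mono_P_U[OF assms assms neg_exps[OF x(3)]] U_mono[OF assms] by auto
    ultimately show ?case unfolding x(1) std_def using assms by (intro U_mult)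
  qed (auto simp: U_0 U_diff assms)
qed

lemma V_gen: "r \<in> Sp (vanishing {1..i}) \<Longrightarrow> g \<in> supported {1..i} \<Longrightarrow> r * std g \<in> V i"
  unfolding V_def by (auto intro: additive_span.gen)

lemma V_sum: "(\<And>j. j \<in> J \<Longrightarrow> f j \<in> V i) \<Longrightarrow> sum f J \<in> V i"
  unfolding V_def by (rule additive_span_sum)

lemma V_add: "x \<in> V i \<Longrightarrow> y \<in> V i \<Longrightarrow> x + y \<in> V i"
  unfolding V_def by (rule additive_span_add)

lemma V_Q: "x \<in> V i \<Longrightarrow> Q s * x \<in> V i"
  unfolding V_def by (rule span_Q)

lemma V_family:
  assumes "y \<in> V i"
  obtains J F where "finite J" "J \<subseteq> supported {1..i}" "\<And>g. F g \<in> Sp (vanishing {1..i})" "y = (\<Sum>g\<in>J. F g * std g)"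
proof -
  have "\<exists>J F. finite J \<and> J \<subseteq> supported {1..i} \<and> (\<forall>g. F g \<in> Sp (vanishing {1..i})) \<and>
      (\<forall>g. g \<notin> J \<longrightarrow> F g = 0) \<and> y = (\<Sum>g\<in>J. F g * std g)"
    using assms unfolding V_def by (intro span_family) (auto intro: Sp_diff)
  then show ?thesis using that by blast
qed

lemma lead_std:
  assumes "i \<le> n" "g \<in> supported {1..i}" shows "lead (frozen_degree i) g (std g)"
proof -
  note l = frozen_degree[OF assms(1)]
  have "lead (frozen_degree i) (- neg g) (Z (neg g))"
    using assms by (intro lead_mono_P[OF l assms(1) assms(1) neg_exps[OF assms(2)]] lead_z_frozen) auto
  then have "lead (frozen_degree i) (pos g + - neg g) (std g)"
    unfolding std_def using lead_M[of "frozen_degree i" "pos g" 0] by (intro lead_mult[OF l]) auto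
  moreover have "pos g + - neg g = g" using pos_neg[of g] by (auto simp: fun_eq_iff)
  ultimately show ?thesis by simp
qed

lemma frozen_degree_supported: "i \<le> n \<Longrightarrow> g \<in> supported {1..i} \<Longrightarrow> frozen_degree i g = 0"
  by (auto simp: frozen_degree_def supported_def)

end

section \<open>Passage from the indices up to \<open>i\<close> to the next index
  \<open>k\<close>\<close>

locale projective_step = acyclic_seed +
  fixes i k :: nat
  assumes k_def: "k = Suc i" and kn: "k \<le> n"
begin

lemma k: "k \<in> {1..n}" and i_n: "i \<le> n" and k2: "k \<in> {1..2*n}"
  using k_def kn by auto

lemma kd: "degree_map (2*n) (\<lambda>c. c k)" by (rule degree_map_coord[OF k2])

abbreviation "pr0 \<equiv> pr {c. c k = 0}"

sublocale A: mutation qh "2*n" M "form S" k "col S k" "d k" by (rule good_mutation[OF S k])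

lemma supported_k: "g \<in> supported I \<Longrightarrow> I \<subseteq> {1..i} \<Longrightarrow> g k = 0"
  using k_def by (auto simp: supported_def)

lemma Z_nonneg: "e \<in> nonneg_exps i \<Longrightarrow> Z e \<in> Sp {c. c k \<ge> 0}"
  using k_def i_n by (intro mono_P_nonneg[OF k]) auto

lemma M_pos_deg: "g k = 0 \<Longrightarrow> M (pos g) \<in> Sp {c. c k = 0}"
  by (intro Sp_M) (simp add: pos_def)

lemma std_nonneg: assumes g: "g \<in> supported {1..i}" shows "std g \<in> Sp {c. c k \<ge> 0}"
proof -
  have "M (pos g) \<in> Sp {c. c k = 0}" using supported_k[OF g] by (intro M_pos_deg) simp
  moreover have "Z (neg g) \<in> Sp {c. c k \<ge> 0}" using neg_exps[OF g] by (intro Z_nonneg) simp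
  ultimately show ?thesis unfolding std_def by (elim Sp_mult) auto
qed

lemma pr0_mult:
  "x \<in> Sp {c. c k \<ge> 0} \<Longrightarrow> y \<in> Sp {c. c k \<ge> 0} \<Longrightarrow> pr0 (x * y) = pr0 x * pr0 y"
  using pr_mult_low[OF kd, of x 0 y 0] by simp

lemma pr0_id: "y \<in> Sp {c. c k = 0} \<Longrightarrow> pr0 y = y"
  by (rule pr_id[OF sat_eq[OF kd]]) auto

lemma pr0_mem: "y \<in> Sp A \<Longrightarrow> pr0 y \<in> Sp {c. c k = 0}"
  by (rule Sp_mono[OF pr_mem(1)[OF sat_eq[OF kd]]]) auto

lemma deg0_nonneg: "y \<in> Sp {c. c k = 0} \<Longrightarrow> y \<in> Sp {c. c k \<ge> 0}"
  by (erule Sp_mono) auto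

lemma pr0_std:
  assumes "g \<in> supported {1..i}" shows "pr0 (std g) = M (pos g) * pr0 (Z (neg g))"
proof -
  have m: "M (pos g) \<in> Sp {c. c k = 0}" using supported_k[OF assms] by (intro M_pos_deg) simp
  have "pr0 (std g) = pr0 (M (pos g)) * pr0 (Z (neg g))"
    unfolding std_def using deg0_nonneg[OF m] Z_nonneg[OF neg_exps[OF assms]] by (intro pr0_mult) auto
  then show ?thesis using pr0_id[OF m] by simp
qed

lemma lead_pr0_std:
  assumes g: "g \<in> supported {1..i}" shows "lead (frozen_degree i) g (pr0 (std g))"
proof -
  obtain s where s: "std g - Q s * M g \<in> Sp {c. frozen_degree i c > frozen_degree i g}"
    using lead_std[OF i_n g] unfolding lead_def by blast
  have m: "Q s * M g \<in> Sp {c. c k = 0}" using supported_k[OF g] by (intro Sp_gen) auto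
  have "pr0 (std g - Q s * M g) = pr0 (std g) - Q s * M g"
    using pr_diff[OF sat_eq[OF kd] Sp_UNIV[OF std_nonneg[OF g]] Sp_UNIV[OF m]] pr0_id[OF m] by simp
  moreover have "pr0 (std g - Q s * M g) \<in> Sp {c. frozen_degree i c > frozen_degree i g}"
    using pr_mem(1)[OF sat_eq[OF kd] s] by (rule Sp_mono) auto
  ultimately show ?thesis unfolding lead_def by auto
qed

lemma supported_separated:
  assumes "g \<in> supported I" "h \<in> supported I" "g \<noteq> h" shows "\<exists>l\<in>I. g l \<noteq> h l"
proof (rule ccontr)
  assume "\<not> ?thesis"
  then have "g l = h l" for l using assms by (cases "l \<in> I") (auto simp: supported_def)
  then show False using assms(3) by auto
qed

text \<open>Otherwise the lowest components of the coefficients would satisfy a linear relation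
  between the elements \<open>pr0 (std g)\<close>, whose leading monomials are distinct.
  Independence is obtained from \<open>division\<close> with divisor and right-hand side 0: every
  coefficient is then a multiple of 0.\<close>

lemma coefficients_degree:
  assumes J: "finite J" "J \<subseteq> supported {1..i}" and F: "\<And>g. F g \<in> Sp (vanishing {1..i})"
    and y: "(\<Sum>g\<in>J. F g * std g) \<in> Sp {c. c k \<ge> t}" and g: "g \<in> J"
  shows "F g \<in> Sp {c. c k \<ge> t}"
proof -
  obtain r t' where "\<forall>g\<in>J. F g \<in> Sp {c. r \<le> c k \<and> c k < r + int t'}"
    using Sp_bounds_family[where F = F, OF kd J(1) F] by blast
  then have r: "F g \<in> Sp {c. c k \<ge> r}" if "g \<in> J" for g
    by (rule Sp_mono[OF bspec[OF _ that]]) auto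
  have "\<forall>g\<in>J. F g \<in> Sp {c. c k \<ge> min t (r + int q)}" for q
  proof (induction q)
    case 0 show ?case by (auto intro: Sp_mono[OF r])
  next
    case (Suc q)
    show ?case
    proof (cases "r + int q < t")
      case False then show ?thesis using Suc by (auto simp: min_def split: if_splits)
    next
      case True
      let ?r = "r + int q"
      have Fr: "F g \<in> Sp {c. c k \<ge> ?r}" if "g \<in> J" for g using Suc that True by (simp add: min_def)
      have "(\<Sum>g\<in>J. F g * std g) \<in> Sp {c. c k > ?r}" by (rule Sp_mono[OF y]) (use True in auto)
      then have sum: "(\<Sum>g\<in>J. pr {c. c k = ?r} (F g) * pr0 (std g)) = 0"
        using Fr std_nonneg J by (intro sum_component_zero[OF kd]) auto
      have "\<exists>G. \<forall>g\<in>J. G g \<in> Sp {c. \<forall>l\<in>{1..i}. c l = 0} \<and> pr {c. c k = ?r} (F g) = G g * 0"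
      proof (rule division[OF frozen_degree[OF i_n] J(1), of "{1..i}" _ _ "\<lambda>g. g" "\<lambda>g. pr0 (std g)" 0 0])
        show "{1..i} \<subseteq> {1..2*n}" using i_n by auto
        show "pr {c. c k = ?r} (F g) \<in> Sp {c. \<forall>l\<in>{1..i}. c l = 0}" for g
          using pr_mem(1)[OF sat_eq[OF kd] F] by (rule Sp_mono) (auto simp: vanishing_def)
        show "\<exists>l\<in>{1..i}. g l \<noteq> h l" if "g \<in> J" "h \<in> J" "g \<noteq> h" for g h
          using supported_separated[of g "{1..i}" h] that J by blast
        show "lead (frozen_degree i) g (pr0 (std g))" if "g \<in> J" for g using that J by (intro lead_pr0_std) auto
        show "frozen_degree i g = 0" if "g \<in> J" for g using that J by (intro frozen_degree_supported i_n) auto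
      qed (simp_all add: sum)
      then have "pr {c. c k = ?r} (F g) = 0" if "g \<in> J" for g using that by auto
      then have "F g \<in> Sp {c. c k \<ge> ?r + 1}" if "g \<in> J" for g using Sp_raise[OF kd Fr] that by blast
      then show ?thesis
      proof (intro ballI)
        fix g assume "g \<in> J" "\<And>g. g \<in> J \<Longrightarrow> F g \<in> Sp {c. c k \<ge> ?r + 1}"
        then have "F g \<in> Sp {c. c k \<ge> ?r + 1}" by blast
        then show "F g \<in> Sp {c. c k \<ge> min t (r + int (Suc q))}" by (rule Sp_mono) auto
      qed
    qed
  qed
  from this[of "nat (t - r)"] g show ?thesis by (auto simp: min_def split: if_splits)
qed

lemma V_family_degree:
  assumes "y \<in> V i" "y \<in> Sp {c. c k \<ge> t}"
  obtains J F where "finite J" "J \<subseteq> supported {1..i}" "\<And>g. F g \<in> Sp (vanishing {1..i})"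
    "\<And>g. g \<in> J \<Longrightarrow> F g \<in> Sp {c. c k \<ge> t}" "y = (\<Sum>g\<in>J. F g * std g)"
proof -
  obtain J F where J: "finite J" "J \<subseteq> supported {1..i}" "\<And>g. F g \<in> Sp (vanishing {1..i})"
    "y = (\<Sum>g\<in>J. F g * std g)"
    by (rule V_family[OF assms(1)]) blast
  have "F g \<in> Sp {c. c k \<ge> t}" if "g \<in> J" for g
    using coefficients_degree[of J F t g] J assms(2) that by simp
  then show ?thesis using that J by blast
qed

text \<open>The nonnegative power of \<open>x_k\<close> passes from the coefficient into the
  standard monomial, as its exponent at \<open>k\<close>.\<close>

lemma V_step_gen:
  assumes g: "g \<in> supported {1..i}" and c: "c \<in> vanishing {1..i}" and ck: "c k \<ge> 0"
  shows "M c * std g \<in> V k"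
proof -
  define h where "h = g + (\<lambda>l. c k * unit_vector k l)"
  have gk: "g k = 0" using supported_k[OF g] by simp
  have ph: "pos h = pos g + (\<lambda>l. c k * unit_vector k l)" "neg h = neg g"
    using gk ck by (auto simp: h_def pos_def neg_def unit_vector_def fun_eq_iff)
  have h: "h \<in> supported {1..k}" using g k_def by (auto simp: h_def supported_def unit_vector_def)
  let ?c = "c - (\<lambda>l. c k * unit_vector k l)"
  have c': "?c \<in> vanishing {1..k}" using c k_def by (auto simp: vanishing_def unit_vector_def le_Suc_eq)
  have e: "?c + pos h = c + pos g" by (simp add: ph)
  have "M c * M (pos g) = Q (form S c (pos g) - form S ?c (pos h)) * (M ?c * M (pos h))"
    unfolding M_mult e by simp
  then have "M c * std g = Q (form S c (pos g) - form S ?c (pos h)) * (M ?c * std h)"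
    unfolding std_def ph(2) by (simp add: mult.assoc[symmetric])
  then show ?thesis using V_Q[OF V_gen[OF Sp_M[OF c'] h]] by simp
qed

lemma V_step_nonneg:
  assumes y: "y \<in> V i" "y \<in> Sp {c. c k \<ge> 0}" shows "y \<in> V k"
proof -
  obtain J F where J: "finite J" "J \<subseteq> supported {1..i}" and F: "\<And>g. F g \<in> Sp (vanishing {1..i})"
    "\<And>g. g \<in> J \<Longrightarrow> F g \<in> Sp {c. c k \<ge> 0}" and eq: "y = (\<Sum>g\<in>J. F g * std g)"
    by (rule V_family_degree[OF y]) blast
  have "F g * std g \<in> V k" if g: "g \<in> J" for g
  proof -
    have "F g \<in> Sp (vanishing {1..i} \<inter> {c. c k \<ge> 0})"
      using F(1) F(2)[OF g] sat_ge[OF kd] by (rule Sp_Int)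
    then show ?thesis
    proof (induction rule: Sp_induct)
      case (gen s c)
      then have "M c * std g \<in> V k" using J g by (intro V_step_gen) auto
      then show ?case using V_Q[of "M c * std g" k s] by (simp add: mult.assoc)
    next
      case zero show ?case using V_sum[of "{}"] by simp
    next
      case (diff u v) then show ?case unfolding V_def by (simp add: left_diff_distrib additive_span.diff)
    qed
  qed
  then show ?thesis unfolding eq by (rule V_sum)
qed

section \<open>Lowest components and their lifts\<close>

text \<open>These are the \<open>l < k\<close> for which \<open>x_l\<close> occurs in
  \<open>M (col S k)\<close>. Column \<open>k\<close> vanishes on the other indices
  \<open>rest\<close>, whose coordinates can therefore separate standard monomials modulo the
  ratio.\<close>

definition nbs :: "nat set" where "nbs = {l\<in>{1..i}. exch S l k \<noteq> 0}"
definition rest :: "nat set" where "rest = {1..i} - nbs"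

lemma k_rest: "k \<notin> rest" unfolding rest_def using k_def by auto

definition only :: "nat set \<Rightarrow> (nat \<Rightarrow> int) \<Rightarrow> nat \<Rightarrow> int" where
  "only I c = (\<lambda>l. if l \<in> I then c l else 0)"

lemma only_supported: "only I c \<in> supported I"
  by (simp add: only_def supported_def)

lemma only_exps: "e \<in> nonneg_exps i \<Longrightarrow> only I e \<in> nonneg_exps i"
  by (simp add: only_def nonneg_exps_def)

lemma pr0_Z_nbs:
  assumes e: "e \<in> nonneg_exps i" "e \<in> supported nbs" shows "\<exists>s. pr0 (Z e) = Q s * M (- e)"
proof -
  have "lead (\<lambda>c. c k) (- e) (Z e)"
  proof (rule lead_mono_P[OF kd i_n i_n e(1)])
    fix j assume j: "j \<in> {1..i}" "e j \<noteq> 0"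
    then have "exch S j k \<noteq> 0" using e(2) by (auto simp: supported_def nbs_def)
    moreover have jn: "j \<in> {1..n}" "j < k" using j i_n k_def by auto
    ultimately have "exch S k j > 0" using exch_sign[OF S jn(1) k] order'[OF jn(1) k jn(2)] by force
    then show "lead (\<lambda>c. c k) (- unit_vector j) (z j)" using jn k by (intro lead_z_neighbour) auto
  qed
  moreover have "(- e) k = 0" using e(1) k_def by (auto simp: nonneg_exps_def)
  ultimately show ?thesis using lead_pr[OF kd, of "- e" "Z e"] by metis
qed

lemma Z_split: "\<exists>s. Z (a + c) = Q s * (Z a * Z c)"
proof -
  interpret F: frame qh "2*n" Z "form (P n)" by (rule good_frame[OF good_P]) simp
  show ?thesis by (rule exI[of _ "- form (P n) a c"]) (simp add: F.M_mult)
qed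

lemma M_prod3: "\<exists>s. M a * (M b * M c) = Q s * M (a + b + c)"
  by (rule exI[of _ "form S a b + form S (a + b) c"])
     (simp only: M_mult_left M_mult[of "a + b"] Q_mult_left)

text \<open>At \<open>x_k = 0\<close> the neighbour part of \<open>std g\<close> degenerates to the
  Laurent monomial with exponent \<open>only nbs g\<close>, which joins the coefficient.\<close>

lemma pr0_std_split:
  assumes g: "g \<in> supported {1..i}"
  shows "\<exists>s. M c * pr0 (std g) = Q s * (M (c + only nbs g) * pr0 (std (only rest g)))"
proof -
  define e where "e = neg g"
  have e: "e \<in> nonneg_exps i" unfolding e_def using neg_exps[OF g] by simp
  have "e = only nbs e + only rest e"
    using e by (auto simp: only_def rest_def nonneg_exps_def nbs_def fun_eq_iff)
  then obtain s1 where s1: "Z e = Q s1 * (Z (only nbs e) * Z (only rest e))" using Z_split by metis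
  have nb: "nbs \<subseteq> {1..i}" "rest \<subseteq> {1..i}" by (auto simp: nbs_def rest_def)
  note z1 = Z_nonneg[OF only_exps[OF e]]
  obtain s2 where s2: "pr0 (Z (only nbs e)) = Q s2 * M (- only nbs e)"
    using pr0_Z_nbs[OF only_exps[OF e] only_supported] by blast
  have "pr0 (Z e) = Q s1 * pr0 (Z (only nbs e) * Z (only rest e))"
    unfolding s1 using Sp_mult[OF z1 z1, of UNIV] by (intro pr_Q sat_eq kd) simp
  also have "\<dots> = Q (s1 + s2) * (M (- only nbs e) * pr0 (Z (only rest e)))"
    unfolding pr0_mult[OF z1 z1] s2 by (simp add: mult.assoc)
  finally have pz: "pr0 (Z e) = Q (s1 + s2) * (M (- only nbs e) * pr0 (Z (only rest e)))" .
  have r: "only rest g \<in> supported {1..i}" using only_supported[of rest g] nb by (auto simp: supported_def)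
  have ne: "neg (only rest g) = only rest e" by (auto simp: neg_def only_def e_def)
  have ex: "c + pos g + - only nbs e = c + only nbs g + pos (only rest g)"
  proof
    fix l show "(c + pos g + - only nbs e) l = (c + only nbs g + pos (only rest g)) l"
      using g by (cases "l \<in> {1..i}") (auto simp: pos_def neg_def only_def e_def rest_def nbs_def supported_def)
  qed
  obtain s3 where s3: "M c * (M (pos g) * M (- only nbs e)) = Q s3 * M (c + only nbs g + pos (only rest g))"
    using M_prod3[of c "pos g" "- only nbs e"] unfolding ex by blast
  have "M c * pr0 (std g) = Q (s1 + s2) * (M c * (M (pos g) * M (- only nbs e)) * pr0 (Z (only rest e)))"
    unfolding pr0_std[OF g] e_def[symmetric] pz
    by (simp only: Q_left_comm[of "M _"] mult.assoc)
  also have "\<dots> = Q (s1 + s2 + s3) * (M (c + only nbs g + pos (only rest g)) * pr0 (Z (only rest e)))"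
    unfolding s3 by (simp add: mult.assoc)
  also have "M (c + only nbs g + pos (only rest g)) =
      Q (- form S (c + only nbs g) (pos (only rest g))) * (M (c + only nbs g) * M (pos (only rest g)))"
    by (simp add: M_mult)
  finally show ?thesis unfolding pr0_std[OF r] ne by (auto simp: mult.assoc)
qed

definition coeffs :: "int \<Rightarrow> (nat \<Rightarrow> int) set" where
  "coeffs t = {c. (\<forall>l\<in>rest. c l = 0) \<and> c k = t}"

abbreviation "lowest t \<equiv> additive_span {r * pr0 (std g) | r g. r \<in> Sp (coeffs t) \<and> g \<in> supported rest}"

lemma lowest_Q: "x \<in> lowest t \<Longrightarrow> Q s * x \<in> lowest t"
  by (rule span_Q)

lemma component_lowest:
  assumes y: "y \<in> V i" "y \<in> Sp {c. c k \<ge> t}"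
  shows "pr {c. c k = t} y \<in> lowest t"
proof -
  obtain J F where J: "finite J" "J \<subseteq> supported {1..i}" and F: "\<And>g. F g \<in> Sp (vanishing {1..i})"
    "\<And>g. g \<in> J \<Longrightarrow> F g \<in> Sp {c. c k \<ge> t}" and eq: "y = (\<Sum>g\<in>J. F g * std g)"
    by (rule V_family_degree[OF y]) blast
  have U: "F g * std g \<in> Sp UNIV" if "g \<in> J" for g
    using Sp_mult[OF F(1) std_nonneg, of g UNIV] J that by auto
  have "pr {c. c k = t} y = (\<Sum>g\<in>J. pr {c. c k = t} (F g * std g))"
    unfolding eq using U by (intro pr_sum sat_eq kd)
  also have "\<dots> = (\<Sum>g\<in>J. pr {c. c k = t} (F g) * pr0 (std g))"
    using pr_mult_low[OF kd F(2) std_nonneg] J by (intro sum.cong refl) auto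
  also have "\<dots> \<in> lowest t"
  proof (rule additive_span_sum)
    fix g assume g: "g \<in> J"
    have gs: "g \<in> supported {1..i}" using g J by auto
    have "pr {c. c k = t} (F g) \<in> Sp (vanishing {1..i} \<inter> {c. c k = t})"
      by (rule pr_mem(1)[OF sat_eq[OF kd] F(1)])
    then show "pr {c. c k = t} (F g) * pr0 (std g) \<in> lowest t"
    proof (induction rule: Sp_induct)
      case (gen s c)
      obtain s' where s': "M c * pr0 (std g) = Q s' * (M (c + only nbs g) * pr0 (std (only rest g)))"
        using pr0_std_split[OF gs] by blast
      have "c + only nbs g \<in> coeffs t"
        unfolding coeffs_def rest_def only_def nbs_def using gen k_def by (auto simp: vanishing_def)
      then have "M (c + only nbs g) * pr0 (std (only rest g)) \<in> lowest t"
        using only_supported[of rest g] by (intro additive_span.gen) (auto intro!: Sp_M)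
      then show ?case using lowest_Q[of _ t "s + s'"] by (simp add: mult.assoc s')
    next
      case zero show ?case by (simp add: additive_span.zero)
    next
      case (diff u v) then show ?case by (simp add: left_diff_distrib additive_span.diff)
    qed
  qed
  finally show ?thesis .
qed

text \<open>Before step \<open>k\<close> the variables \<open>x_k\<close> and
  \<open>z 1, ..., z i\<close> belong to one cluster, that of \<open>P i\<close>, and so commute up
  to powers of \<open>qh\<close>. Taking lowest components transfers this to
  \<open>pr0 (Z e)\<close>.\<close>

lemma commute_xk:
  assumes e: "e \<in> nonneg_exps i"
  shows "\<exists>s. M (\<lambda>l. t * unit_vector k l) * pr0 (Z e) = Q s * (pr0 (Z e) * M (\<lambda>l. t * unit_vector k l))"
proof -
  let ?x = "\<lambda>l. t * unit_vector k l"
  interpret F: frame qh "2*n" "mono (P i)" "form (P i)" by (rule good_frame[OF good_P[OF i_n]])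
  obtain s1 where s1: "Z e = Q s1 * mono (P i) e"
    using mono_proportional[of e "P n" "P i"] e i_n cluster_P[of n] cluster_P[of i]
    by (fastforce simp: nonneg_exps_def)
  obtain s2 where s2: "M ?x = Q s2 * mono (P i) ?x"
    using mono_proportional[of ?x S "P i"] cluster_P[of i] k_def
    by (fastforce simp: unit_vector_def)
  define s where "s = 2 * form (P i) ?x e"
  have c: "M ?x * Z e = Q s * (Z e * M ?x)"
    unfolding s1 s2 using F.M_comm[of ?x e]
    by (simp add: mult.assoc Q_left_comm[of "mono (P i) _"] s_def algebra_simps)
  have x: "M ?x \<in> Sp {c. c k \<ge> t}" "pr {c. c k = t} (M ?x) = M ?x"
    by (auto intro!: Sp_M pr_id[OF sat_eq[OF kd], of _ "{?x}"] simp: unit_vector_def)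
  note ze = Z_nonneg[OF e]
  have "M ?x * pr0 (Z e) = pr {c. c k = t + 0} (M ?x * Z e)"
    using pr_mult_low[OF kd x(1) ze] x(2) by simp
  also have "\<dots> = Q s * pr {c. c k = t + 0} (Z e * M ?x)"
    unfolding c using Sp_mult[OF ze x(1), of UNIV] by (intro pr_Q sat_eq kd) simp
  also have "pr {c. c k = t + 0} (Z e * M ?x) = pr0 (Z e) * M ?x"
    using pr_mult_low[OF kd ze x(1)] x(2) by simp
  finally show ?thesis by blast
qed

text \<open>Coefficients may contain negative powers of neighbours \<open>x_l\<close>, and these are
  lifted to powers of \<open>z l\<close>, with the same value at \<open>x_k = 0\<close>. The lift
  need not be a combination of standard monomials by its form, hence the claim of membership in
  \<open>U i\<close> only.\<close>

lemma lift_lowest: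
  assumes "W \<in> lowest t"
  shows "\<exists>u. u \<in> U i \<and> u \<in> Sp {c. c k \<ge> 0} \<and> W = pr0 u * M (\<lambda>l. t * unit_vector k l)"
  using assms
proof (induction rule: additive_span.induct)
  case (gen x)
  let ?x = "\<lambda>l. t * unit_vector k l"
  obtain r g where rg: "x = r * pr0 (std g)" "r \<in> Sp (coeffs t)" "g \<in> supported rest" using gen by auto
  have gi: "g \<in> supported {1..i}" using rg(3) by (auto simp: supported_def rest_def)
  have "\<exists>u. u \<in> U i \<and> u \<in> Sp {c. c k \<ge> 0} \<and> r * pr0 (std g) = pr0 u * M ?x"
    using rg(2)
  proof (induction rule: Sp_induct)
    case (gen s c)
    \<comment> \<open>The negative exponents of \<open>c\<close> at neighbours are collected in
      \<open>e\<close> and realized by \<open>Z e\<close>, whose value at \<open>x_k = 0\<close> is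
      \<open>M (- e)\<close> up to a power of \<open>qh\<close>. The remaining exponent
      \<open>a\<close> is nonnegative on \<open>{1..i}\<close> and 0 at \<open>k\<close>.\<close>
    define e where "e = neg (only nbs c)"
    define a where "a = c - ?x + e"
    have e: "e \<in> nonneg_exps i" "e \<in> supported nbs"
      unfolding e_def using only_supported[of nbs c]
      by (auto intro: neg_exps simp: nbs_def neg_def supported_def nonneg_exps_def)
    have c: "c k = t" "\<And>l. l \<in> rest \<Longrightarrow> c l = 0" using gen by (auto simp: coeffs_def)
    have "e k = 0" using e(1) k_def by (simp add: nonneg_exps_def)
    then have ak: "a k = 0" using c(1) by (simp add: a_def unit_vector_def)
    have al: "a l \<ge> 0" if l: "l \<in> {1..i}" for l
    proof -
      have "l \<noteq> k" using l k_def by auto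
      then show ?thesis using c(2)[of l] l
        by (cases "l \<in> nbs") (simp_all add: a_def e_def neg_def only_def rest_def unit_vector_def)
    qed
    define u where "u = M a * (Z e * std g)"
    have stdU: "std g \<in> U i" using V_U[OF i_n] V_gen[OF Sp_1 gi] by (auto simp: vanishing_def)
    have uU: "u \<in> U i" unfolding u_def using al mono_P_U[OF i_n i_n e(1)] U_mono[OF i_n] stdU i_n
      by (intro U_mult U_M) auto
    have ma: "M a \<in> Sp {c. c k = 0}" using ak by (intro Sp_M) simp
    have zs: "Z e * std g \<in> Sp {c. c k \<ge> 0}" by (rule Sp_mult[OF Z_nonneg[OF e(1)] std_nonneg[OF gi]]) auto
    have u0: "u \<in> Sp {c. c k \<ge> 0}" unfolding u_def by (rule Sp_mult[OF ma zs]) auto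
    obtain s1 where s1: "pr0 (Z e) = Q s1 * M (- e)" using pr0_Z_nbs[OF e] by blast
    have "pr0 u = M a * (pr0 (Z e) * pr0 (std g))"
      unfolding u_def by (simp only: pr0_mult[OF deg0_nonneg[OF ma] zs] pr0_id[OF ma]
          pr0_mult[OF Z_nonneg[OF e(1)] std_nonneg[OF gi]])
    also have "\<dots> = Q s1 * (M a * M (- e) * pr0 (std g))"
      unfolding s1 by (simp only: mult.assoc Q_left_comm[of "M a"])
    also have "M a * M (- e) = Q (form S a (- e)) * M (c - ?x)" by (simp add: M_mult a_def)
    finally have pu: "pr0 u = Q (s1 + form S a (- e)) * (M (c - ?x) * pr0 (std g))" by (simp add: mult.assoc)
    obtain s2 where s2: "M ?x * pr0 (Z (neg g)) = Q s2 * (pr0 (Z (neg g)) * M ?x)"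
      using commute_xk[OF neg_exps[OF gi]] by blast
    have "M ?x * pr0 (std g) = M ?x * M (pos g) * pr0 (Z (neg g))" unfolding pr0_std[OF gi] by (simp add: mult.assoc)
    also have "\<dots> = Q (2 * form S ?x (pos g)) * (M (pos g) * (M ?x * pr0 (Z (neg g))))"
      by (simp only: M_comm[of ?x "pos g"] mult.assoc)
    also have "\<dots> = Q (2 * form S ?x (pos g) + s2) * (pr0 (std g) * M ?x)"
      unfolding s2 pr0_std[OF gi] by (simp only: Q_left_comm[of "M (pos g)"] Q_mult_left mult.assoc)
    finally have mx: "M ?x * pr0 (std g) = Q (2 * form S ?x (pos g) + s2) * (pr0 (std g) * M ?x)" .
    have "M c = Q (- form S (c - ?x) ?x) * (M (c - ?x) * M ?x)" by (simp add: M_mult)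
    then have "M c * pr0 (std g) = Q (- form S (c - ?x) ?x) * (M (c - ?x) * (M ?x * pr0 (std g)))"
      by (simp add: mult.assoc)
    also have "\<dots> = Q (- form S (c - ?x) ?x + (2 * form S ?x (pos g) + s2)) * (M (c - ?x) * pr0 (std g) * M ?x)"
      unfolding mx by (simp only: Q_left_comm[of "M _"] Q_mult_left mult.assoc)
    finally obtain s3 where s3: "M c * pr0 (std g) = Q s3 * (M (c - ?x) * pr0 (std g) * M ?x)" by blast
    define s' where "s' = s + s3"
    have s': "Q s * M c * pr0 (std g) = Q s' * (M (c - ?x) * pr0 (std g) * M ?x)"
      by (simp only: mult.assoc[of "Q s"] s3 Q_mult_left s'_def)
    let ?q = "s' - (s1 + form S a (- e))"
    have "pr0 (Q ?q * u) = Q ?q * pr0 u" by (rule pr_Q[OF sat_eq[OF kd] Sp_UNIV[OF u0]])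
    also have "\<dots> = Q s' * (M (c - ?x) * pr0 (std g))" unfolding pu by simp
    finally have "pr0 (Q ?q * u) * M ?x = Q s * M c * pr0 (std g)" unfolding s' by (simp add: mult.assoc)
    then show ?case using U_Q[OF i_n uU, of ?q] u0 by (intro exI[of _ "Q ?q * u"]) simp
  next
    case zero
    show ?case using U_0[OF i_n] by (intro exI[of _ 0]) (simp add: sat_eq[OF kd])
  next
    case (diff v w)
    then obtain u u' where u: "u \<in> U i" "u \<in> Sp {c. c k \<ge> 0}" "v * pr0 (std g) = pr0 u * M ?x"
      "u' \<in> U i" "u' \<in> Sp {c. c k \<ge> 0}" "w * pr0 (std g) = pr0 u' * M ?x" by blast
    then show ?case using U_diff[OF i_n u(1,4)] Sp_diff[OF u(2,5)]
      pr_diff[OF sat_eq[OF kd] Sp_UNIV[OF u(2)] Sp_UNIV[OF u(5)], of 0]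
      by (intro exI[of _ "u - u'"]) (simp add: left_diff_distrib)
  qed
  then show ?case unfolding rg(1) .
next
  case zero
  show ?case using U_0[OF i_n] by (intro exI[of _ 0]) (simp add: sat_eq[OF kd])
next
  case (diff v w)
  let ?x = "\<lambda>l. t * unit_vector k l"
  from diff obtain u u' where u: "u \<in> U i" "u \<in> Sp {c. c k \<ge> 0}" "v = pr0 u * M ?x"
    "u' \<in> U i" "u' \<in> Sp {c. c k \<ge> 0}" "w = pr0 u' * M ?x" by blast
  then show ?case using U_diff[OF i_n u(1,4)] Sp_diff[OF u(2,5)]
    pr_diff[OF sat_eq[OF kd] Sp_UNIV[OF u(2)] Sp_UNIV[OF u(5)], of 0]
    by (intro exI[of _ "u - u'"]) (simp add: left_diff_distrib)
qed

text \<open>Setting \<open>x\<^sub>k = 0\<close> turns the neighbours of \<open>k\<close> below \<open>k\<close> into units and leaves the remaining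
  standard monomials independent even modulo \<open>A.r t\<close>; so a quotient by \<open>A.r t\<close> stays in their span.\<close>

lemma lowest_quotient:
  assumes W: "W \<in> Sp {c. c k = - int t}" and y: "W * A.r (int t) \<in> lowest (- int t)"
  shows "W \<in> lowest (- int t)"
proof -
  let ?q = "A.r (int t)"
  have "\<exists>J F. finite J \<and> J \<subseteq> supported rest \<and> (\<forall>g. F g \<in> Sp (coeffs (- int t))) \<and>
      (\<forall>g. g \<notin> J \<longrightarrow> F g = 0) \<and> W * ?q = (\<Sum>g\<in>J. F g * pr0 (std g))"
    using y by (intro span_family) (auto intro: Sp_diff)
  then obtain J F where J: "finite J" "J \<subseteq> supported rest" and F: "\<And>g. F g \<in> Sp (coeffs (- int t))"
    and eq: "W * ?q = (\<Sum>g\<in>J. F g * pr0 (std g))" by blast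
  have Ji: "g \<in> supported {1..i}" if "g \<in> J" for g using that J(2) by (auto simp: supported_def rest_def)
  have qY: "?q \<in> Sp A.Y" by (rule A.r_nonneg_Y) simp
  have comm: "?q * pr0 (std g) = pr0 (std g) * ?q" if "g \<in> J" for g
    by (rule A.r_comm[OF pr0_mem[OF std_nonneg[OF Ji[OF that]]]])
  have sep: "\<exists>l\<in>insert k rest. g l \<noteq> h l" if "g \<in> J" "h \<in> J" "g \<noteq> h" for g h
    using supported_separated[of g rest h] that J by blast
  have "\<exists>G. \<forall>g\<in>J. G g \<in> Sp {c. \<forall>l\<in>insert k rest. c l = (if l = k then - int t else 0)} \<and> F g = G g * ?q"
  proof (rule division[OF frozen_degree[OF i_n] J(1), of "insert k rest" F _ "\<lambda>g. g" "\<lambda>g. pr0 (std g)" ?q W])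
    show "insert k rest \<subseteq> {1..2*n}" using k2 i_n by (auto simp: rest_def)
    show "F g \<in> Sp {c. \<forall>l\<in>insert k rest. c l = (if l = k then - int t else 0)}" for g
      by (rule Sp_mono[OF F]) (auto simp: coeffs_def)
    show "lead (frozen_degree i) g (pr0 (std g))" if "g \<in> J" for g by (rule lead_pr0_std[OF Ji[OF that]])
    show "frozen_degree i g = 0" if "g \<in> J" for g by (rule frozen_degree_supported[OF i_n Ji[OF that]])
    have "frozen_degree i (\<lambda>l. s * exch S l k) = 0" for s
      unfolding frozen_degree_def using k k_def i_n by (intro sum.neutral) (auto simp: principal)
    then show "?q \<in> Sp {c. frozen_degree i c = 0 \<and> (\<forall>l\<in>insert k rest. c l = 0)}"
      using A.b_k by (intro Sp_mono[OF qY]) (auto simp: rest_def nbs_def)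
    show "?q * M g = M g * ?q" if "g \<in> J" for g
      using supported_k[OF Ji[OF that]] by (intro A.r_comm_M) simp
    show "W \<in> Sp UNIV" by (rule Sp_UNIV[OF W])
  qed (use eq comm sep in auto)
  then obtain G where G: "\<And>g. g \<in> J \<Longrightarrow> G g \<in> Sp {c. \<forall>l\<in>insert k rest. c l = (if l = k then - int t else 0)}"
    "\<And>g. g \<in> J \<Longrightarrow> F g = G g * ?q" by blast
  have "W * ?q = (\<Sum>g\<in>J. G g * pr0 (std g)) * ?q"
    unfolding eq sum_distrib_right using G(2) comm by (intro sum.cong refl) (simp add: mult.assoc)
  then have "W = (\<Sum>g\<in>J. G g * pr0 (std g))" by simp
  also have "\<dots> \<in> lowest (- int t)"
  proof (rule additive_span_sum)
    fix g assume g: "g \<in> J"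
    have "G g \<in> Sp (coeffs (- int t))"
      using k_rest by (intro Sp_mono[OF G(1)[OF g]]) (auto simp: coeffs_def)
    then show "G g * pr0 (std g) \<in> lowest (- int t)" using g J by (intro additive_span.gen) auto
  qed
  finally show ?thesis .
qed

lemma V_times_z_gen:
  assumes g: "g \<in> supported {1..i}" and c: "c \<in> vanishing {1..i}" "c k = 0"
  shows "M c * std g * z k ^ t \<in> V k"
proof -
  interpret F: frame qh "2*n" Z "form (P n)" by (rule good_frame[OF good_P]) simp
  define h where "h = g - (\<lambda>l. int t * unit_vector k l)"
  have gk: "g k = 0" using supported_k[OF g] by simp
  have ph: "pos h = pos g" "neg h = neg g + (\<lambda>l. int t * unit_vector k l)"
    using gk by (auto simp: h_def pos_def neg_def unit_vector_def fun_eq_iff)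
  have h: "h \<in> supported {1..k}" using g k_def by (auto simp: h_def supported_def unit_vector_def)
  have c': "c \<in> vanishing {1..k}" using c k_def by (auto simp: vanishing_def le_Suc_eq)
  have "z k = Z (unit_vector k)" using k cluster_P[of n k] by (simp add: seed_monomial_unit)
  then have "z k ^ t = Z (\<lambda>l. int t * unit_vector k l)" using F.M_powi[of "unit_vector k" "int t"] by simp
  then have "Z (neg g) * z k ^ t = Q (form (P n) (neg g) (\<lambda>l. int t * unit_vector k l)) * Z (neg h)"
    unfolding ph by (simp add: F.M_mult)
  then have "M c * std g * z k ^ t = Q (form (P n) (neg g) (\<lambda>l. int t * unit_vector k l)) * (M c * std h)"
    unfolding std_def ph(1) by (simp only: mult.assoc Q_left_comm[of "M _"])
  then show ?thesis using V_Q[OF V_gen[OF Sp_M[OF c'] h]] by simp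
qed

text \<open>The lift \<open>u\<close> of \<open>W\<close> in \<open>U i\<close> is expanded into
  standard monomials by the induction hypothesis. Multiplication by \<open>z k ^ t\<close> then
  supplies both the \<open>x_k\<close>-degree \<open>- int t\<close> and the ratio.\<close>

lemma lift_component:
  assumes W: "W \<in> lowest (- int t)" and IH: "U i \<subseteq> V i"
  shows "\<exists>w. w \<in> V k \<and> w \<in> Sp {c. c k \<ge> - int t} \<and> pr {c. c k = - int t} w = W * A.r (int t)"
proof -
  obtain u where u: "u \<in> U i" "u \<in> Sp {c. c k \<ge> 0}" "W = pr0 u * M (\<lambda>l. - int t * unit_vector k l)"
    using lift_lowest[OF W] by blast
  have "u \<in> V i" using u(1) IH by blast
  obtain J F where J: "finite J" "J \<subseteq> supported {1..i}" and F: "\<And>g. F g \<in> Sp (vanishing {1..i})"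
    "\<And>g. g \<in> J \<Longrightarrow> F g \<in> Sp {c. c k \<ge> 0}" and eq: "u = (\<Sum>g\<in>J. F g * std g)"
    by (rule V_family_degree[OF \<open>u \<in> V i\<close> u(2)]) blast
  \<comment> \<open>Positive powers of \<open>x_k\<close> in the coefficients are dropped. This does
    not change the value at \<open>x_k = 0\<close>, and it ensures that no term of
    \<open>u' * z k ^ t\<close> has an explicit factor \<open>x_k\<close> beside
    \<open>z k\<close>.\<close>
  define u' where "u' = (\<Sum>g\<in>J. pr0 (F g) * std g)"
  have F0: "pr0 (F g) \<in> Sp (vanishing {1..i} \<inter> {c. c k = 0})" for g
    by (rule pr_mem(1)[OF sat_eq[OF kd] F(1)])
  have F0k: "pr0 (F g) \<in> Sp {c. c k = 0}" for g by (rule Sp_mono[OF F0]) auto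
  have s0: "std g \<in> Sp {c. c k \<ge> 0}" if "g \<in> J" for g using that J by (intro std_nonneg) auto
  have n1: "F g * std g \<in> Sp {c. c k \<ge> 0}" if "g \<in> J" for g
    by (rule Sp_mult[OF F(2)[OF that] s0[OF that]]) auto
  have n2: "pr0 (F g) * std g \<in> Sp {c. c k \<ge> 0}" if "g \<in> J" for g
    by (rule Sp_mult[OF F0k s0[OF that]]) auto
  have u'0: "u' \<in> Sp {c. c k \<ge> 0}" unfolding u'_def using n2 by (rule Sp_sum)
  have "pr0 u' = (\<Sum>g\<in>J. pr0 (pr0 (F g) * std g))"
    unfolding u'_def using Sp_UNIV[OF n2] by (intro pr_sum sat_eq kd)
  also have "\<dots> = (\<Sum>g\<in>J. pr0 (F g * std g))"
    using pr0_mult[OF deg0_nonneg[OF F0k] s0] pr0_mult[OF F(2) s0] pr0_id[OF F0k]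
    by (intro sum.cong refl) simp
  also have "\<dots> = pr0 u" unfolding eq using Sp_UNIV[OF n1] by (intro pr_sum[symmetric] sat_eq kd)
  finally have pu: "pr0 u' = pr0 u" .
  define w where "w = u' * z k ^ t"
  note zk = z_power_component[OF k, of t]
  have "pr {c. c k = - int t} w = pr0 u' * pr {c. c k = - int t} (z k ^ t)"
    unfolding w_def using pr_mult_low[OF kd u'0 zk(2)] by simp
  also have "\<dots> = W * A.r (int t)" unfolding zk(1) pu u(3) by (simp add: mult.assoc)
  finally have 1: "pr {c. c k = - int t} w = W * A.r (int t)" .
  have 2: "w \<in> Sp {c. c k \<ge> - int t}" unfolding w_def by (rule Sp_mult[OF u'0 zk(2)]) auto
  have "pr0 (F g) * std g * z k ^ t \<in> V k" if g: "g \<in> J" for g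
    using F0[of g]
  proof (induction rule: Sp_induct)
    case (gen s c)
    have "M c * std g * z k ^ t \<in> V k" using gen J g by (intro V_times_z_gen) auto
    then show ?case using V_Q[of "M c * std g * z k ^ t" k s] by (simp add: mult.assoc)
  next
    case zero show ?case using V_sum[of "{}"] by simp
  next
    case (diff x y) then show ?case unfolding V_def by (simp add: left_diff_distrib additive_span.diff)
  qed
  then have "w \<in> V k" unfolding w_def u'_def sum_distrib_right by (rule V_sum)
  then show ?thesis using 1 2 by blast
qed

text \<open>The component of lowest \<open>x_k\<close>-degree is matched by an element of
  \<open>V k\<close>; by \<open>V_U\<close> the difference stays in \<open>U k\<close>, so the
  argument can be repeated until no negative degree is left.\<close>

lemma step:
  assumes IH: "U i \<subseteq> V i" shows "U k \<subseteq> V k"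
proof
  fix y assume y: "y \<in> U k"
  have Uk: "U k \<subseteq> U i" using k_def by (intro U_mono) simp
  have "y \<in> V k" if "y \<in> U k" "y \<in> Sp {c. c k \<ge> - int t}" for y t
    using that
  proof (induction t arbitrary: y)
    case 0
    then have "y \<in> V i" using Uk IH by blast
    then show ?case using V_step_nonneg[of y] 0 by simp
  next
    case (Suc t)
    let ?t = "Suc t"
    have "y \<in> Sp UNIV" "y \<in> A.Sp' UNIV"
      using Suc.prems(1) k_def k unfolding U_def mono_mutate(1)[OF S k, symmetric] by auto
    then obtain W where W: "W \<in> Sp {c. c k = - int ?t}" "pr {c. c k = - int ?t} y = W * A.r (int ?t)"
      using A.inter_component by blast
    have "y \<in> V i" using Suc.prems(1) Uk IH by blast
    then have "W * A.r (int ?t) \<in> lowest (- int ?t)"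
      using component_lowest[of y "- int ?t"] Suc.prems(2) W(2) by simp
    then have "W \<in> lowest (- int ?t)" by (rule lowest_quotient[OF W(1)])
    then obtain w where w: "w \<in> V k" "w \<in> Sp {c. c k \<ge> - int ?t}" "pr {c. c k = - int ?t} w = W * A.r (int ?t)"
      using lift_component[OF _ IH] by blast
    have "pr {c. c k = - int ?t} (y - w) = 0"
      using pr_diff[OF sat_eq[OF kd] Sp_UNIV[OF Suc.prems(2)] Sp_UNIV[OF w(2)], of "- int ?t"] W(2) w(3) by simp
    then have "y - w \<in> Sp {c. c k \<ge> - int ?t + 1}"
      by (rule Sp_raise[OF kd Sp_diff[OF Suc.prems(2) w(2)]])
    moreover have "y - w \<in> U k" using Suc.prems(1) w(1) V_U[OF kn] by (intro U_diff[OF kn]) auto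
    ultimately have "y - w \<in> V k" by (intro Suc.IH) simp_all
    then show ?case using V_add[OF _ w(1), of "y - w"] by simp
  qed
  note main = this
  have "y \<in> Sp UNIV" using y by (simp add: U_def)
  then obtain r t where "y \<in> Sp {c. r \<le> c k \<and> c k < r + int t}" using Sp_bounds[OF kd] by blast
  then have "y \<in> Sp {c. c k \<ge> - int (nat (- r))}" by (rule Sp_mono) auto
  then show "y \<in> V k" by (rule main[OF y])
qed

end

context acyclic_seed begin

lemma U_V: "i \<le> n \<Longrightarrow> U i \<subseteq> V i"
proof (induction i)
  case 0
  show ?case
  proof
    fix y assume "y \<in> U 0"
    then have "y \<in> Sp UNIV" by (simp add: U_def)
    moreover have "std 0 = 1"
    proof -
      interpret F: frame qh "2*n" Z "form (P n)" by (rule good_frame[OF good_P]) simp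
      have "pos 0 = 0" "neg 0 = 0" by (auto simp: pos_def neg_def)
      then show ?thesis by (simp only: std_def M_0 F.M_0 mult_1_right)
    qed
    ultimately show "y \<in> V 0" using V_gen[of y 0 0] by (simp add: vanishing_def supported_def)
  qed
next
  case (Suc i)
  interpret projective_step qh n d S i "Suc i" by unfold_locales (use Suc.prems in auto)
  show ?case using Suc by (intro step) auto
qed

end

section \<open>The basis theorem\<close>

lemma subring_generated_zero: "0 \<in> subring_generated G"
  using subring_generated.diff[OF subring_generated.one subring_generated.one, of G] by simp

lemma subring_generated_add:
  assumes "u \<in> subring_generated G" "v \<in> subring_generated G" shows "u + v \<in> subring_generated G"
  using subring_generated.diff[OF assms(1) subring_generated.diff[OF subring_generated_zero assms(2)]] by simp

lemma subring_generated_sum: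
  "(\<And>i. i \<in> I \<Longrightarrow> f i \<in> subring_generated G) \<Longrightarrow> sum f I \<in> subring_generated G"
  by (induction I rule: infinite_finite_induct) (auto intro: subring_generated_zero subring_generated_add)

lemma subring_generated_power: "u \<in> subring_generated G \<Longrightarrow> u ^ k \<in> subring_generated G"
  by (induction k) (auto intro: subring_generated.intros)

lemma subring_generated_powi:
  "u \<in> subring_generated G \<Longrightarrow> inverse u \<in> subring_generated G \<Longrightarrow> u powi k \<in> subring_generated G"
  by (auto simp: power_int_def intro: subring_generated_power)

lemma subring_generated_prod_list:
  "(\<And>i. i \<in> set xs \<Longrightarrow> f i \<in> subring_generated G) \<Longrightarrow> prod_list (map f xs) \<in> subring_generated G"
  by (induction xs) (auto intro: subring_generated.intros)

lemma additive_span_le_left_span: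
  assumes "0 \<in> R" "\<And>u v. u \<in> R \<Longrightarrow> v \<in> R \<Longrightarrow> u - v \<in> R"
  shows "additive_span {r * f i | r i. r \<in> R \<and> i \<in> I} \<subseteq> left_span R f I"
proof
  fix y assume "y \<in> additive_span {r * f i | r i. r \<in> R \<and> i \<in> I}"
  then have "\<exists>J F. finite J \<and> J \<subseteq> I \<and> (\<forall>g. F g \<in> R) \<and> (\<forall>g. g \<notin> J \<longrightarrow> F g = 0) \<and>
      y = (\<Sum>g\<in>J. F g * f g)" by (rule span_family[rotated 2]) (use assms in auto)
  then obtain J F where "finite J" "J \<subseteq> I" "\<forall>g. F g \<in> R" "y = (\<Sum>g\<in>J. F g * f g)" by blast
  then show "y \<in> left_span R f I" unfolding left_span_def by blast
qed

context acyclic_seed begin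

lemma ZP_eq: "ZP n qh S = Sp (vanishing {1..n})"
proof
  let ?V = "vanishing {1..n}"
  show "ZP n qh S \<subseteq> Sp ?V"
  proof
    fix y assume "y \<in> ZP n qh S"
    then show "y \<in> Sp ?V" unfolding ZP_def
    proof induction
      case (gen g)
      then consider "g = qh" | "g = inverse qh" | i where "i \<in> {n+1..2*n}" "g = cluster S i"
        | i where "i \<in> {n+1..2*n}" "g = inverse (cluster S i)" by auto
      then show ?case
      proof cases
        case 1
        then show ?thesis using Sp_gen[of 0 ?V 1] by (simp add: M_0 vanishing_def)
      next
        case 2
        then show ?thesis using Sp_gen[of 0 ?V "- 1"] by (simp add: M_0 vanishing_def power_int_minus)
      next
        case (3 i)
        then have "g = M (unit_vector i)" by (simp add: seed_monomial_unit)
        then show ?thesis using 3 by (auto intro!: Sp_M simp: vanishing_def unit_vector_def)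
      next
        case (4 i)
        then have "g = M (- unit_vector i)" by (simp add: seed_monomial_unit M_inverse[symmetric])
        then show ?thesis using 4 by (auto intro!: Sp_M simp: vanishing_def unit_vector_def)
      qed
    next
      case one show ?case by (rule Sp_1) (simp add: vanishing_def)
    next
      case (diff u v) then show ?case by (intro Sp_diff)
    next
      case (mult u v) then show ?case by (elim Sp_mult) (auto simp: vanishing_def)
    qed
  qed
  have Q: "Q s \<in> ZP n qh S" for s
    unfolding ZP_def by (rule subring_generated_powi; rule subring_generated.gen) auto
  show "Sp ?V \<subseteq> ZP n qh S"
  proof
    fix y assume "y \<in> Sp ?V"
    then show "y \<in> ZP n qh S"
    proof (induction rule: Sp_induct)
      case (gen s c)
      have "prod_list (map (\<lambda>i. cluster S i powi c i) [1..<Suc (2*n)]) \<in> ZP n qh S"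
        unfolding ZP_def
      proof (rule subring_generated_prod_list)
        fix i assume i: "i \<in> set [1..<Suc (2*n)]"
        show "cluster S i powi c i \<in> subring_generated ({qh, inverse qh} \<union> cluster S ` {n+1..2*n} \<union>
            (\<lambda>i. inverse (cluster S i)) ` {n+1..2*n})"
        proof (cases "i \<le> n")
          case True
          then have "i \<in> {1..n}" using i by (simp del: upt_Suc)
          then have "c i = 0" using gen by (simp add: vanishing_def)
          then show ?thesis by (simp add: subring_generated.one)
        next
          case False
          then show ?thesis using i by (intro subring_generated_powi; intro subring_generated.gen) auto
        qed
      qed
      then have "M c \<in> ZP n qh S" using Q unfolding seed_monomial_def ZP_def by (blast intro: subring_generated.mult)
      then show ?case using Q unfolding ZP_def by (blast intro: subring_generated.mult)
    next
      case zero show ?case unfolding ZP_def by (rule subring_generated_zero)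
    next
      case (diff u v) then show ?case unfolding ZP_def by (intro subring_generated.diff)
    qed
  qed
qed

lemma mono_head:
  assumes "e \<in> nonneg_exps n"
  shows "\<exists>s. mono S1 e = Q s * prod_list (map (\<lambda>i. cluster S1 i ^ nat (e i)) [1..<Suc n])"
proof -
  have "[1..<Suc (2*n)] = [1..<Suc n] @ [Suc n..<Suc (2*n)]"
    using upt_add_eq_append[of 1 "Suc n" n] by (simp add: mult_2)
  moreover have one: "prod_list (map (\<lambda>i. cluster S1 i powi e i) xs) = 1" if "set xs \<inter> {1..n} = {}" for xs
    using that assms by (induction xs) (auto simp: nonneg_exps_def)
  have "prod_list (map (\<lambda>i. cluster S1 i powi e i) [Suc n..<Suc (2*n)]) = 1" by (rule one) auto
  moreover have "map (\<lambda>i. cluster S1 i powi e i) [1..<Suc n] = map (\<lambda>i. cluster S1 i ^ nat (e i)) [1..<Suc n]"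
    using assms by (auto simp: nonneg_exps_def power_int_def)
  ultimately have "prod_list (map (\<lambda>i. cluster S1 i powi e i) [1..<Suc (2*n)]) =
      prod_list (map (\<lambda>i. cluster S1 i ^ nat (e i)) [1..<Suc n])" by (simp only: map_append prod_list.append mult_1_right)
  then show ?thesis unfolding seed_monomial_def by (simp only:) blast
qed

abbreviation signed :: "(nat \<Rightarrow> nat) \<times> (nat \<Rightarrow> nat) \<Rightarrow> nat \<Rightarrow> int" where
  "signed p \<equiv> \<lambda>l. int (fst p l) - int (snd p l)"

lemma signed_standard:
  assumes "p \<in> standard_exponents n"
  shows "signed p \<in> supported {1..n}" "pos (signed p) = (\<lambda>l. int (fst p l))" "neg (signed p) = (\<lambda>l. int (snd p l))"
proof -
  have z: "\<forall>l. fst p l = 0 \<or> snd p l = 0"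
  proof
    fix l show "fst p l = 0 \<or> snd p l = 0"
      using assms by (cases "l \<in> {1..n}") (auto simp: standard_exponents_def)
  qed
  show "signed p \<in> supported {1..n}" using assms by (auto simp: standard_exponents_def supported_def)
  show "pos (signed p) = (\<lambda>l. int (fst p l))"
  proof
    fix l show "pos (signed p) l = int (fst p l)"
      using z[rule_format, of l] by (auto simp: pos_def neg_def)
  qed
  show "neg (signed p) = (\<lambda>l. int (snd p l))"
  proof
    fix l show "neg (signed p) l = int (snd p l)"
      using z[rule_format, of l] by (auto simp: pos_def neg_def)
  qed
qed

lemma standard_monomial_std:
  assumes "p \<in> standard_exponents n"
  shows "\<exists>s. std (signed p) = Q s * projective_standard_monomial n qh S p"
proof -
  note s = signed_standard[OF assms]
  have "pos (signed p) \<in> nonneg_exps n" "neg (signed p) \<in> nonneg_exps n"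
    unfolding s(2,3) using assms by (auto simp: nonneg_exps_def standard_exponents_def)
  then obtain s1 s2 where "M (pos (signed p)) = Q s1 * prod_list (map (\<lambda>i. cluster S i ^ nat (pos (signed p) i)) [1..<Suc n])"
    "Z (neg (signed p)) = Q s2 * prod_list (map (\<lambda>i. cluster (P n) i ^ nat (neg (signed p) i)) [1..<Suc n])"
    using mono_head by meson
  then have "M (pos (signed p)) = Q s1 * prod_list (map (\<lambda>i. cluster S i ^ fst p i) [1..<Suc n])"
    "Z (neg (signed p)) = Q s2 * prod_list (map (\<lambda>i. cluster (P n) i ^ snd p i) [1..<Suc n])"
    unfolding s(2,3) by simp_all
  then have "std (signed p) = Q (s1 + s2) * projective_standard_monomial n qh S p"
    unfolding std_def by (cases p) (simp only: projective_standard_monomial.simps projective_variable_def fst_conv snd_conv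
        mult.assoc Q_left_comm[of "prod_list _"] Q_mult_left)
  then show ?thesis by blast
qed

text \<open>Up to powers of \<open>qh\<close> these are the elements \<open>std g\<close>, whose
  leading exponents are distinct. As before, \<open>division\<close> by 0 turns this into vanishing
  of the coefficients.\<close>

lemma standard_independent:
  "left_independent (ZP n qh S) (projective_standard_monomial n qh S) (standard_exponents n)"
  unfolding left_independent_def
proof (intro allI impI ballI)
  fix J c i
  let ?f = "projective_standard_monomial n qh S"
  assume J: "finite J" "J \<subseteq> standard_exponents n" and c: "\<forall>i\<in>J. c i \<in> ZP n qh S"
    and sum: "(\<Sum>i\<in>J. c i * ?f i) = 0" and i: "i \<in> J"
  have "\<exists>G. \<forall>p\<in>J. G p \<in> Sp {c. \<forall>l\<in>{1..n}. c l = 0} \<and> c p = G p * 0"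
  proof (rule division[OF frozen_degree[OF order_refl] J(1), of "{1..n}" c _ signed ?f 0 0])
    show "{1..n} \<subseteq> {1..2*n}" by auto
    show "c p \<in> Sp {c. \<forall>l\<in>{1..n}. c l = 0}" if "p \<in> J" for p
      using c that unfolding ZP_eq vanishing_def by blast
    show "lead (frozen_degree n) (signed p) (?f p)" if "p \<in> J" for p
    proof -
      have p: "p \<in> standard_exponents n" using that J by blast
      obtain s where "std (signed p) = Q s * ?f p" using standard_monomial_std[OF p] by blast
      then have "?f p = Q (- s) * std (signed p)" by simp
      then show ?thesis using lead_Q[OF lead_std[OF order_refl signed_standard(1)[OF p]]] by simp
    qed
    show "frozen_degree n (signed p) = 0" if "p \<in> J" for p
      using that J signed_standard(1)[of p] by (intro frozen_degree_supported) auto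
    show "\<exists>l\<in>{1..n}. signed p l \<noteq> signed q l" if "p \<in> J" "q \<in> J" "p \<noteq> q" for p q
    proof (rule ccontr)
      assume *: "\<not> ?thesis"
      have s: "p \<in> standard_exponents n" "q \<in> standard_exponents n" using that J by auto
      have "signed p l = signed q l" for l
        using * signed_standard(1)[OF s(1)] signed_standard(1)[OF s(2)]
        by (cases "l \<in> {1..n}") (auto simp: supported_def)
      then have e: "signed p = signed q" by blast
      have "int (fst p l) = int (fst q l)" "int (snd p l) = int (snd q l)" for l
        using signed_standard(2,3)[OF s(1)] signed_standard(2,3)[OF s(2)] e by (simp_all add: fun_eq_iff)
      then have "fst p = fst q" "snd p = snd q" by auto
      then show False using that(3) by (simp add: prod_eq_iff)
    qed
  qed (use sum in simp_all)
  then show "c i = 0" using i by auto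
qed

lemma V_left_span: "V n \<subseteq> left_span (ZP n qh S) (projective_standard_monomial n qh S) (standard_exponents n)"
proof -
  let ?f = "projective_standard_monomial n qh S" and ?I = "standard_exponents n" and ?R = "ZP n qh S"
  have "V n \<subseteq> additive_span {r * ?f p | r p. r \<in> ?R \<and> p \<in> ?I}"
    unfolding V_def
  proof (rule additive_span_subset, clarify)
    fix r g assume r: "r \<in> Sp (vanishing {1..n})" and g: "g \<in> supported {1..n}"
    define p where "p = (\<lambda>l. nat (g l), \<lambda>l. nat (- g l))"
    have p: "p \<in> ?I" using g by (auto simp: p_def standard_exponents_def supported_def)
    have "signed p = g" by (auto simp: p_def)
    then obtain s where "std g = Q s * ?f p" using standard_monomial_std[OF p] by auto
    then have "r * std g = (Q s * r) * ?f p" by (simp add: mult.assoc Q_left_comm[of r])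
    moreover have "Q s * r \<in> ?R" using r by (simp add: ZP_eq)
    ultimately have "r * std g \<in> {r * ?f p | r p. r \<in> ?R \<and> p \<in> ?I}" using p by blast
    then show "r * std g \<in> additive_span {r * ?f p | r p. r \<in> ?R \<and> p \<in> ?I}" by (rule additive_span.gen)
  qed
  also have "\<dots> \<subseteq> left_span ?R ?f ?I"
    by (rule additive_span_le_left_span) (auto simp: ZP_eq Sp_diff)
  finally show ?thesis .
qed

lemma algebra_upper_bound: "quantum_cluster_algebra n qh S \<subseteq> upper_bound S"
  unfolding quantum_cluster_algebra_def
proof (rule subring_upper_bound[OF S], rule Un_least)
  show "ZP n qh S \<subseteq> upper_bound S"
  proof -
    have "y \<in> U n" if "y \<in> Sp (vanishing {1..n})" for y
      using that
    proof (induction rule: Sp_induct)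
      case (gen s a)
      then show ?case by (intro U_Q U_M) (auto simp: vanishing_def)
    qed (auto simp: U_0 U_diff)
    then show ?thesis unfolding ZP_eq upper_bound_U_n by blast
  qed
  show "quantum_cluster_variables n qh S \<subseteq> upper_bound S"
    unfolding quantum_cluster_variables_def
  proof clarify
    fix ks i assume ks: "set ks \<subseteq> {1..n}" and i: "i \<in> {1..n}"
    have "cluster (fold mu ks S) i \<in> upper_bound (fold mu ks S)"
      using i by (intro cluster_upper_bound good_fold S ks) auto
    then show "cluster (fold mu ks S) i \<in> upper_bound S" using upper_bound_fold[OF S ks] by blast
  qed
qed

lemma left_span_algebra:
  "left_span (ZP n qh S) (projective_standard_monomial n qh S) (standard_exponents n) \<subseteq> quantum_cluster_algebra n qh S"
proof -
  let ?A = "subring_generated (ZP n qh S \<union> quantum_cluster_variables n qh S)"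
  have v: "cluster (fold mu ks S) i \<in> ?A" if "set ks \<subseteq> {1..n}" "i \<in> {1..n}" for ks i
    using that by (intro subring_generated.gen) (auto simp: quantum_cluster_variables_def)
  have "projective_standard_monomial n qh S p \<in> ?A" for p
  proof -
    have "prod_list (map (\<lambda>i. cluster S i ^ fst p i) [1..<Suc n]) \<in> ?A"
      using v[of "[]"] by (intro subring_generated_prod_list subring_generated_power) auto
    moreover have "prod_list (map (\<lambda>i. projective_variable n qh S i ^ snd p i) [1..<Suc n]) \<in> ?A"
      unfolding projective_variable_def projective_seed_def
      by (intro subring_generated_prod_list subring_generated_power v) auto
    ultimately show ?thesis by (cases p) (auto intro: subring_generated.mult)
  qed
  then have "(\<Sum>i\<in>J. c i * projective_standard_monomial n qh S i) \<in> ?A" if "\<forall>i\<in>J. c i \<in> ZP n qh S" for J c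
    using that by (intro subring_generated_sum subring_generated.mult) (auto intro: subring_generated.gen)
  then show ?thesis unfolding left_span_def quantum_cluster_algebra_def by auto
qed

text \<open>A circle of inclusions: the span of the standard monomials lies in the algebra, the
  algebra in the upper bound \<open>U n\<close>, this in \<open>V n\<close>, and \<open>V n\<close>
  in the span.\<close>

theorem standard_basis:
  "left_basis (ZP n qh S) (projective_standard_monomial n qh S) (standard_exponents n) (quantum_cluster_algebra n qh S)"
  unfolding left_basis_def
  using standard_independent left_span_algebra algebra_upper_bound U_V[OF order_refl] V_left_span
  unfolding upper_bound_U_n by blast

end

section \<open>The quantum torus as a toric frame\<close>

context quantum_torus_fractions begin

lemma laurent_commute: "r \<in> laurent_ring qh \<Longrightarrow> qh * r = r * qh"
  unfolding laurent_ring_def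
proof (induction rule: subring_generated.induct)
  case (gen g) then show ?case using qh_nonzero by auto
next
  case (mult u v)
  have "qh * (u * v) = (qh * u) * v" by (simp only: mult.assoc)
  also have "\<dots> = u * (qh * v)" by (simp only: mult.IH mult.assoc)
  also have "\<dots> = u * v * qh" by (simp only: mult.IH mult.assoc)
  finally show ?case .
qed (auto simp: algebra_simps)

lemma torus_commute:
  assumes "u \<in> left_span (laurent_ring qh) X (int_lattice m)" shows "qh * u = u * qh"
proof -
  obtain J c where J: "u = (\<Sum>i\<in>J. c i * X i)" "J \<subseteq> int_lattice m" "\<forall>i\<in>J. c i \<in> laurent_ring qh"
    using assms by (auto simp: left_span_def)
  have "qh * (c i * X i) = c i * X i * qh" if "i \<in> J" for i
  proof -
    have "qh * (c i * X i) = c i * (qh * X i)" using laurent_commute[of "c i"] J that by (simp add: mult.assoc[symmetric])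
    also have "\<dots> = c i * X i * qh" using qh_central[of i] J that by (auto simp: mult.assoc)
    finally show ?thesis .
  qed
  then show ?thesis unfolding J(1) by (simp add: sum_distrib_left sum_distrib_right)
qed

text \<open>The element \<open>qh\<close> commutes with the torus, and every element of the skew
  field is a fraction of torus elements.\<close>

lemma central_unit: "central_unit qh"
proof
  fix z
  obtain u v where u: "qh * u = u * qh" and v: "qh * v = v * qh" "v \<noteq> 0" and z: "z = u * inverse v"
    using fractions[of z] torus_commute by blast
  have "inverse v * qh = inverse v * (qh * v) * inverse v" using v(2) by (simp add: mult.assoc)
  also have "\<dots> = qh * inverse v" unfolding v(1) using v(2) by (simp add: mult.assoc[symmetric])
  finally show "qh * z = z * qh" unfolding z by (simp add: mult.assoc[symmetric] u) (simp add: mult.assoc)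
qed (rule qh_nonzero)

lemma powi_laurent: "qh powi s \<in> laurent_ring qh"
  unfolding laurent_ring_def by (rule subring_generated_powi; rule subring_generated.gen) simp_all

text \<open>The rules for \<open>X\<close> concern lattice vectors only, whereas exponents in a
  frame are arbitrary functions; truncation reconciles the two.\<close>

definition frame_map :: "(nat \<Rightarrow> int) \<Rightarrow> 'f" where
  "frame_map a = X (\<lambda>i. if i \<in> {1..m} then a i else 0)"

lemma span_torus:
  assumes "saturated m A" "y \<in> monomial_span qh frame_map A"
  shows "\<exists>J F. finite J \<and> J \<subseteq> A \<inter> int_lattice m \<and> (\<forall>g. F g \<in> laurent_ring qh) \<and>
    (\<forall>g. g \<notin> J \<longrightarrow> F g = 0) \<and> y = (\<Sum>g\<in>J. F g * X g)"
proof (rule span_family)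
  show "0 \<in> laurent_ring qh" unfolding laurent_ring_def by (rule subring_generated_zero)
  show "u - v \<in> laurent_ring qh" if "u \<in> laurent_ring qh" "v \<in> laurent_ring qh" for u v
    using that unfolding laurent_ring_def by (rule subring_generated.diff)
  have "{qh powi s * frame_map a |s a. a \<in> A} \<subseteq> {r * X g |r g. r \<in> laurent_ring qh \<and> g \<in> A \<inter> int_lattice m}"
  proof clarify
    fix s a assume a: "a \<in> A"
    let ?a = "\<lambda>i. if i \<in> {1..m} then a i else 0"
    have "agree m a ?a" by (simp add: agree_def)
    then have "?a \<in> A" using assms(1) a unfolding saturated_def by blast
    moreover have "?a \<in> int_lattice m" by (simp add: int_lattice_def)
    ultimately show "\<exists>r g. qh powi s * frame_map a = r * X g \<and> r \<in> laurent_ring qh \<and> g \<in> A \<inter> int_lattice m"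
      using powi_laurent unfolding frame_map_def by blast
  qed
  then show "y \<in> additive_span {r * X g |r g. r \<in> laurent_ring qh \<and> g \<in> A \<inter> int_lattice m}"
    using assms(2) additive_span_mono unfolding monomial_span_def by blast
qed

lemma frame:
  assumes "skew_symmetric m \<Lambda>" shows "frame qh m frame_map (bilinear_form m \<Lambda>)"
proof -
  interpret central_unit qh by (rule central_unit)
  show ?thesis
  proof unfold_locales
    fix a c e :: "nat \<Rightarrow> int"
    show "bilinear_form m \<Lambda> (a + c) e = bilinear_form m \<Lambda> a e + bilinear_form m \<Lambda> c e" by (rule bilinear_form_add)
    show sk: "bilinear_form m \<Lambda> a c = - bilinear_form m \<Lambda> c a" for a c by (rule bilinear_form_skew[OF assms])
    show cong: "agree m a c \<Longrightarrow> bilinear_form m \<Lambda> a e = bilinear_form m \<Lambda> c e" for a c e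
      by (rule bilinear_form_cong)
    show "frame_map a = frame_map c" if "agree m a c"
    proof -
      have "(\<lambda>i. if i \<in> {1..m} then a i else 0) = (\<lambda>i. if i \<in> {1..m} then c i else 0)"
        using that by (auto simp: agree_def fun_eq_iff)
      then show ?thesis by (simp only: frame_map_def)
    qed
    let ?r = "\<lambda>a i. if i \<in> {1..m} then a i else (0::int)"
    have l: "?r a \<in> int_lattice m" for a by (simp add: int_lattice_def)
    have ag: "agree m (?r a) a" for a by (simp add: agree_def)
    have "bilinear_form m \<Lambda> (?r a) (?r c) = bilinear_form m \<Lambda> a c"
      using cong[OF ag[of a], of "?r c"] sk[of a "?r c"] cong[OF ag[of c], of a] sk[of a c] by simp
    moreover have "(\<lambda>i. ?r a i + ?r c i) = ?r (a + c)" by (auto simp: fun_eq_iff)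
    ultimately show "frame_map a * frame_map c = Q (bilinear_form m \<Lambda> a c) * frame_map (a + c)"
      unfolding frame_map_def using product[OF l[of a] l[of c]] by simp
    \<comment> \<open>The product rule only shows that \<open>X\<close> at the zero vector is
      idempotent. Being nonzero by independence, it is 1.\<close>
    have nz: "X (?r 0) \<noteq> 0"
    proof
      assume 0: "X (?r 0) = 0"
      have "1 \<in> laurent_ring qh" unfolding laurent_ring_def by (rule subring_generated.one)
      then have "\<forall>i\<in>{?r 0}. (1::'f) = 0"
        using independent[unfolded left_independent_def, rule_format, of "{?r 0}" "\<lambda>_. 1"] l[of 0] 0 by simp
      then show False by simp
    qed
    have "bilinear_form m \<Lambda> (?r 0) (?r 0) = 0" using sk[of "?r 0" "?r 0"] by simp
    moreover have "(\<lambda>i. ?r 0 i + ?r 0 i) = ?r 0" by auto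
    ultimately have "X (?r 0) * X (?r 0) = X (?r 0)" using product[OF l[of 0] l[of 0]] by simp
    then show "frame_map 0 = 1" using nz unfolding frame_map_def by simp
  next
    fix A y assume A: "saturated m A" and y: "y \<in> monomial_span qh frame_map A" "y \<in> monomial_span qh frame_map (- A)"
    obtain I F where I: "finite I" "I \<subseteq> A \<inter> int_lattice m" "\<And>g. F g \<in> laurent_ring qh" "\<And>g. g \<notin> I \<Longrightarrow> F g = 0"
      "y = (\<Sum>g\<in>I. F g * X g)" using span_torus[OF A y(1)] by blast
    obtain J G where J: "finite J" "J \<subseteq> - A \<inter> int_lattice m" "\<And>g. G g \<in> laurent_ring qh" "\<And>g. g \<notin> J \<Longrightarrow> G g = 0"
      "y = (\<Sum>g\<in>J. G g * X g)" using span_torus[OF saturated_Compl[OF A] y(2)] by blast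
    have 1: "y = (\<Sum>g\<in>I \<union> J. F g * X g)" unfolding I(5) using I J by (intro sum.mono_neutral_left) auto
    have 2: "y = (\<Sum>g\<in>I \<union> J. G g * X g)" unfolding J(5) using I J by (intro sum.mono_neutral_left) auto
    have "(\<Sum>g\<in>I \<union> J. (F g - G g) * X g) = 0"
      using 1 2 by (simp only: left_diff_distrib sum_subtractf) simp
    moreover have "F g - G g \<in> laurent_ring qh" for g
      using I(3) J(3) unfolding laurent_ring_def by (rule subring_generated.diff)
    ultimately have "\<forall>g\<in>I \<union> J. F g - G g = 0"
      using independent[unfolded left_independent_def, rule_format, of "I \<union> J" "\<lambda>g. F g - G g"] I J by auto
    moreover have "G g = 0" if "g \<in> I" for g using that I(2) J(2,4) by blast
    ultimately have "F g = 0" if "g \<in> I" for g using that by auto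
    then show "y = 0" unfolding I(5) by simp
  qed
qed

end

theorem theorem4p10:
  fixes n :: nat
    and \<Lambda> B :: "nat \<Rightarrow> nat \<Rightarrow> int"
    and d :: "nat \<Rightarrow> int"
    and qh :: "'f::{division_ring, ring_char_0}"
    and X :: "(nat \<Rightarrow> int) \<Rightarrow> 'f"
  assumes "\<forall>j\<in>{1..n}. d j > 0"
    and "skew_symmetric n (\<lambda>i j. d i * B i j)"
    and "principal_coefficients n B"
    and "skew_symmetric (2*n) \<Lambda>"
    and "compatible n d \<Lambda> B"
    and "quantum_torus_fractions (2*n) \<Lambda> qh X"
    and "acyclic_exch n B"
    and "\<forall>i\<in>{1..n}. \<forall>j\<in>{1..n}. i > j \<longrightarrow> B i j \<ge> 0"
  defines "S \<equiv> initial_seed X \<Lambda> B"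
  shows "left_basis (ZP n qh S) (projective_standard_monomial n qh S) (standard_exponents n)
           (quantum_cluster_algebra n qh S)"
proof -
  interpret T: quantum_torus_fractions "2*n" \<Lambda> qh X by fact
  interpret T: frame qh "2*n" T.frame_map "bilinear_form (2*n) \<Lambda>" by (rule T.frame[OF assms(4)])
  interpret seed_setting qh n d by unfold_locales (use assms(1) in auto)
  have "seed_monomial n qh S = T.frame_map"
  proof (rule seed_monomial_eq[OF T.frame[OF assms(4)]])
    fix i assume i: "i \<in> {1..2*n}"
    have "(\<lambda>l. if l \<in> {1..2*n} then unit_vector i l else 0) = unit_vector i"
      using i by (auto simp: unit_vector_def)
    then show "cluster S i = T.frame_map (unit_vector i)"
      unfolding T.frame_map_def S_def initial_seed_def by (simp del: atLeastAtMost_iff)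
  next
    fix i j assume "i \<in> {1..2*n}" "j \<in> {1..2*n}"
    then show "qform S i j = bilinear_form (2*n) \<Lambda> (unit_vector i) (unit_vector j)"
      by (simp add: bilinear_form_unit S_def initial_seed_def)
  qed
  \<comment> \<open>Compatibility is given on unit vectors and extends to all exponents by
    linearity.\<close>
  moreover have "bilinear_form (2*n) \<Lambda> (\<lambda>i. B i j) a = d j * a j" if j: "j \<in> {1..n}" for j a
  proof -
    have "bilinear_form (2*n) \<Lambda> (\<lambda>i. B i j) (unit_vector i) = (if i = j then d j else 0)" if "i \<in> {1..2*n}" for i
      using assms(5) j that unfolding compatible_def by blast
    then have "(\<Sum>i=1..2*n. a i * bilinear_form (2*n) \<Lambda> (\<lambda>i. B i j) (unit_vector i)) =
        (\<Sum>i=1..2*n. if i = j then d j * a j else 0)"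
      by (intro sum.cong) auto
    then have "bilinear_form (2*n) \<Lambda> (\<lambda>i. B i j) a = (\<Sum>i=1..2*n. if i = j then d j * a j else 0)"
      by (simp only: bilinear_form_expand[of _ _ _ a])
    then show ?thesis using j by simp
  qed
  ultimately have "good_seed S"
    unfolding good_seed_def using T.frame[OF assms(4)] by (simp add: S_def initial_seed_def)
  then interpret acyclic_seed qh n d S
    using assms(3,8) by unfold_locales (auto simp: S_def initial_seed_def principal_coefficients_def)
  show ?thesis by (rule standard_basis)
qed

end
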